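(* Let $R\ge0$. Then the following statements are equivalent: (i) $V$ is nuclear. (ii) $\mathrm{T}^\bullet_R(V)$ is nuclear. (iii) $\mathcal{W}_R(V)$ is nuclear.
   Context: $\mathbb{K}=\mathbb{R}$ or $\mathbb{C}$, and $V=V_{\mathbf 0}\oplus V_{\mathbf 1}$ is a $\mathbb{Z}_2$-graded Hausdorff locally convex $\mathbb{K}$-vector space such that the projections onto $V_{\mathbf 0}$ and $V_{\mathbf 1}$ are continuous. $S_n$ acts from the right on $V^{\otimes n}$ by $(v_1\otimes\cdots\otimes v_n)\triangleleft\sigma=\pm\, v_{\sigma(1)}\otimes\cdots\otimes v_{\sigma(n)}$ for homogeneous $v_i$, where $\pm$ is the Koszul sign ($-1$ to the number of pairs $i<j$ with $\sigma(i)>\sigma(j)$ and $v_{\sigma(i)},v_{\sigma(j)}$ both odd). $\mathcal{S}_n(v)=\frac1{n!}\sum_{\sigma} v\triangleleft\sigma$, $\mathrm{S}^n(V)=\operatorname{im}\mathcal{S}_n\subseteq V^{\otimes n}$, $\mathrm{S}^0(V)=\mathbb{K}$, and $\mathrm{S}^\bullet(V)=\bigoplus_n\mathrm{S}^n(V)\subseteq\mathrm{T}^\bullet(V)=\bigoplus_n V^{\otimes n}$. For a continuous seminorm $p$ on $V$ let $p^n=p\otimes\cdots\otimes p$ be the projective tensor seminorm on $V^{\otimes n}$ ($p^0=|\cdot|$), and for $R\in\mathbb{R}$ set $p_R(v)=\sum_{n\ge0}p^n(v_n)\,n!^R$ for $v=\sum_n v_n$, $v_n\in V^{\otimes n}$.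 $\mathrm{T}^\bullet_R(V)$ is $\mathrm{T}^\bullet(V)$ with the locally convex topology defined by all $p_R$, $p$ a continuous seminorm on $V$. The locally convex space underlying the Weyl algebra, $\mathcal{W}_R(V)$, is $\mathrm{S}^\bullet(V)$ with the subspace topology from $\mathrm{T}^\bullet_R(V)$ (it does not depend on the choice of a star product). Nuclear means: for every continuous seminorm $p$ there is a continuous seminorm $q\ge p$ such that the canonical map $V_q\to V_p$ is a nuclear map of Banach spaces, where $V_p$ is the completion of $V/\ker p$ with respect to the quotient norm. *)

theory Defs
  imports
    "HOL-Analysis.Analysis"
    "HOL-Combinatorics.Permutations"
    "HOL-Library.Function_Algebras"
begin

section \<open>Scalars and locally convex spaces\<close>

text \<open>Stated with \<open>a *\<^sub>R 1\<close> for \<open>of_real a\<close>, which a class specification does not admit. The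
  second alternative says that the field is \<open>\<real>[i]\<close> with the usual absolute value; in the first
  one the norm is the absolute value anyway.\<close>

class real_or_complex = real_normed_field +
  assumes real_or_complex:
    "(\<forall>x. \<exists>a. x = a *\<^sub>R 1) \<or>
     (\<exists>i. i * i = - 1 \<and> (\<forall>x. \<exists>a b. x = a *\<^sub>R 1 + b *\<^sub>R i \<and> norm x = sqrt (a\<^sup>2 + b\<^sup>2)))"

instance real :: real_or_complex
  by standard simp

instance complex :: real_or_complex
proof
  have "x = Re x *\<^sub>R 1 + Im x *\<^sub>R \<i> \<and> norm x = sqrt ((Re x)\<^sup>2 + (Im x)\<^sup>2)" for x
    by (simp add: complex_eq_iff cmod_def)
  then show "(\<forall>x::complex. \<exists>a. x = a *\<^sub>R 1) \<or>
     (\<exists>i::complex. i * i = - 1 \<and>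
        (\<forall>x. \<exists>a b. x = a *\<^sub>R 1 + b *\<^sub>R i \<and> norm x = sqrt (a\<^sup>2 + b\<^sup>2)))"
    by (intro disjI2 exI[of _ \<i>]) (auto)
qed

text \<open>The underlying vector space is \<open>topspace X\<close>, a subspace of the ambient type.\<close>

locale locally_convex_space = vector_space sm
  for sm :: "'k::real_or_complex \<Rightarrow> 'a::ab_group_add \<Rightarrow> 'a" +
  fixes X :: "'a topology"
  assumes subspace_topspace: "subspace (topspace X)"
    and continuous_add: "continuous_map (prod_topology X X) X (\<lambda>(x, y). x + y)"
    and continuous_scale:
      "continuous_map (prod_topology euclidean X) X (\<lambda>(c, x). sm c x)"
    and locally_convex:
      "openin X U \<Longrightarrow> 0 \<in> U \<Longrightarrow>
        \<exists>W. openin X W \<and> 0 \<in> W \<and> W \<subseteq> U \<and>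
          (\<forall>x\<in>W. \<forall>y\<in>W. \<forall>t\<in>{0..1}. sm (of_real t) x + sm (of_real (1 - t)) y \<in> W)"

definition seminorm_on ::
  "('k::real_or_complex \<Rightarrow> 'a::ab_group_add \<Rightarrow> 'a) \<Rightarrow> 'a set \<Rightarrow> ('a \<Rightarrow> real) \<Rightarrow> bool" where
  "seminorm_on sm E p \<longleftrightarrow>
     (\<forall>x\<in>E. \<forall>y\<in>E. p (x + y) \<le> p x + p y) \<and> (\<forall>c. \<forall>x\<in>E. p (sm c x) = norm c * p x)"

definition continuous_seminorm ::
  "('k::real_or_complex \<Rightarrow> 'a::ab_group_add \<Rightarrow> 'a) \<Rightarrow> 'a topology \<Rightarrow> ('a \<Rightarrow> real) \<Rightarrow> bool" where
  "continuous_seminorm sm X p \<longleftrightarrow>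
     seminorm_on sm (topspace X) p \<and> continuous_map X euclideanreal p"

definition seminorm_topology ::
  "'a::ab_group_add set \<Rightarrow> ('a \<Rightarrow> real) set \<Rightarrow> 'a topology" where
  "seminorm_topology E P =
     topology_generated_by {{y\<in>E. p (y - x) < e} | p x e. p \<in> P \<and> x \<in> E \<and> 0 < e}"


section \<open>Normed spaces, quotients and completions\<close>

text \<open>Quotients and completions have equivalence classes as elements, so their operations are
  kept in a record rather than taken from a type class.\<close>

record ('k, 'b) normed_space =
  carr :: "'b set"
  zer :: 'b
  pls :: "'b \<Rightarrow> 'b \<Rightarrow> 'b"
  scl :: "'k \<Rightarrow> 'b \<Rightarrow> 'b"
  nrm :: "'b \<Rightarrow> real"

definition ndist :: "('k::real_or_complex, 'b) normed_space \<Rightarrow> 'b \<Rightarrow> 'b \<Rightarrow> real" where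
  "ndist N a b = nrm N (pls N a (scl N (- 1) b))"

primrec partial_sum ::
  "('k::real_or_complex, 'b) normed_space \<Rightarrow> (nat \<Rightarrow> 'b) \<Rightarrow> nat \<Rightarrow> 'b" where
  "partial_sum N g 0 = zer N"
| "partial_sum N g (Suc n) = pls N (partial_sum N g n) (g n)"

definition bounded_functional ::
  "('k::real_or_complex, 'b) normed_space \<Rightarrow> ('b \<Rightarrow> 'k) \<Rightarrow> bool" where
  "bounded_functional N f \<longleftrightarrow>
     (\<forall>a\<in>carr N. \<forall>b\<in>carr N. f (pls N a b) = f a + f b) \<and>
     (\<forall>c. \<forall>a\<in>carr N. f (scl N c a) = c * f a) \<and>
     (\<exists>C. \<forall>a\<in>carr N. norm (f a) \<le> C * nrm N a)"

definition dual_norm ::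
  "('k::real_or_complex, 'b) normed_space \<Rightarrow> ('b \<Rightarrow> 'k) \<Rightarrow> real" where
  "dual_norm N f = Sup {norm (f a) | a. a \<in> carr N \<and> nrm N a \<le> 1}"

definition nuclear_map ::
  "('k::real_or_complex, 'b) normed_space \<Rightarrow> ('k, 'c) normed_space \<Rightarrow> ('b \<Rightarrow> 'c) \<Rightarrow> bool" where
  "nuclear_map M N T \<longleftrightarrow>
     (\<exists>f y. (\<forall>i. bounded_functional M (f i)) \<and> (\<forall>i. y i \<in> carr N) \<and>
        summable (\<lambda>i. dual_norm M (f i) * nrm N (y i)) \<and>
        (\<forall>a\<in>carr M.
           (\<lambda>n. ndist N (T a) (partial_sum N (\<lambda>i. scl N (f i a) (y i)) n)) \<longlonglongrightarrow> 0))"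

definition ker_rel :: "'a::ab_group_add set \<Rightarrow> ('a \<Rightarrow> real) \<Rightarrow> ('a \<times> 'a) set" where
  "ker_rel E p = {(x, y). x \<in> E \<and> y \<in> E \<and> p (x - y) = 0}"

definition quotient_space ::
  "('k::real_or_complex \<Rightarrow> 'a::ab_group_add \<Rightarrow> 'a) \<Rightarrow> 'a set \<Rightarrow> ('a \<Rightarrow> real) \<Rightarrow>
     ('k, 'a set) normed_space" where
  "quotient_space sm E p =
     \<lparr>carr = E // ker_rel E p,
      zer = ker_rel E p `` {0},
      pls = (\<lambda>A B. \<Union>x\<in>A. \<Union>y\<in>B. ker_rel E p `` {x + y}),
      scl = (\<lambda>c A. \<Union>x\<in>A. ker_rel E p `` {sm c x}),
      nrm = (\<lambda>A. Inf (p ` A))\<rparr>"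

definition cauchy_seqs :: "('k::real_or_complex, 'b) normed_space \<Rightarrow> (nat \<Rightarrow> 'b) set" where
  "cauchy_seqs N =
     {s. (\<forall>n. s n \<in> carr N) \<and> (\<forall>e>0. \<exists>M. \<forall>m\<ge>M. \<forall>n\<ge>M. ndist N (s m) (s n) < e)}"

definition cauchy_rel ::
  "('k::real_or_complex, 'b) normed_space \<Rightarrow> ((nat \<Rightarrow> 'b) \<times> (nat \<Rightarrow> 'b)) set" where
  "cauchy_rel N =
     {(s, t). s \<in> cauchy_seqs N \<and> t \<in> cauchy_seqs N \<and> (\<lambda>n. ndist N (s n) (t n)) \<longlonglongrightarrow> 0}"

definition completion_space ::
  "('k::real_or_complex, 'b) normed_space \<Rightarrow> ('k, (nat \<Rightarrow> 'b) set) normed_space" where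
  "completion_space N =
     \<lparr>carr = cauchy_seqs N // cauchy_rel N,
      zer = cauchy_rel N `` {\<lambda>n. zer N},
      pls = (\<lambda>A B. \<Union>s\<in>A. \<Union>t\<in>B. cauchy_rel N `` {\<lambda>n. pls N (s n) (t n)}),
      scl = (\<lambda>c A. \<Union>s\<in>A. cauchy_rel N `` {\<lambda>n. scl N c (s n)}),
      nrm = (\<lambda>A. THE r. \<forall>s\<in>A. (\<lambda>n. nrm N (s n)) \<longlonglongrightarrow> r)\<rparr>"


section \<open>Nuclear spaces\<close>

definition seminorm_completion ::
  "('k::real_or_complex \<Rightarrow> 'a::ab_group_add \<Rightarrow> 'a) \<Rightarrow> 'a set \<Rightarrow> ('a \<Rightarrow> real) \<Rightarrow>
     ('k, (nat \<Rightarrow> 'a set) set) normed_space" where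
  "seminorm_completion sm E p = completion_space (quotient_space sm E p)"

text \<open>The continuous extension of \<open>x + ker q \<mapsto> x + ker p\<close> to the completions, for \<open>p \<le> q\<close>.\<close>

definition canonical_map ::
  "('k::real_or_complex \<Rightarrow> 'a::ab_group_add \<Rightarrow> 'a) \<Rightarrow> 'a set \<Rightarrow> ('a \<Rightarrow> real) \<Rightarrow> ('a \<Rightarrow> real) \<Rightarrow>
     (nat \<Rightarrow> 'a set) set \<Rightarrow> (nat \<Rightarrow> 'a set) set" where
  "canonical_map sm E q p A =
     (\<Union>s\<in>A. cauchy_rel (quotient_space sm E p) `` {\<lambda>n. \<Union>x\<in>s n. ker_rel E p `` {x}})"

definition nuclear_space ::
  "('k::real_or_complex \<Rightarrow> 'a::ab_group_add \<Rightarrow> 'a) \<Rightarrow> 'a topology \<Rightarrow> bool" where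
  "nuclear_space sm X \<longleftrightarrow>
     (\<forall>p. continuous_seminorm sm X p \<longrightarrow>
        (\<exists>q. continuous_seminorm sm X q \<and> (\<forall>x\<in>topspace X. p x \<le> q x) \<and>
           nuclear_map (seminorm_completion sm (topspace X) q)
             (seminorm_completion sm (topspace X) p)
             (canonical_map sm (topspace X) q p)))"


section \<open>Tensor powers\<close>

definition multilinear ::
  "('k \<Rightarrow> 'v::ab_group_add \<Rightarrow> 'v) \<Rightarrow> ('k \<Rightarrow> 'w::ab_group_add \<Rightarrow> 'w) \<Rightarrow> nat \<Rightarrow>
     ('v list \<Rightarrow> 'w) \<Rightarrow> bool" where
  "multilinear sm sm' n F \<longleftrightarrow>
     (\<forall>vs i. length vs = n \<and> i < n \<longrightarrow>
        (\<forall>x y. F (vs[i := x + y]) = F (vs[i := x]) + F (vs[i := y])) \<and>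
        (\<forall>c x. F (vs[i := sm c x]) = sm' c (F (vs[i := x]))))"

text \<open>The tensor power \<open>V\<^sup>\<otimes>\<^sup>n\<close> is realised inside the algebraic dual of the space of \<open>n\<close>-linear
  forms, \<open>v\<^sub>1 \<otimes> \<dots> \<otimes> v\<^sub>n\<close> being evaluation at \<open>(v\<^sub>1, \<dots>, v\<^sub>n)\<close>. Over a field this is the algebraic
  tensor power: the universal property is \<open>tensor_power_universal\<close> below.\<close>

type_synonym ('k, 'v) tensor = "('v list \<Rightarrow> 'k) \<Rightarrow> 'k"

definition tscale :: "'k::real_or_complex \<Rightarrow> ('k, 'v) tensor \<Rightarrow> ('k, 'v) tensor" where
  "tscale c t = (\<lambda>\<phi>. c * t \<phi>)"

definition tensor ::
  "('k::real_or_complex \<Rightarrow> 'v::ab_group_add \<Rightarrow> 'v) \<Rightarrow> 'v list \<Rightarrow> ('k, 'v) tensor" where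
  "tensor sm vs = (\<lambda>\<phi>. if multilinear sm (*) (length vs) \<phi> then \<phi> vs else 0)"

definition tensor_power ::
  "('k::real_or_complex \<Rightarrow> 'v::ab_group_add \<Rightarrow> 'v) \<Rightarrow> nat \<Rightarrow> ('k, 'v) tensor set" where
  "tensor_power sm n = module.span tscale {tensor sm vs | vs. length vs = n}"

text \<open>The projective tensor seminorm \<open>p\<^sup>n\<close>. The coefficients \<open>c\<close> can be absorbed into the vectors
  if \<open>n > 0\<close>; for \<open>n = 0\<close> they give the absolute value on \<open>V\<^sup>\<otimes>\<^sup>0\<close>, the scalars.\<close>

definition tensor_seminorm ::
  "('k::real_or_complex \<Rightarrow> 'v::ab_group_add \<Rightarrow> 'v) \<Rightarrow> ('v \<Rightarrow> real) \<Rightarrow> nat \<Rightarrow>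
     ('k, 'v) tensor \<Rightarrow> real" where
  "tensor_seminorm sm p n t =
     Inf {\<Sum>i<m. norm (c i) * prod_list (map p (vs i)) | (m::nat) c vs.
        (\<forall>i<m. length (vs i) = n) \<and> t = (\<Sum>i<m. tscale (c i) (tensor sm (vs i)))}"


section \<open>The action of the symmetric group\<close>

text \<open>Positions are counted from \<open>0\<close>. A vector \<open>0\<close> is both even and odd, but then the tensor is
  \<open>0\<close> and the sign does not matter.\<close>

definition koszul_sign ::
  "'v set \<Rightarrow> (nat \<Rightarrow> nat) \<Rightarrow> 'v list \<Rightarrow> 'k::real_or_complex" where
  "koszul_sign V1 \<sigma> vs =
     (- 1) ^ card {(i, j). i < j \<and> j < length vs \<and> \<sigma> i > \<sigma> j \<and> vs ! \<sigma> i \<in> V1 \<and> vs ! \<sigma> j \<in> V1}"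

definition is_koszul_action ::
  "('k::real_or_complex \<Rightarrow> 'v::ab_group_add \<Rightarrow> 'v) \<Rightarrow> 'v set \<Rightarrow> 'v set \<Rightarrow> nat \<Rightarrow> (nat \<Rightarrow> nat) \<Rightarrow>
     (('k, 'v) tensor \<Rightarrow> ('k, 'v) tensor) \<Rightarrow> bool" where
  "is_koszul_action sm V0 V1 n \<sigma> L \<longleftrightarrow>
     Vector_Spaces.linear tscale tscale L \<and>
     (\<forall>vs. length vs = n \<and> set vs \<subseteq> V0 \<union> V1 \<longrightarrow>
        L (tensor sm vs) = tscale (koszul_sign V1 \<sigma> vs) (tensor sm (permute_list \<sigma> vs)))"

text \<open>Such a linear map exists and is unique on \<open>V\<^sup>\<otimes>\<^sup>n\<close>, see \<open>koszul_action_exists\<close> and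
  \<open>koszul_action_unique\<close>; its values elsewhere are irrelevant.\<close>

definition koszul_action ::
  "('k::real_or_complex \<Rightarrow> 'v::ab_group_add \<Rightarrow> 'v) \<Rightarrow> 'v set \<Rightarrow> 'v set \<Rightarrow> nat \<Rightarrow> (nat \<Rightarrow> nat) \<Rightarrow>
     ('k, 'v) tensor \<Rightarrow> ('k, 'v) tensor" where
  "koszul_action sm V0 V1 n \<sigma> = (SOME L. is_koszul_action sm V0 V1 n \<sigma> L)"

definition symmetrizer ::
  "('k::real_or_complex \<Rightarrow> 'v::ab_group_add \<Rightarrow> 'v) \<Rightarrow> 'v set \<Rightarrow> 'v set \<Rightarrow> nat \<Rightarrow>
     ('k, 'v) tensor \<Rightarrow> ('k, 'v) tensor" where
  "symmetrizer sm V0 V1 n t =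
     tscale (1 / fact n) (\<Sum>\<sigma> | \<sigma> permutes {..<n}. koszul_action sm V0 V1 n \<sigma> t)"

definition symmetric_power ::
  "('k::real_or_complex \<Rightarrow> 'v::ab_group_add \<Rightarrow> 'v) \<Rightarrow> 'v set \<Rightarrow> 'v set \<Rightarrow> nat \<Rightarrow>
     ('k, 'v) tensor set" where
  "symmetric_power sm V0 V1 n = symmetrizer sm V0 V1 n ` tensor_power sm n"


section \<open>The tensor algebra and the Weyl algebra\<close>

text \<open>An element of the direct sum is the sequence of its homogeneous components.\<close>

definition gscale ::
  "'k::real_or_complex \<Rightarrow> (nat \<Rightarrow> ('k, 'v) tensor) \<Rightarrow> (nat \<Rightarrow> ('k, 'v) tensor)" where
  "gscale c t = (\<lambda>n. tscale c (t n))"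

definition tensor_algebra ::
  "('k::real_or_complex \<Rightarrow> 'v::ab_group_add \<Rightarrow> 'v) \<Rightarrow> (nat \<Rightarrow> ('k, 'v) tensor) set" where
  "tensor_algebra sm = {t. (\<forall>n. t n \<in> tensor_power sm n) \<and> finite {n. t n \<noteq> 0}}"

definition symmetric_algebra ::
  "('k::real_or_complex \<Rightarrow> 'v::ab_group_add \<Rightarrow> 'v) \<Rightarrow> 'v set \<Rightarrow> 'v set \<Rightarrow>
     (nat \<Rightarrow> ('k, 'v) tensor) set" where
  "symmetric_algebra sm V0 V1 =
     {t. (\<forall>n. t n \<in> symmetric_power sm V0 V1 n) \<and> finite {n. t n \<noteq> 0}}"

definition graded_seminorm ::
  "('k::real_or_complex \<Rightarrow> 'v::ab_group_add \<Rightarrow> 'v) \<Rightarrow> real \<Rightarrow> ('v \<Rightarrow> real) \<Rightarrow>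
     (nat \<Rightarrow> ('k, 'v) tensor) \<Rightarrow> real" where
  "graded_seminorm sm R p t =
     (\<Sum>n | t n \<noteq> 0. tensor_seminorm sm p n (t n) * fact n powr R)"

definition tensor_algebra_topology ::
  "('k::real_or_complex \<Rightarrow> 'v::ab_group_add \<Rightarrow> 'v) \<Rightarrow> 'v topology \<Rightarrow> real \<Rightarrow>
     (nat \<Rightarrow> ('k, 'v) tensor) topology" where
  "tensor_algebra_topology sm X R =
     seminorm_topology (tensor_algebra sm)
       (graded_seminorm sm R ` {p. continuous_seminorm sm X p})"

definition weyl_algebra_topology ::
  "('k::real_or_complex \<Rightarrow> 'v::ab_group_add \<Rightarrow> 'v) \<Rightarrow> 'v topology \<Rightarrow> 'v set \<Rightarrow> 'v set \<Rightarrow> real \<Rightarrow>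
     (nat \<Rightarrow> ('k, 'v) tensor) topology" where
  "weyl_algebra_topology sm X V0 V1 R =
     subtopology (tensor_algebra_topology sm X R) (symmetric_algebra sm V0 V1)"

definition proj_along :: "'v::ab_group_add set \<Rightarrow> 'v set \<Rightarrow> 'v \<Rightarrow> 'v" where
  "proj_along A B v = (THE a. a \<in> A \<and> v - a \<in> B)"

locale graded_locally_convex_space = locally_convex_space sm X
  for sm :: "'k::real_or_complex \<Rightarrow> 'v::ab_group_add \<Rightarrow> 'v" and X +
  fixes V0 V1 :: "'v set"
  assumes topspace_UNIV: "topspace X = UNIV"
    and hausdorff: "Hausdorff_space X"
    and subspace_V0: "subspace V0"
    and subspace_V1: "subspace V1"
    and V0_Int_V1: "V0 \<inter> V1 = {0}"
    and V0_plus_V1: "\<exists>a\<in>V0. \<exists>b\<in>V1. v = a + b"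
    and continuous_proj_V0: "continuous_map X X (proj_along V0 V1)"
    and continuous_proj_V1: "continuous_map X X (proj_along V1 V0)"


section \<open>Well-definedness\<close>

lemma vector_space_tscale: "vector_space (tscale :: 'k::real_or_complex \<Rightarrow> ('k, 'v) tensor \<Rightarrow> _)"
  by standard (simp_all add: tscale_def fun_eq_iff algebra_simps)

lemma vector_space_gscale: "vector_space (gscale :: 'k::real_or_complex \<Rightarrow> (nat \<Rightarrow> ('k, 'v) tensor) \<Rightarrow> _)"
  by standard (simp_all add: gscale_def tscale_def fun_eq_iff algebra_simps)

lemma multilinear_tensor: "multilinear sm tscale n (tensor sm)"
  unfolding multilinear_def
  by (auto simp: tensor_def tscale_def fun_eq_iff multilinear_def)

lemma tensor_power_universal:
  fixes sm :: "'k::real_or_complex \<Rightarrow> 'v::ab_group_add \<Rightarrow> 'v"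
    and sm' :: "'k \<Rightarrow> 'w::ab_group_add \<Rightarrow> 'w"
  assumes "vector_space sm'" and F: "multilinear sm sm' n F"
  shows "\<exists>L. Vector_Spaces.linear tscale sm' L \<and> (\<forall>vs. length vs = n \<longrightarrow> L (tensor sm vs) = F vs)"
proof -
  interpret T: vector_space "tscale :: 'k \<Rightarrow> ('k, 'v) tensor \<Rightarrow> _"
    by (rule vector_space_tscale)
  interpret W: vector_space sm' by fact
  interpret K: vector_space "(*) :: 'k \<Rightarrow> 'k \<Rightarrow> 'k"
    by standard (simp_all add: algebra_simps)
  interpret TW: vector_space_pair "tscale :: 'k \<Rightarrow> ('k, 'v) tensor \<Rightarrow> _" sm' ..
  interpret WK: vector_space_pair sm' "(*) :: 'k \<Rightarrow> 'k \<Rightarrow> 'k" ..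
  let ?E = "{tensor sm vs | vs. length vs = n}"
  obtain B where B: "B \<subseteq> ?E" "T.independent B" "?E \<subseteq> T.span B"
    using T.maximal_independent_subset by blast
  from B(1) have "\<forall>b\<in>B. \<exists>vs. length vs = n \<and> tensor sm vs = b" by blast
  then obtain r where r: "\<And>b. b \<in> B \<Longrightarrow> length (r b) = n \<and> tensor sm (r b) = b"
    by (auto dest!: bchoice)
  obtain L where L: "Vector_Spaces.linear tscale sm' L" and LB: "\<And>b. b \<in> B \<Longrightarrow> L b = F (r b)"
    using TW.linear_independent_extend[OF B(2), of "\<lambda>b. F (r b)"] by blast
  interpret L: Vector_Spaces.linear tscale sm' L by fact
  have "L (tensor sm vs) = F vs" if vs: "length vs = n" for vs
  proof -
    have "tensor sm vs \<in> T.span B" using B(3) vs by blast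
    then obtain S u where S: "finite S" "S \<subseteq> B"
      and eq: "tensor sm vs = (\<Sum>b\<in>S. tscale (u b) b)"
      unfolding T.span_explicit by blast
    have L_eq: "L (tensor sm vs) = (\<Sum>b\<in>S. sm' (u b) (F (r b)))"
      unfolding eq L.sum L.scale using S LB by (intro sum.cong) auto
    have sep: "g (F vs) = g (L (tensor sm vs))" if g: "Vector_Spaces.linear sm' (*) g" for g
    proof -
      interpret g: Vector_Spaces.linear sm' "(*)" g by fact
      have ml: "multilinear sm (*) n (\<lambda>ws. g (F ws))"
        using F unfolding multilinear_def by (simp add: g.add g.scale)
      have "g (F vs) = tensor sm vs (\<lambda>ws. g (F ws))"
        using ml vs by (simp add: tensor_def)
      also have "\<dots> = (\<Sum>b\<in>S. u b * b (\<lambda>ws. g (F ws)))"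
        unfolding eq using S(1) by (induction S rule: finite_induct) (auto simp: tscale_def)
      also have "\<dots> = (\<Sum>b\<in>S. u b * g (F (r b)))"
      proof (intro sum.cong refl)
        fix b assume "b \<in> S"
        then have "length (r b) = n" "b = tensor sm (r b)" using r S by auto
        then show "u b * b (\<lambda>ws. g (F ws)) = u b * g (F (r b))"
          using ml by (metis (mono_tags, lifting) tensor_def)
      qed
      also have "\<dots> = g (L (tensor sm vs))"
        unfolding L_eq g.sum g.scale ..
      finally show ?thesis .
    qed
    show ?thesis
    proof (rule ccontr)
      assume "L (tensor sm vs) \<noteq> F vs"
      then have "W.independent {F vs - L (tensor sm vs)}" by simp
      then obtain g where "Vector_Spaces.linear sm' (*) g" "g (F vs - L (tensor sm vs)) = 1"
        using WK.linear_independent_extend[of _ "\<lambda>_. 1"] by blast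
      then show False
        using sep[of g] WK.linear_diff[of g] by simp
    qed
  qed
  then show ?thesis using L by blast
qed

lemma tensor_power_linear_unique:
  assumes L: "Vector_Spaces.linear tscale sm' L" and L': "Vector_Spaces.linear tscale sm' L'"
    and eq: "\<And>vs. length vs = n \<Longrightarrow> L (tensor sm vs) = L' (tensor sm vs)"
    and t: "t \<in> tensor_power sm n"
  shows "L t = L' t"
proof -
  note pair = vector_space_pair.intro[OF Vector_Spaces.linear.axioms(1,2)[OF L]]
  show ?thesis
    using vector_space_pair.linear_eq_on[OF pair L L'] t eq unfolding tensor_power_def by blast
qed

lemma multilinearD:
  assumes "multilinear sm sm' n F" "length vs = n" "i < n"
  shows "F (vs[i := x + y]) = F (vs[i := x]) + F (vs[i := y])"
    and "F (vs[i := sm c x]) = sm' c (F (vs[i := x]))"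
  using assms unfolding multilinear_def by auto

context graded_locally_convex_space
begin

lemma proj_along_decomp:
  assumes "a \<in> V0" "b \<in> V1"
  shows "proj_along V0 V1 (a + b) = a" "proj_along V1 V0 (a + b) = b"
proof -
  have 1: "a' = a" if "a' \<in> V0" "a + b - a' \<in> V1" for a'
  proof -
    have "a - a' \<in> V0" using that assms subspace_diff[OF subspace_V0] by blast
    moreover have "a + b - a' - b \<in> V1" using that assms subspace_diff[OF subspace_V1] by blast
    then have "a - a' \<in> V1" by (simp add: algebra_simps)
    ultimately have "a - a' \<in> {0}" using V0_Int_V1 by blast
    then show ?thesis by simp
  qed
  have 2: "b' = b" if "b' \<in> V1" "a + b - b' \<in> V0" for b'
    using 1[of "a + b - b'"] that by simp
  show "proj_along V0 V1 (a + b) = a" unfolding proj_along_def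
    using assms 1 by (intro the_equality) auto
  show "proj_along V1 V0 (a + b) = b" unfolding proj_along_def
    using assms 2 by (intro the_equality) auto
qed

lemma proj_along_linear:
  "proj_along V0 V1 (x + y) = proj_along V0 V1 x + proj_along V0 V1 y"
  "proj_along V1 V0 (x + y) = proj_along V1 V0 x + proj_along V1 V0 y"
  "proj_along V0 V1 (sm c x) = sm c (proj_along V0 V1 x)"
  "proj_along V1 V0 (sm c x) = sm c (proj_along V1 V0 x)"
proof -
  obtain a b where x: "a \<in> V0" "b \<in> V1" "x = a + b" using V0_plus_V1 by blast
  obtain a' b' where y: "a' \<in> V0" "b' \<in> V1" "y = a' + b'" using V0_plus_V1 by blast
  have xy: "x + y = (a + a') + (b + b')" and cx: "sm c x = sm c a + sm c b"
    using x y by (simp_all add: scale_right_distrib algebra_simps)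
  note m = subspace_add[OF subspace_V0 x(1) y(1)] subspace_add[OF subspace_V1 x(2) y(2)]
    subspace_scale[OF subspace_V0 x(1)] subspace_scale[OF subspace_V1 x(2)]
  show "proj_along V0 V1 (x + y) = proj_along V0 V1 x + proj_along V0 V1 y"
    "proj_along V1 V0 (x + y) = proj_along V1 V0 x + proj_along V1 V0 y"
    unfolding xy using m x y by (simp_all add: proj_along_decomp)
  show "proj_along V0 V1 (sm c x) = sm c (proj_along V0 V1 x)"
    "proj_along V1 V0 (sm c x) = sm c (proj_along V1 V0 x)"
    unfolding cx using m x by (simp_all add: proj_along_decomp)
qed

lemma tensor_zero:
  assumes "i < length vs" "vs ! i = 0"
  shows "tensor sm vs = 0"
proof -
  have "vs = vs[i := sm 0 0]" using assms by (metis list_update_id scale_zero_left)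
  also have "tensor sm \<dots> = tscale 0 (tensor sm (vs[i := 0]))"
    using multilinearD(2)[OF multilinear_tensor refl assms(1)] .
  finally show ?thesis by (simp add: tscale_def fun_eq_iff)
qed

lemma koszul_action_exists:
  assumes \<sigma>: "\<sigma> permutes {..<n}"
  shows "\<exists>L. is_koszul_action sm V0 V1 n \<sigma> L"
proof -
  interpret T: vector_space "tscale :: 'k \<Rightarrow> ('k, 'v) tensor \<Rightarrow> _"
    by (rule vector_space_tscale)
  define P where "P A i = (if i \<in> A then proj_along V1 V0 else proj_along V0 V1)" for A and i :: nat
  define comp where "comp A vs = map (\<lambda>i. P A i (vs ! i)) [0..<n]" for A vs
  define sgn where "sgn A = ((- 1) ^ card {(i, j). i < j \<and> j < n \<and> \<sigma> i > \<sigma> j \<and> \<sigma> i \<in> A \<and> \<sigma> j \<in> A} :: 'k)" for A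
  define F where "F vs = (\<Sum>A\<in>Pow {..<n}. tscale (sgn A) (tensor sm (permute_list \<sigma> (comp A vs))))" for vs
  have comp_upd: "permute_list \<sigma> (comp A (vs[i := x])) = (permute_list \<sigma> (comp A vs))[inv \<sigma> i := P A i x]"
    if "length vs = n" "i < n" for A vs i x
  proof (rule nth_equalityI)
    fix j assume "j < length (permute_list \<sigma> (comp A (vs[i := x])))"
    then have j: "j < n" by (simp add: comp_def)
    then have "\<sigma> j < n" using \<sigma> by (metis lessThan_iff permutes_in_image)
    moreover have "\<sigma> j = i \<longleftrightarrow> inv \<sigma> i = j" using \<sigma> by (metis permutes_inv_eq)
    ultimately show "permute_list \<sigma> (comp A (vs[i := x])) ! j = (permute_list \<sigma> (comp A vs))[inv \<sigma> i := P A i x] ! j"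
      using that j \<sigma> by (auto simp: comp_def permute_list_nth nth_list_update)
  qed (simp add: comp_def)
  have Plin: "P A i (x + y) = P A i x + P A i y" "P A i (sm c x) = sm c (P A i x)" for A i x y c
    by (simp_all add: P_def proj_along_linear)
  have invn: "inv \<sigma> i < n" if "i < n" for i
    using that permutes_inv[OF \<sigma>] by (metis lessThan_iff permutes_in_image)
  have len: "length (permute_list \<sigma> (comp A vs)) = n" for A vs by (simp add: comp_def)
  have "multilinear sm tscale n F"
    unfolding multilinear_def
  proof (intro allI impI conjI; elim conjE)
    fix vs :: "'v list" and i x y c assume vs: "length vs = n" "i < n"
    note ml = multilinearD[OF multilinear_tensor len invn[OF vs(2)]]
    show "F (vs[i := x + y]) = F (vs[i := x]) + F (vs[i := y])"
      unfolding F_def comp_upd[OF vs] Plin ml T.scale_right_distrib sum.distrib ..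
    show "F (vs[i := sm c x]) = tscale c (F (vs[i := x]))"
      unfolding F_def comp_upd[OF vs] Plin ml T.scale_sum_right
      by (intro sum.cong refl T.scale_left_commute)
  qed
  from tensor_power_universal[OF vector_space_tscale this]
  obtain L where L: "Vector_Spaces.linear tscale tscale L"
    "\<And>vs. length vs = n \<Longrightarrow> L (tensor sm vs) = F vs" by blast
  have "F vs = tscale (koszul_sign V1 \<sigma> vs) (tensor sm (permute_list \<sigma> vs))"
    if vs: "length vs = n" "set vs \<subseteq> V0 \<union> V1" for vs
  proof -
    define A0 where "A0 = {i. i < n \<and> vs ! i \<in> V1}"
    have z0: "0 \<in> V0" "0 \<in> V1" using V0_Int_V1 by auto
    have P1: "proj_along V1 V0 v = v" "proj_along V0 V1 v = 0" if "v \<in> V1" for v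
      using proj_along_decomp[OF z0(1) that] by auto
    have P0: "proj_along V0 V1 v = v" "proj_along V1 V0 v = 0" if "v \<in> V0" for v
      using proj_along_decomp[OF that z0(2)] by auto
    have mem: "vs ! i \<in> V0 \<or> vs ! i \<in> V1" if "i < n" for i
      using vs that by (metis UnE nth_mem subsetD)
    have other: "tensor sm (permute_list \<sigma> (comp A vs)) = 0" if A: "A \<in> Pow {..<n}" "A \<noteq> A0" for A
    proof -
      have "\<exists>i<n. (i \<in> A \<and> vs ! i \<notin> V1) \<or> (i \<notin> A \<and> vs ! i \<in> V1)"
        using A unfolding A0_def by blast
      then obtain i where "i < n" "(i \<in> A \<and> vs ! i \<in> V0) \<or> (i \<notin> A \<and> vs ! i \<in> V1)"
        using mem by blast
      then have i: "i < n" "P A i (vs ! i) = 0"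
        using P0(2) P1(2) by (auto simp: P_def)
      show ?thesis
      proof (rule tensor_zero)
        show "inv \<sigma> i < length (permute_list \<sigma> (comp A vs))" using invn i len by simp
        show "permute_list \<sigma> (comp A vs) ! inv \<sigma> i = 0"
          using i invn[OF i(1)] \<sigma> by (simp add: comp_def permute_list_nth permutes_inverses)
      qed
    qed
    have "comp A0 vs = vs"
      using vs(1) mem P0 P1 by (intro nth_equalityI) (auto simp: comp_def P_def A0_def)
    moreover have "sgn A0 = koszul_sign V1 \<sigma> vs"
    proof -
      have "\<sigma> i < n" if "i < n" for i using \<sigma> that by (metis lessThan_iff permutes_in_image)
      then have "{(i, j). i < j \<and> j < n \<and> \<sigma> i > \<sigma> j \<and> \<sigma> i \<in> A0 \<and> \<sigma> j \<in> A0} =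
          {(i, j). i < j \<and> j < n \<and> \<sigma> i > \<sigma> j \<and> vs ! \<sigma> i \<in> V1 \<and> vs ! \<sigma> j \<in> V1}"
        unfolding A0_def by fastforce
      then show ?thesis unfolding sgn_def koszul_sign_def vs(1) by simp
    qed
    moreover have "F vs = (\<Sum>A\<in>{A0}. tscale (sgn A) (tensor sm (permute_list \<sigma> (comp A vs))))"
      unfolding F_def using other
      by (intro sum.mono_neutral_right) (auto simp: A0_def)
    ultimately show ?thesis by simp
  qed
  then show ?thesis using L unfolding is_koszul_action_def by metis
qed

lemma koszul_action_unique:
  assumes L: "is_koszul_action sm V0 V1 n \<sigma> L" and L': "is_koszul_action sm V0 V1 n \<sigma> L'"
    and t: "t \<in> tensor_power sm n"
  shows "L t = L' t"
proof -
  interpret L: Vector_Spaces.linear tscale tscale L using L by (simp add: is_koszul_action_def)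
  interpret L': Vector_Spaces.linear tscale tscale L' using L' by (simp add: is_koszul_action_def)
  have "L (tensor sm vs) = L' (tensor sm vs)"
    if "length vs = n" "k \<le> n" "\<forall>i<n. k \<le> i \<longrightarrow> vs ! i \<in> V0 \<union> V1" for k vs
    using that
  proof (induction k arbitrary: vs)
    case 0
    then have "set vs \<subseteq> V0 \<union> V1" by (auto simp: in_set_conv_nth)
    then show ?case using L L' 0 by (simp add: is_koszul_action_def)
  next
    case (Suc k)
    obtain a b where ab: "a \<in> V0" "b \<in> V1" "vs ! k = a + b" using V0_plus_V1 by blast
    have k: "k < n" using Suc by simp
    have "tensor sm vs = tensor sm (vs[k := a]) + tensor sm (vs[k := b])"
      using multilinearD(1)[OF multilinear_tensor Suc.prems(1) k, of sm a b] ab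
      by (metis list_update_id)
    moreover have "L (tensor sm (vs[k := c])) = L' (tensor sm (vs[k := c]))" if "c \<in> V0 \<union> V1" for c
      using that Suc.prems by (intro Suc.IH) (auto simp: nth_list_update)
    ultimately show ?case using ab by (metis L.add L'.add UnCI)
  qed
  from this[of _ n] show ?thesis
    using tensor_power_linear_unique[OF L.linear_axioms L'.linear_axioms _ t] by simp
qed

end

lemma topspace_tensor_algebra_topology:
  "topspace (tensor_algebra_topology sm X R) = tensor_algebra sm"
proof -
  have "continuous_seminorm sm X (\<lambda>_. 0)"
    by (simp add: continuous_seminorm_def seminorm_on_def)
  moreover have "graded_seminorm sm R (\<lambda>_. 0) (x - x) = 0" for x
    by (simp add: graded_seminorm_def)
  ultimately have "x \<in> topspace (tensor_algebra_topology sm X R)" if "x \<in> tensor_algebra sm" for x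
    unfolding tensor_algebra_topology_def seminorm_topology_def topology_generated_by_topspace
    using that
    by (intro UnionI[of "{z \<in> tensor_algebra sm. graded_seminorm sm R (\<lambda>_. 0) (z - x) < 1}"]) force+
  moreover have "topspace (tensor_algebra_topology sm X R) \<subseteq> tensor_algebra sm"
    unfolding tensor_algebra_topology_def seminorm_topology_def topology_generated_by_topspace
    by auto
  ultimately show ?thesis by blast
qed

end

theory Submission
  imports Defs
begin

text \<open>
  Nuclearity is first freed from quotients and completions. That the canonical map \<open>V\<^sub>q \<rightarrow> V\<^sub>p\<close> is
  nuclear means that \<open>x = \<Sum>\<^sub>i f\<^sub>i(x) y\<^sub>i\<close> in \<open>V\<^sub>p\<close> with linear forms \<open>|f\<^sub>i| \<le> q\<close> and \<open>\<Sum>\<^sub>i p(y\<^sub>i) < \<infinity>\<close>. The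
  vectors \<open>y\<^sub>i\<close> may be taken in the space itself, because every element of the completion is the sum of
  an absolutely convergent series from the space (\<open>cauchy_as_series\<close>). Such an expansion
  (\<open>nuclear_expansion\<close>) mentions only seminorms, and by \<open>nuclear_space_iff_expansion\<close> a space is
  nuclear iff every continuous seminorm \<open>p\<close> has an expansion dominated by some continuous \<open>q\<close>.

  Expansions pass to retracts: if \<open>\<pi> \<circ> \<iota> = id\<close> with continuous linear \<open>\<iota>\<close> and \<open>\<pi>\<close>, then the forms
  \<open>f\<^sub>i \<circ> \<iota>\<close> and the vectors \<open>\<pi>(y\<^sub>i)\<close> give an expansion of the smaller space
  (\<open>nuclear_space_retract\<close>). This settles two implications. The Weyl algebra is the image of the
  symmetrizer, which is idempotent because the Koszul signs form a cocycle
  (\<open>koszul_sign_compose\<close>), and continuous because every continuous seminorm is dominated by one with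
  \<open>p(a + b) = p(a) + p(b)\<close> for even \<open>a\<close> and odd \<open>b\<close>, for which no permutation increases \<open>p\<^sup>n\<close>. And \<open>V\<close>
  itself is the part of degree one of the Weyl algebra.

  For the remaining implication, an expansion of \<open>V\<close> is multiplied out: on elementary tensors,
  \<open>v\<^sub>1 \<otimes> \<dots> \<otimes> v\<^sub>n\<close> is the sum over all words \<open>I = i\<^sub>1 \<dots> i\<^sub>n\<close> of the terms
  \<open>f\<^bsub>i\<^sub>1\<^esub>(v\<^sub>1) \<dots> f\<^bsub>i\<^sub>n\<^esub>(v\<^sub>n) (y\<^bsub>i\<^sub>1\<^esub> \<otimes> \<dots> \<otimes> y\<^bsub>i\<^sub>n\<^esub>)\<close>. The total weight of the words of
  length \<open>n\<close> is at most \<open>(\<Sum>\<^sub>i p(y\<^sub>i))\<^sup>n\<close>, so once \<open>q\<close> has been multiplied by a constant that makes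
  \<open>\<Sum>\<^sub>i p(y\<^sub>i) \<le> 1/2\<close>, the words of all lengths together have finite weight. The factor \<open>n!\<^sup>R\<close> is
  moved from the vectors, where \<open>p\<^sub>R\<close> produces it, into the forms, where \<open>q\<^sub>R\<close> absorbs it (\<open>tensor_algebra_expansion\<close>).
\<close>

section \<open>Completeness of the field of scalars\<close>

text \<open>Coordinates with respect to \<open>1\<close>, or to \<open>1\<close> and \<open>i\<close>, do not increase distances, so completeness is
  inherited from the real line. It is needed to extend bounded forms to completions.\<close>

lemma Cauchy_convergent_real_or_complex:
  fixes x :: "nat \<Rightarrow> 'k::real_or_complex"
  assumes "Cauchy x"
  shows "convergent x"
  using real_or_complex[where ?'a = 'k]
proof (elim disjE exE conjE)
  assume "\<forall>x::'k. \<exists>a. x = a *\<^sub>R 1"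
  then have "\<forall>x::'k. \<exists>a. a *\<^sub>R 1 = x" by (metis (full_types))
  from choice[OF this] obtain a where a: "\<And>x::'k. a x *\<^sub>R 1 = x" by blast
  have d: "dist x y = dist (a x) (a y)" for x y :: 'k
  proof -
    have "x - y = (a x - a y) *\<^sub>R 1" unfolding scaleR_left_diff_distrib a ..
    then show ?thesis by (simp add: dist_norm)
  qed
  have "Cauchy (\<lambda>n. a (x n))" using assms by (simp add: Cauchy_def d)
  then obtain l where "(\<lambda>n. a (x n)) \<longlonglongrightarrow> l" using real_Cauchy_convergent convergent_def by blast
  then have "(\<lambda>n. a (x n) *\<^sub>R (1::'k)) \<longlonglongrightarrow> l *\<^sub>R 1" by (intro tendsto_intros)
  then show ?thesis unfolding a convergent_def by blast
next
  fix i :: 'k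
  assume i: "i * i = - 1"
    and n: "\<forall>x. \<exists>a b. x = a *\<^sub>R 1 + b *\<^sub>R i \<and> norm x = sqrt (a\<^sup>2 + b\<^sup>2)"
  \<comment> \<open>\<open>1\<close> and \<open>i\<close> are linearly independent over the reals because \<open>- 1\<close> is not a real square.\<close>
  have indep: "a = 0 \<and> b = 0" if "a *\<^sub>R 1 + b *\<^sub>R i = 0" for a b
  proof -
    have "(a *\<^sub>R 1 + b *\<^sub>R i) * (a *\<^sub>R 1 - b *\<^sub>R i) = (a * a) *\<^sub>R 1 - (b * b) *\<^sub>R (i * i)"
      by (simp add: algebra_simps)
    also have "\<dots> = (a * a + b * b) *\<^sub>R 1" by (simp add: i algebra_simps)
    finally have "a * a + b * b = 0" using that by simp
    then show ?thesis by (simp add: sum_squares_eq_zero_iff)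
  qed
  from n have "\<forall>x. \<exists>c. fst c *\<^sub>R 1 + snd c *\<^sub>R i = x" by (metis fst_conv snd_conv)
  from choice[OF this] obtain c where c: "\<And>x. fst (c x) *\<^sub>R 1 + snd (c x) *\<^sub>R i = x" by blast
  define a b where "a x = fst (c x)" and "b x = snd (c x)" for x
  have ab: "a x *\<^sub>R 1 + b x *\<^sub>R i = x" for x by (simp add: a_def b_def c)
  have d: "\<bar>a x - a y\<bar> \<le> dist x y \<and> \<bar>b x - b y\<bar> \<le> dist x y" for x y
  proof -
    obtain c e where ce: "x - y = c *\<^sub>R 1 + e *\<^sub>R i" "norm (x - y) = sqrt (c\<^sup>2 + e\<^sup>2)" using n by blast
    have "(a x - a y - c) *\<^sub>R 1 + (b x - b y - e) *\<^sub>R i =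
        (a x *\<^sub>R 1 + b x *\<^sub>R i) - (a y *\<^sub>R 1 + b y *\<^sub>R i) - (c *\<^sub>R 1 + e *\<^sub>R i)"
      by (simp add: algebra_simps)
    also have "\<dots> = 0" unfolding ab ce(1)[symmetric] by simp
    finally have "(a x - a y - c) *\<^sub>R 1 + (b x - b y - e) *\<^sub>R i = 0" .
    from indep[OF this] have "a x - a y = c" "b x - b y = e" by auto
    then show ?thesis unfolding dist_norm ce(2)
      by (auto intro!: real_le_rsqrt)
  qed
  have ca: "Cauchy (\<lambda>n. a (x n))" and cb: "Cauchy (\<lambda>n. b (x n))"
    using assms d unfolding Cauchy_def dist_real_def by (metis order.strict_trans1)+
  from ca cb obtain k l where "(\<lambda>n. a (x n)) \<longlonglongrightarrow> k" "(\<lambda>n. b (x n)) \<longlonglongrightarrow> l"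
    using real_Cauchy_convergent convergent_def by metis
  then have "(\<lambda>n. a (x n) *\<^sub>R 1 + b (x n) *\<^sub>R i) \<longlonglongrightarrow> k *\<^sub>R 1 + l *\<^sub>R i" by (intro tendsto_intros)
  then show ?thesis unfolding ab convergent_def by blast
qed

section \<open>Seminormed spaces and their completions\<close>

locale seminormed_space = vector_space sm
  for sm :: "'k::real_or_complex \<Rightarrow> 'a::ab_group_add \<Rightarrow> 'a" +
  fixes E :: "'a set" and p :: "'a \<Rightarrow> real"
  assumes subspace_E: "subspace E"
    and seminorm_p: "seminorm_on sm E p"
begin

lemma E_closed [simp, intro]:
  "0 \<in> E"
  "x \<in> E \<Longrightarrow> y \<in> E \<Longrightarrow> x + y \<in> E"
  "x \<in> E \<Longrightarrow> y \<in> E \<Longrightarrow> x - y \<in> E"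
  "x \<in> E \<Longrightarrow> sm c x \<in> E"
  "x \<in> E \<Longrightarrow> - x \<in> E"
  using subspace_E by (simp_all add: subspace_0 subspace_add subspace_diff subspace_scale subspace_neg)

lemma E_sum [simp, intro]: "(\<And>i. i \<in> F \<Longrightarrow> g i \<in> E) \<Longrightarrow> sum g F \<in> E"
  using subspace_E by (rule subspace_sum)

lemma seminorm_add: "x \<in> E \<Longrightarrow> y \<in> E \<Longrightarrow> p (x + y) \<le> p x + p y"
  and seminorm_scale: "x \<in> E \<Longrightarrow> p (sm c x) = norm c * p x"
  using seminorm_p by (simp_all add: seminorm_on_def)

lemma seminorm_zero [simp]: "p 0 = 0"
  using seminorm_scale[of 0 0] by simp

lemma seminorm_minus: "x \<in> E \<Longrightarrow> p (- x) = p x"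
  using seminorm_scale[of x "- 1"] by simp

lemma seminorm_nonneg: "x \<in> E \<Longrightarrow> 0 \<le> p x"
  using seminorm_add[of x "- x"] by (simp add: seminorm_minus)

lemma seminorm_minus_commute: "x \<in> E \<Longrightarrow> y \<in> E \<Longrightarrow> p (x - y) = p (y - x)"
  using seminorm_minus[of "x - y"] by simp

lemma seminorm_triangle: "x \<in> E \<Longrightarrow> y \<in> E \<Longrightarrow> z \<in> E \<Longrightarrow> p (x - z) \<le> p (x - y) + p (y - z)"
  using seminorm_add[of "x - y" "y - z"] by simp

lemma seminorm_diff: "x \<in> E \<Longrightarrow> y \<in> E \<Longrightarrow> \<bar>p x - p y\<bar> \<le> p (x - y)"
  using seminorm_add[of "x - y" y] seminorm_add[of "y - x" x] seminorm_minus_commute[of x y] by simp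

lemma seminorm_sum: "(\<And>i. i \<in> F \<Longrightarrow> g i \<in> E) \<Longrightarrow> p (sum g F) \<le> (\<Sum>i\<in>F. p (g i))"
proof (induction F rule: infinite_finite_induct)
  case (insert i F)
  then have "p (g i + sum g F) \<le> p (g i) + p (sum g F)" by (intro seminorm_add) auto
  with insert show ?case by force
qed simp_all

definition coset :: "'a \<Rightarrow> 'a set" where "coset x = ker_rel E p `` {x}"

abbreviation quot :: "('k, 'a set) normed_space" where "quot \<equiv> quotient_space sm E p"

lemma coset_eq: "x \<in> E \<Longrightarrow> coset x = {y\<in>E. p (x - y) = 0}"
  by (auto simp: coset_def ker_rel_def)

lemma equiv_ker_rel: "equiv E (ker_rel E p)"
proof (rule equivI)
  show "ker_rel E p \<subseteq> E \<times> E" by (auto simp: ker_rel_def)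
  show "refl_on E (ker_rel E p)" by (auto simp: refl_on_def ker_rel_def)
  show "sym (ker_rel E p)" by (auto simp: sym_def ker_rel_def seminorm_minus_commute)
  show "trans (ker_rel E p)"
  proof (rule transI)
    fix x y z assume "(x, y) \<in> ker_rel E p" "(y, z) \<in> ker_rel E p"
    then show "(x, z) \<in> ker_rel E p"
      using seminorm_triangle[of x y z] seminorm_nonneg[of "x - z"] by (auto simp: ker_rel_def)
  qed
qed

lemma coset_eq_iff: "x \<in> E \<Longrightarrow> y \<in> E \<Longrightarrow> coset x = coset y \<longleftrightarrow> p (x - y) = 0"
  using eq_equiv_class_iff[OF equiv_ker_rel, of x y] by (simp add: coset_def ker_rel_def)

text \<open>The operations on quotients and completions are unions over all representatives; this rule and
  \<open>limit_const_UN\<close> below evaluate such a union once the choice of representative does not matter.\<close>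

lemma coset_const_UN:
  assumes "x \<in> E" "\<And>y. y \<in> E \<Longrightarrow> p (x - y) = 0 \<Longrightarrow> g y = g x"
  shows "(\<Union>y\<in>coset x. g y) = g x"
proof -
  have "x \<in> coset x" using assms(1) by (simp add: coset_eq)
  moreover have "g y = g x" if "y \<in> coset x" for y
    using that by (intro assms(2)) (simp_all add: coset_eq[OF assms(1)])
  ultimately show ?thesis by blast
qed

lemma carr_quot: "carr quot = coset ` E"
  by (auto simp: quotient_space_def quotient_def coset_def)

lemma zer_quot: "zer quot = coset 0"
  by (simp add: quotient_space_def coset_def)

lemma pls_quot: assumes "x \<in> E" "y \<in> E" shows "pls quot (coset x) (coset y) = coset (x + y)"
proof -
  have *: "coset (x' + y') = coset (x + y)" if "x' \<in> E" "y' \<in> E" "p (x - x') = 0" "p (y - y') = 0" for x' y'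
  proof -
    have "p (x + y - (x' + y')) \<le> p (x - x') + p (y - y')"
      using seminorm_add[of "x - x'" "y - y'"] that assms by (simp add: algebra_simps)
    then have "p (x + y - (x' + y')) = 0" using that assms seminorm_nonneg[of "x + y - (x' + y')"] by auto
    then show ?thesis using coset_eq_iff[of "x + y" "x' + y'"] assms that by auto
  qed
  have "pls quot (coset x) (coset y) = (\<Union>x'\<in>coset x. \<Union>y'\<in>coset y. coset (x' + y'))"
    by (simp add: quotient_space_def coset_def)
  also have "\<dots> = (\<Union>x'\<in>coset x. \<Union>y'\<in>coset y. coset (x + y))"
  proof (intro SUP_cong refl)
    fix x' y' assume "x' \<in> coset x" "y' \<in> coset y"
    then show "coset (x' + y') = coset (x + y)" using assms by (intro *) (auto simp: coset_eq)
  qed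
  also have "\<dots> = coset (x + y)"
  proof -
    have "x \<in> coset x" "y \<in> coset y" using assms by (auto simp: coset_eq)
    then show ?thesis by blast
  qed
  finally show ?thesis .
qed

lemma scl_quot: assumes "x \<in> E" shows "scl quot c (coset x) = coset (sm c x)"
proof -
  have *: "coset (sm c y) = coset (sm c x)" if "y \<in> E" "p (x - y) = 0" for y
  proof -
    have "p (sm c x - sm c y) = 0"
      using that assms seminorm_scale[of "x - y" c] by (simp add: scale_right_diff_distrib)
    then show ?thesis using that assms coset_eq_iff[of "sm c x" "sm c y"] by auto
  qed
  have "scl quot c (coset x) = (\<Union>y\<in>coset x. coset (sm c y))"
    by (simp add: quotient_space_def coset_def)
  also have "\<dots> = coset (sm c x)" by (intro coset_const_UN assms) (rule *)
  finally show ?thesis .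
qed

lemma nrm_quot: assumes "x \<in> E" shows "nrm quot (coset x) = p x"
proof -
  have *: "p y = p x" if "y \<in> coset x" for y
    using that assms seminorm_diff[of x y] by (auto simp: coset_eq)
  have "x \<in> coset x" using assms by (simp add: coset_eq)
  with * have "p ` coset x = {p x}" by blast
  then show ?thesis by (simp add: quotient_space_def coset_def)
qed

lemma ndist_quot: "x \<in> E \<Longrightarrow> y \<in> E \<Longrightarrow> ndist quot (coset x) (coset y) = p (x - y)"
  by (simp add: ndist_def scl_quot pls_quot nrm_quot)

definition cauchy :: "(nat \<Rightarrow> 'a) \<Rightarrow> bool" where
  "cauchy s \<longleftrightarrow> range s \<subseteq> E \<and> (\<forall>e>0. \<exists>M. \<forall>m\<ge>M. \<forall>n\<ge>M. p (s m - s n) < e)"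

lemma cauchy_in_E: "cauchy s \<Longrightarrow> s n \<in> E"
  by (auto simp: cauchy_def)

lemma cauchyD: "cauchy s \<Longrightarrow> 0 < e \<Longrightarrow> \<exists>M. \<forall>m\<ge>M. \<forall>n\<ge>M. p (s m - s n) < e"
  by (simp add: cauchy_def)

lemma cauchy_const [simp]: "x \<in> E \<Longrightarrow> cauchy (\<lambda>_. x)"
  by (auto simp: cauchy_def)

lemma cauchy_add:
  assumes s: "cauchy s" and t: "cauchy t" shows "cauchy (\<lambda>n. s n + t n)"
  unfolding cauchy_def
proof (intro conjI allI impI)
  note sE [simp] = cauchy_in_E[OF s] and tE [simp] = cauchy_in_E[OF t]
  fix e :: real assume "0 < e"
  then have "0 < e / 2" by simp
  obtain M where M: "\<forall>m\<ge>M. \<forall>n\<ge>M. p (s m - s n) < e / 2"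
    using cauchyD[OF s \<open>0 < e / 2\<close>] by blast
  obtain N where N: "\<forall>m\<ge>N. \<forall>n\<ge>N. p (t m - t n) < e / 2"
    using cauchyD[OF t \<open>0 < e / 2\<close>] by blast
  have "p (s m + t m - (s n + t n)) < e" if "m \<ge> max M N" "n \<ge> max M N" for m n
  proof -
    have "p (s m + t m - (s n + t n)) \<le> p (s m - s n) + p (t m - t n)"
      using seminorm_add[of "s m - s n" "t m - t n"] by (simp add: algebra_simps)
    moreover have "p (s m - s n) < e / 2" "p (t m - t n) < e / 2" using M N that by auto
    ultimately show ?thesis by linarith
  qed
  then show "\<exists>M. \<forall>m\<ge>M. \<forall>n\<ge>M. p (s m + t m - (s n + t n)) < e" by blast
qed (use cauchy_in_E[OF s] cauchy_in_E[OF t] in auto)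

lemma cauchy_scale:
  assumes s: "cauchy s" shows "cauchy (\<lambda>n. sm c (s n))"
  unfolding cauchy_def
proof (intro conjI allI impI)
  note sE [simp] = cauchy_in_E[OF s]
  fix e :: real assume "0 < e"
  then have "0 < e / (norm c + 1)" by (simp add: add_nonneg_pos)
  then obtain M where M: "\<forall>m\<ge>M. \<forall>n\<ge>M. p (s m - s n) < e / (norm c + 1)"
    using cauchyD[OF assms] by blast
  have "p (sm c (s m) - sm c (s n)) < e" if "m \<ge> M" "n \<ge> M" for m n
  proof -
    have "p (sm c (s m) - sm c (s n)) = norm c * p (s m - s n)"
      using seminorm_scale[of "s m - s n" c] by (simp add: scale_right_diff_distrib)
    also have "\<dots> \<le> (norm c + 1) * p (s m - s n)"
      by (intro mult_right_mono seminorm_nonneg) auto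
    also have "\<dots> < e"
    proof -
      have "p (s m - s n) < e / (norm c + 1)" using M that by blast
      then show ?thesis by (simp add: pos_less_divide_eq add_nonneg_pos mult.commute)
    qed
    finally show ?thesis .
  qed
  then show "\<exists>M. \<forall>m\<ge>M. \<forall>n\<ge>M. p (sm c (s m) - sm c (s n)) < e" by blast
qed (use cauchy_in_E[OF s] in auto)

lemma cauchy_diff:
  assumes "cauchy s" "cauchy t" shows "cauchy (\<lambda>n. s n - t n)"
  using cauchy_add[OF assms(1) cauchy_scale[OF assms(2), of "- 1"]] by simp

lemma cauchy_norm_convergent: assumes s: "cauchy s" shows "convergent (\<lambda>n. p (s n))"
proof -
  have "Cauchy (\<lambda>n. p (s n))" unfolding Cauchy_def
  proof (intro allI impI)
    fix e :: real assume "0 < e"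
    then obtain M where M: "\<forall>m\<ge>M. \<forall>n\<ge>M. p (s m - s n) < e"
      using cauchyD[OF assms] by blast
    have "dist (p (s m)) (p (s n)) < e" if "m \<ge> M" "n \<ge> M" for m n
    proof -
      have "\<bar>p (s m) - p (s n)\<bar> \<le> p (s m - s n)" by (intro seminorm_diff cauchy_in_E[OF s])
      also have "\<dots> < e" using M that by blast
      finally show ?thesis by (simp add: dist_real_def)
    qed
    then show "\<exists>M. \<forall>m\<ge>M. \<forall>n\<ge>M. dist (p (s m)) (p (s n)) < e" by blast
  qed
  then show ?thesis by (rule real_Cauchy_convergent)
qed

abbreviation compl :: "('k, (nat \<Rightarrow> 'a set) set) normed_space" where
  "compl \<equiv> seminorm_completion sm E p"

text \<open>The element of the completion of \<open>E / ker p\<close> that is represented by a Cauchy sequence in \<open>E\<close>. All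
  elements have this form, and the lemmas below compute the operations of the completion on such
  representatives, so that cosets need not be mentioned afterwards.\<close>

definition limit :: "(nat \<Rightarrow> 'a) \<Rightarrow> (nat \<Rightarrow> 'a set) set" where
  "limit s = cauchy_rel quot `` {\<lambda>n. coset (s n)}"

lemma cauchy_seqs_quot: "cauchy_seqs quot = (\<lambda>s n. coset (s n)) ` {s. cauchy s}"
proof (intro equalityI subsetI)
  fix S assume S: "S \<in> cauchy_seqs quot"
  then have "\<forall>n. \<exists>x. x \<in> E \<and> S n = coset x" unfolding cauchy_seqs_def carr_quot by blast
  from choice[OF this] obtain s where s: "\<And>n. s n \<in> E" "\<And>n. S n = coset (s n)" by blast
  have "\<forall>e>0. \<exists>M. \<forall>m\<ge>M. \<forall>n\<ge>M. ndist quot (S m) (S n) < e" using S by (simp add: cauchy_seqs_def)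
  then have "cauchy s" using s by (auto simp: cauchy_def ndist_quot)
  then show "S \<in> (\<lambda>s n. coset (s n)) ` {s. cauchy s}" using s(2) by blast
next
  fix S assume "S \<in> (\<lambda>s n. coset (s n)) ` {s. cauchy s}"
  then obtain s where s: "cauchy s" "S = (\<lambda>n. coset (s n))" by auto
  note sE = cauchy_in_E[OF s(1)]
  have "\<forall>n. S n \<in> carr quot" using s(2) sE by (simp add: carr_quot)
  moreover have "ndist quot (S m) (S n) = p (s m - s n)" for m n
    using s(2) sE by (simp add: ndist_quot)
  ultimately show "S \<in> cauchy_seqs quot"
    using s(1) by (simp add: cauchy_seqs_def cauchy_def)
qed

lemma cauchy_seqsI: "cauchy s \<Longrightarrow> (\<lambda>n. coset (s n)) \<in> cauchy_seqs quot"
  by (auto simp: cauchy_seqs_quot)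

lemma cauchy_seqsE: assumes "S \<in> cauchy_seqs quot" obtains s where "cauchy s" "S = (\<lambda>n. coset (s n))"
  using assms by (auto simp: cauchy_seqs_quot)

lemma cauchy_rel_quot:
  assumes "cauchy s" "cauchy t"
  shows "((\<lambda>n. coset (s n)), (\<lambda>n. coset (t n))) \<in> cauchy_rel quot \<longleftrightarrow> (\<lambda>n. p (s n - t n)) \<longlonglongrightarrow> 0"
  by (simp add: cauchy_rel_def cauchy_seqsI assms ndist_quot cauchy_in_E[OF assms(1)] cauchy_in_E[OF assms(2)])

lemma equiv_cauchy_rel: "equiv (cauchy_seqs quot) (cauchy_rel quot)"
proof (rule equivI)
  show "cauchy_rel quot \<subseteq> cauchy_seqs quot \<times> cauchy_seqs quot" by (auto simp: cauchy_rel_def)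
  show "refl_on (cauchy_seqs quot) (cauchy_rel quot)"
  proof (rule refl_onI)
    fix S assume "S \<in> cauchy_seqs quot"
    then obtain s where "cauchy s" "S = (\<lambda>n. coset (s n))" by (rule cauchy_seqsE)
    then show "(S, S) \<in> cauchy_rel quot" by (simp add: cauchy_rel_quot)
  qed
  show "sym (cauchy_rel quot)"
  proof (rule symI)
    fix S T assume ST: "(S, T) \<in> cauchy_rel quot"
    then have "S \<in> cauchy_seqs quot" "T \<in> cauchy_seqs quot" by (auto simp: cauchy_rel_def)
    then obtain s t where st: "cauchy s" "S = (\<lambda>n. coset (s n))" "cauchy t" "T = (\<lambda>n. coset (t n))"
      by (elim cauchy_seqsE)
    have "p (s n - t n) = p (t n - s n)" for n
      using st by (intro seminorm_minus_commute cauchy_in_E)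
    then show "(T, S) \<in> cauchy_rel quot" using ST st by (simp add: cauchy_rel_quot)
  qed
  show "trans (cauchy_rel quot)"
  proof (rule transI)
    fix S T U assume ST: "(S, T) \<in> cauchy_rel quot" and TU: "(T, U) \<in> cauchy_rel quot"
    then have "S \<in> cauchy_seqs quot" "T \<in> cauchy_seqs quot" "U \<in> cauchy_seqs quot"
      by (auto simp: cauchy_rel_def)
    then obtain s t u where *: "cauchy s" "S = (\<lambda>n. coset (s n))" "cauchy t" "T = (\<lambda>n. coset (t n))"
      "cauchy u" "U = (\<lambda>n. coset (u n))"
      by (elim cauchy_seqsE)
    note E = cauchy_in_E[OF *(1)] cauchy_in_E[OF *(3)] cauchy_in_E[OF *(5)]
    have "(\<lambda>n. p (s n - t n) + p (t n - u n)) \<longlonglongrightarrow> 0 + 0"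
      using ST TU * by (intro tendsto_add) (simp_all add: cauchy_rel_quot)
    then have "(\<lambda>n. p (s n - t n) + p (t n - u n)) \<longlonglongrightarrow> 0" by simp
    then have "(\<lambda>n. p (s n - u n)) \<longlonglongrightarrow> 0"
    proof (rule tendsto_sandwich[OF _ _ tendsto_const, rotated 2])
      show "\<forall>\<^sub>F n in sequentially. 0 \<le> p (s n - u n)"
        by (intro always_eventually allI seminorm_nonneg E_closed(3) E)
      show "\<forall>\<^sub>F n in sequentially. p (s n - u n) \<le> p (s n - t n) + p (t n - u n)"
        by (intro always_eventually allI seminorm_triangle E)
    qed
    then show "(S, U) \<in> cauchy_rel quot" using * by (simp add: cauchy_rel_quot)
  qed
qed

lemma limit_memE:
  assumes "S \<in> limit s" "cauchy s"
  obtains t where "cauchy t" "(\<lambda>n. p (s n - t n)) \<longlonglongrightarrow> 0" "S = (\<lambda>n. coset (t n))"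
proof -
  have *: "((\<lambda>n. coset (s n)), S) \<in> cauchy_rel quot" using assms by (simp add: limit_def)
  then have "S \<in> cauchy_seqs quot" by (auto simp: cauchy_rel_def)
  then obtain t where t: "cauchy t" "S = (\<lambda>n. coset (t n))" by (rule cauchy_seqsE)
  then show ?thesis using * assms that by (simp add: cauchy_rel_quot)
qed

lemma limit_self: "cauchy s \<Longrightarrow> (\<lambda>n. coset (s n)) \<in> limit s"
  by (simp add: limit_def cauchy_rel_quot)

lemma limit_eq_iff: "cauchy s \<Longrightarrow> cauchy t \<Longrightarrow> limit s = limit t \<longleftrightarrow> (\<lambda>n. p (s n - t n)) \<longlonglongrightarrow> 0"
  unfolding limit_def
  by (subst eq_equiv_class_iff[OF equiv_cauchy_rel]) (simp_all add: cauchy_seqsI cauchy_rel_quot)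

lemma limit_const_UN:
  assumes "cauchy s" "\<And>t. cauchy t \<Longrightarrow> (\<lambda>n. p (s n - t n)) \<longlonglongrightarrow> 0 \<Longrightarrow> g (\<lambda>n. coset (t n)) = A"
  shows "(\<Union>S\<in>limit s. g S) = A"
proof -
  have "g S = A" if "S \<in> limit s" for S
    using limit_memE[OF that assms(1)] assms(2) by metis
  then show ?thesis using limit_self[OF assms(1)] by blast
qed

lemma carr_compl: "carr compl = limit ` {s. cauchy s}"
proof -
  have "carr compl = (\<lambda>S. cauchy_rel quot `` {S}) ` cauchy_seqs quot"
    by (auto simp: seminorm_completion_def completion_space_def quotient_def)
  then show ?thesis by (simp add: cauchy_seqs_quot image_image limit_def)
qed

lemma zer_compl: "zer compl = limit (\<lambda>_. 0)"
  by (simp add: seminorm_completion_def completion_space_def zer_quot limit_def)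

lemma pls_compl: assumes "cauchy s" "cauchy t" shows "pls compl (limit s) (limit t) = limit (\<lambda>n. s n + t n)"
proof -
  have *: "limit (\<lambda>n. s' n + t' n) = limit (\<lambda>n. s n + t n)"
    if *: "cauchy s'" "cauchy t'" "(\<lambda>n. p (s n - s' n)) \<longlonglongrightarrow> 0" "(\<lambda>n. p (t n - t' n)) \<longlonglongrightarrow> 0" for s' t'
  proof -
    note E [simp] = cauchy_in_E[OF *(1)] cauchy_in_E[OF *(2)] cauchy_in_E[OF assms(1)] cauchy_in_E[OF assms(2)]
    have "(\<lambda>n. p (s n - s' n) + p (t n - t' n)) \<longlonglongrightarrow> 0 + 0" using * by (intro tendsto_add)
    then have "(\<lambda>n. p (s n - s' n) + p (t n - t' n)) \<longlonglongrightarrow> 0" by simp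
    then have "(\<lambda>n. p (s n + t n - (s' n + t' n))) \<longlonglongrightarrow> 0"
    proof (rule tendsto_sandwich[OF _ _ tendsto_const, rotated 2])
      show "\<forall>\<^sub>F n in sequentially. 0 \<le> p (s n + t n - (s' n + t' n))"
        by (intro always_eventually allI seminorm_nonneg) simp
      have "p (s n + t n - (s' n + t' n)) \<le> p (s n - s' n) + p (t n - t' n)" for n
        using seminorm_add[of "s n - s' n" "t n - t' n"] by (simp add: algebra_simps)
      then show "\<forall>\<^sub>F n in sequentially. p (s n + t n - (s' n + t' n)) \<le> p (s n - s' n) + p (t n - t' n)"
        by (intro always_eventually allI)
    qed
    then show ?thesis
      using limit_eq_iff[OF cauchy_add[OF assms] cauchy_add[OF *(1,2)]] by simp
  qed
  have "(\<Union>S\<in>limit s. \<Union>T\<in>limit t. cauchy_rel quot `` {\<lambda>n. pls quot (S n) (T n)}) = limit (\<lambda>n. s n + t n)"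
  proof (intro limit_const_UN assms)
    fix s' t' assume a: "cauchy s'" "cauchy t'" "(\<lambda>n. p (s n - s' n)) \<longlonglongrightarrow> 0" "(\<lambda>n. p (t n - t' n)) \<longlonglongrightarrow> 0"
    have "(\<lambda>n. pls quot (coset (s' n)) (coset (t' n))) = (\<lambda>n. coset (s' n + t' n))"
      by (intro ext pls_quot cauchy_in_E[OF a(1)] cauchy_in_E[OF a(2)])
    then show "cauchy_rel quot `` {\<lambda>n. pls quot (coset (s' n)) (coset (t' n))} = limit (\<lambda>n. s n + t n)"
      using *[OF a] by (simp add: limit_def)
  qed
  then show ?thesis by (simp add: seminorm_completion_def completion_space_def)
qed

lemma scl_compl: assumes "cauchy s" shows "scl compl c (limit s) = limit (\<lambda>n. sm c (s n))"
proof -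
  have "(\<Union>S\<in>limit s. cauchy_rel quot `` {\<lambda>n. scl quot c (S n)}) = limit (\<lambda>n. sm c (s n))"
  proof (intro limit_const_UN assms)
    fix t assume t: "cauchy t" "(\<lambda>n. p (s n - t n)) \<longlonglongrightarrow> 0"
    note E [simp] = cauchy_in_E[OF t(1)] cauchy_in_E[OF assms]
    have "(\<lambda>n. norm c * p (s n - t n)) \<longlonglongrightarrow> norm c * 0" using t(2) by (intro tendsto_intros)
    moreover have "p (sm c (s n) - sm c (t n)) = norm c * p (s n - t n)" for n
      using seminorm_scale[of "s n - t n" c] by (simp add: scale_right_diff_distrib)
    ultimately have "limit (\<lambda>n. sm c (s n)) = limit (\<lambda>n. sm c (t n))"
      using limit_eq_iff[OF cauchy_scale[OF assms] cauchy_scale[OF t(1)]] by simp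
    moreover have "(\<lambda>n. scl quot c (coset (t n))) = (\<lambda>n. coset (sm c (t n)))"
      by (intro ext scl_quot cauchy_in_E[OF t(1)])
    ultimately show "cauchy_rel quot `` {\<lambda>n. scl quot c (coset (t n))} = limit (\<lambda>n. sm c (s n))"
      by (simp add: limit_def)
  qed
  then show ?thesis by (simp add: seminorm_completion_def completion_space_def)
qed

lemma nrm_compl: assumes s: "cauchy s" and r: "(\<lambda>n. p (s n)) \<longlonglongrightarrow> r" shows "nrm compl (limit s) = r"
proof -
  have *: "(\<lambda>n. nrm quot (T n)) \<longlonglongrightarrow> r" if T: "T \<in> limit s" for T
  proof -
    obtain t where t: "cauchy t" "(\<lambda>n. p (s n - t n)) \<longlonglongrightarrow> 0" "T = (\<lambda>n. coset (t n))"
      using limit_memE[OF T s] .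
    have "norm (p (s n) - p (t n)) \<le> p (s n - t n)" for n
      using seminorm_diff[OF cauchy_in_E[OF s, of n] cauchy_in_E[OF t(1), of n]] by simp
    then have "(\<lambda>n. p (s n) - p (t n)) \<longlonglongrightarrow> 0"
      by (intro Lim_null_comparison[OF _ t(2)] always_eventually allI)
    from tendsto_diff[OF r this] show ?thesis using t(3) by (simp add: nrm_quot cauchy_in_E[OF t(1)])
  qed
  have "(THE r. \<forall>S\<in>limit s. (\<lambda>n. nrm quot (S n)) \<longlonglongrightarrow> r) = r"
    using * limit_self[OF s] LIMSEQ_unique by (intro the_equality) blast+
  then show ?thesis by (simp add: seminorm_completion_def completion_space_def)
qed

lemma nrm_compl_lim: "cauchy s \<Longrightarrow> (\<lambda>n. p (s n)) \<longlonglongrightarrow> nrm compl (limit s)"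
  using cauchy_norm_convergent nrm_compl by (auto simp: convergent_def)

lemma nrm_compl_const: "x \<in> E \<Longrightarrow> nrm compl (limit (\<lambda>_. x)) = p x"
  by (intro nrm_compl) auto

lemma nrm_compl_nonneg: "cauchy s \<Longrightarrow> 0 \<le> nrm compl (limit s)"
  using nrm_compl_lim[of s] by (rule LIMSEQ_le_const) (auto intro!: seminorm_nonneg cauchy_in_E)

lemma ndist_compl: "cauchy s \<Longrightarrow> cauchy t \<Longrightarrow> ndist compl (limit s) (limit t) = nrm compl (limit (\<lambda>n. s n - t n))"
  unfolding ndist_def
  using cauchy_scale[of t "- 1"] by (simp add: scl_compl pls_compl)

lemma partial_sum_compl:
  assumes "\<And>i. cauchy (s i)"
  shows "partial_sum compl (\<lambda>i. scl compl (c i) (limit (s i))) n = limit (\<lambda>k. \<Sum>i<n. sm (c i) (s i k))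
    \<and> cauchy (\<lambda>k. \<Sum>i<n. sm (c i) (s i k))"
proof (induction n)
  case (Suc n)
  then show ?case using assms by (simp add: scl_compl pls_compl cauchy_scale cauchy_add)
qed (simp add: zer_compl)

end

section \<open>Nuclear expansions\<close>

definition dominated_form ::
  "('k::real_or_complex \<Rightarrow> 'a::ab_group_add \<Rightarrow> 'a) \<Rightarrow> 'a set \<Rightarrow> ('a \<Rightarrow> real) \<Rightarrow> ('a \<Rightarrow> 'k) \<Rightarrow> bool" where
  "dominated_form sm E q g \<longleftrightarrow>
     (\<forall>x\<in>E. \<forall>y\<in>E. g (x + y) = g x + g y) \<and> (\<forall>c. \<forall>x\<in>E. g (sm c x) = c * g x) \<and>
     (\<forall>x\<in>E. norm (g x) \<le> q x)"

text \<open>The expansion \<open>x = \<Sum>\<^sub>i f\<^sub>i(x) y\<^sub>i\<close> with respect to \<open>p\<close>. Its convergence is only required along some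
  cofinal family of finite index sets, which is easier to verify and makes the notion independent of
  an enumeration of the indices. Since the sum is absolutely convergent, the whole net of partial sums
  then converges, see \<open>expansion_remainder\<close>.\<close>

definition nuclear_expansion ::
  "('k::real_or_complex \<Rightarrow> 'a::ab_group_add \<Rightarrow> 'a) \<Rightarrow> 'a set \<Rightarrow> ('a \<Rightarrow> real) \<Rightarrow> ('a \<Rightarrow> real) \<Rightarrow>
     ('i \<Rightarrow> 'a \<Rightarrow> 'k) \<Rightarrow> ('i \<Rightarrow> 'a) \<Rightarrow> bool" where
  "nuclear_expansion sm E q p f y \<longleftrightarrow>
     (\<forall>i. dominated_form sm E q (f i)) \<and> range y \<subseteq> E \<and> (\<lambda>i. p (y i)) summable_on UNIV \<and>
     (\<forall>x\<in>E. \<forall>A e. finite A \<and> 0 < e \<longrightarrow>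
        (\<exists>B. finite B \<and> A \<subseteq> B \<and> p (x - (\<Sum>i\<in>B. sm (f i x) (y i))) < e))"

lemma nuclear_expansion_approx:
  assumes "nuclear_expansion sm E q p f y" "x \<in> E" "finite A" "0 < e"
  obtains B where "finite B" "A \<subseteq> B" "p (x - (\<Sum>i\<in>B. sm (f i x) (y i))) < e"
proof -
  have "\<forall>A e. finite A \<and> 0 < e \<longrightarrow> (\<exists>B. finite B \<and> A \<subseteq> B \<and> p (x - (\<Sum>i\<in>B. sm (f i x) (y i))) < e)"
    using assms(1,2) by (simp add: nuclear_expansion_def)
  then show thesis using assms(3,4) that by blast
qed

lemma nuclear_expansion_reindex:
  fixes h :: "'j \<Rightarrow> 'i"
  assumes exp: "nuclear_expansion sm E q p f y" and h: "bij h"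
  shows "nuclear_expansion sm E q p (f \<circ> h) (y \<circ> h)"
  unfolding nuclear_expansion_def
proof (intro conjI ballI allI impI; (elim conjE)?)
  show "dominated_form sm E q ((f \<circ> h) j)" for j
    using exp by (simp add: nuclear_expansion_def)
  show "range (y \<circ> h) \<subseteq> E" using exp by (auto simp: nuclear_expansion_def)
  have "(\<lambda>i. p (y i)) summable_on UNIV" using exp by (simp add: nuclear_expansion_def)
  then show "(\<lambda>j. p ((y \<circ> h) j)) summable_on UNIV"
    using summable_on_reindex_bij_betw[OF h, of "\<lambda>i. p (y i)"] by simp
next
  fix x e and A :: "'j set" assume "x \<in> E" "finite A" "0 < (e::real)"
  then obtain B where B: "finite B" "h ` A \<subseteq> B" "p (x - (\<Sum>i\<in>B. sm (f i x) (y i))) < e"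
    by (rule nuclear_expansion_approx[OF exp _ finite_imageI])
  have "(\<Sum>j\<in>h -` B. sm (f (h j) x) (y (h j))) = (\<Sum>i\<in>B. sm (f i x) (y i))"
  proof (rule sum.reindex_bij_betw)
    have "inj_on h (h -` B)" using h by (meson bij_is_inj inj_on_subset subset_UNIV)
    moreover have "h ` (h -` B) = B" using h by (simp add: bij_is_surj surj_image_vimage_eq)
    ultimately show "bij_betw h (h -` B) B" by (simp add: bij_betw_def)
  qed
  then show "\<exists>B. finite B \<and> A \<subseteq> B \<and> p (x - (\<Sum>j\<in>B. sm ((f \<circ> h) j x) ((y \<circ> h) j))) < e"
    using B h by (intro exI[of _ "h -` B"]) (auto intro: finite_vimageI bij_is_inj)
qed

context seminormed_space
begin

lemma dominated_form_diff:
  assumes g: "dominated_form sm E p g" and x: "x \<in> E" "y \<in> E"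
  shows "g (x - y) = g x - g y"
proof -
  have "g (x + sm (- 1) y) = g x + - 1 * g y"
    using g x unfolding dominated_form_def by (metis E_closed(4))
  then show ?thesis by simp
qed

lemma dominated_form_convergent:
  assumes g: "dominated_form sm E p g" and s: "cauchy s"
  shows "convergent (\<lambda>n. g (s n))"
proof (rule Cauchy_convergent_real_or_complex, unfold Cauchy_def, intro allI impI)
  fix e :: real assume "0 < e"
  then obtain M where M: "\<forall>m\<ge>M. \<forall>n\<ge>M. p (s m - s n) < e" using cauchyD[OF s] by blast
  have "dist (g (s m)) (g (s n)) < e" if "m \<ge> M" "n \<ge> M" for m n
  proof -
    have "g (s m) - g (s n) = g (s m - s n)"
      using dominated_form_diff[OF g] cauchy_in_E[OF s] by simp
    moreover have "norm (g (s m - s n)) \<le> p (s m - s n)"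
      using g cauchy_in_E[OF s] by (simp add: dominated_form_def)
    moreover have "p (s m - s n) < e" using M that by blast
    ultimately show ?thesis by (simp add: dist_norm)
  qed
  then show "\<exists>M. \<forall>m\<ge>M. \<forall>n\<ge>M. dist (g (s m)) (g (s n)) < e" by blast
qed

text \<open>Any Cauchy sequence that represents \<open>A\<close> gives the same limit, see \<open>extension_limit\<close>.\<close>

definition extension :: "('a \<Rightarrow> 'k) \<Rightarrow> (nat \<Rightarrow> 'a set) set \<Rightarrow> 'k" where
  "extension g A = lim (\<lambda>n. g ((SOME s. cauchy s \<and> A = limit s) n))"

lemma extension_limit:
  assumes g: "dominated_form sm E p g" and s: "cauchy s"
  shows "(\<lambda>n. g (s n)) \<longlonglongrightarrow> extension g (limit s)"
proof -
  define t where "t = (SOME t. cauchy t \<and> limit s = limit t)"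
  have "\<exists>t. cauchy t \<and> limit s = limit t" using s by blast
  then have t: "cauchy t" "limit s = limit t" unfolding t_def by (metis (mono_tags, lifting) someI_ex)+
  have "(\<lambda>n. p (s n - t n)) \<longlonglongrightarrow> 0" using t s limit_eq_iff by blast
  moreover have "norm (g (s n) - g (t n)) \<le> p (s n - t n)" for n
  proof -
    have "norm (g (s n - t n)) \<le> p (s n - t n)"
      using g cauchy_in_E[OF s] cauchy_in_E[OF t(1)] by (simp add: dominated_form_def)
    then show ?thesis
      using dominated_form_diff[OF g cauchy_in_E[OF s] cauchy_in_E[OF t(1)]] by simp
  qed
  ultimately have "(\<lambda>n. g (s n) - g (t n)) \<longlonglongrightarrow> 0"
    by (intro Lim_null_comparison[of "\<lambda>n. g (s n) - g (t n)" "\<lambda>n. p (s n - t n)"] always_eventually allI)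
  moreover have "(\<lambda>n. g (t n)) \<longlonglongrightarrow> extension g (limit s)"
    using dominated_form_convergent[OF g t(1)] unfolding extension_def t_def[symmetric]
    by (simp add: convergent_LIMSEQ_iff)
  ultimately have "(\<lambda>n. g (s n) - g (t n) + g (t n)) \<longlonglongrightarrow> 0 + extension g (limit s)"
    by (rule tendsto_add)
  then show ?thesis by simp
qed

lemma norm_extension_le:
  assumes g: "dominated_form sm E p g" and s: "cauchy s"
  shows "norm (extension g (limit s)) \<le> nrm compl (limit s)"
proof (rule LIMSEQ_le[OF tendsto_norm[OF extension_limit[OF g s]] nrm_compl_lim[OF s]])
  have "norm (g (s n)) \<le> p (s n)" for n
    using g cauchy_in_E[OF s] by (simp add: dominated_form_def)
  then show "\<exists>N. \<forall>n\<ge>N. norm (g (s n)) \<le> p (s n)" by blast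
qed

lemma bounded_extension:
  assumes g: "dominated_form sm E p g"
  shows "bounded_functional compl (extension g)"
  unfolding bounded_functional_def carr_compl
proof (intro conjI ballI allI)
  fix A B assume "A \<in> limit ` {s. cauchy s}" "B \<in> limit ` {s. cauchy s}"
  then obtain s t where s: "cauchy s" "A = limit s" and t: "cauchy t" "B = limit t" by blast
  have "(\<lambda>n. g (s n + t n)) = (\<lambda>n. g (s n) + g (t n))"
    using g cauchy_in_E[OF s(1)] cauchy_in_E[OF t(1)] by (simp add: dominated_form_def)
  then have "(\<lambda>n. g (s n) + g (t n)) \<longlonglongrightarrow> extension g (limit (\<lambda>n. s n + t n))"
    using extension_limit[OF g cauchy_add[OF s(1) t(1)]] by simp
  moreover have "(\<lambda>n. g (s n) + g (t n)) \<longlonglongrightarrow> extension g A + extension g B"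
    unfolding s t by (intro tendsto_add extension_limit g s t)
  ultimately show "extension g (pls compl A B) = extension g A + extension g B"
    using LIMSEQ_unique by (simp add: s t pls_compl)
next
  fix c A assume "A \<in> limit ` {s. cauchy s}"
  then obtain s where s: "cauchy s" "A = limit s" by blast
  have "(\<lambda>n. g (sm c (s n))) = (\<lambda>n. c * g (s n))"
    using g cauchy_in_E[OF s(1)] by (simp add: dominated_form_def)
  then have "(\<lambda>n. c * g (s n)) \<longlonglongrightarrow> extension g (limit (\<lambda>n. sm c (s n)))"
    using extension_limit[OF g cauchy_scale[OF s(1)], of c] by simp
  moreover have "(\<lambda>n. c * g (s n)) \<longlonglongrightarrow> c * extension g A"
    unfolding s by (intro tendsto_mult tendsto_const extension_limit g s)
  ultimately show "extension g (scl compl c A) = c * extension g A"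
    using LIMSEQ_unique by (simp add: s scl_compl)
next
  show "\<exists>K. \<forall>A\<in>limit ` {s. cauchy s}. norm (extension g A) \<le> K * nrm compl A"
    using norm_extension_le[OF g] by (intro exI[of _ 1]) auto
qed

lemma dual_norm_bdd:
  assumes "bounded_functional compl \<phi>"
  shows "bdd_above {norm (\<phi> a) | a. a \<in> carr compl \<and> nrm compl a \<le> 1}"
proof -
  obtain K where K: "\<forall>a\<in>carr compl. norm (\<phi> a) \<le> K * nrm compl a" using assms by (auto simp: bounded_functional_def)
  have "norm (\<phi> a) \<le> \<bar>K\<bar>" if "a \<in> carr compl" "nrm compl a \<le> 1" for a
  proof -
    have "0 \<le> nrm compl a" using that nrm_compl_nonneg by (auto simp: carr_compl)
    then have "K * nrm compl a \<le> \<bar>K\<bar> * 1" using that by (intro mult_mono) auto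
    then show ?thesis using K that by force
  qed
  then show ?thesis unfolding bdd_above_def by blast
qed

lemma dual_norm_nonneg:
  assumes "bounded_functional compl \<phi>"
  shows "0 \<le> dual_norm compl \<phi>"
proof -
  have "norm (\<phi> (limit (\<lambda>_. 0))) \<le> dual_norm compl \<phi>"
    unfolding dual_norm_def using dual_norm_bdd[OF assms]
    by (intro cSup_upper) (auto simp: carr_compl nrm_compl_const)
  then show ?thesis by (meson norm_ge_zero order_trans)
qed

lemma dual_norm_extension_le:
  assumes g: "dominated_form sm E p g"
  shows "dual_norm compl (extension g) \<le> 1"
  unfolding dual_norm_def
proof (rule cSup_least)
  have "limit (\<lambda>_. 0) \<in> carr compl" "nrm compl (limit (\<lambda>_. 0)) \<le> 1" by (simp_all add: carr_compl nrm_compl_const)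
  then show "{norm (extension g a) |a. a \<in> carr compl \<and> nrm compl a \<le> 1} \<noteq> {}" by blast
  show "r \<le> 1" if "r \<in> {norm (extension g a) |a. a \<in> carr compl \<and> nrm compl a \<le> 1}" for r
    using that norm_extension_le[OF g] by (force simp: carr_compl)
qed

lemma functional_le_dual_norm:
  assumes \<phi>: "bounded_functional compl \<phi>" and x: "x \<in> E"
  shows "norm (\<phi> (limit (\<lambda>_. x))) \<le> dual_norm compl \<phi> * p x"
proof (cases "p x = 0")
  case True
  obtain K where "\<forall>a\<in>carr compl. norm (\<phi> a) \<le> K * nrm compl a" using \<phi> by (auto simp: bounded_functional_def)
  moreover have "limit (\<lambda>_. x) \<in> carr compl" using x by (simp add: carr_compl)
  ultimately have "norm (\<phi> (limit (\<lambda>_. x))) \<le> K * p x" using x by (metis nrm_compl_const)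
  then show ?thesis using True by simp
next
  case False
  then have r: "0 < p x" using seminorm_nonneg[OF x] by simp
  define c :: 'k where "c = of_real (1 / p x)"
  have c: "norm c = 1 / p x" using r by (simp only: c_def norm_of_real abs_of_pos zero_less_divide_1_iff)
  have a: "limit (\<lambda>_. x) \<in> carr compl" using x by (simp add: carr_compl)
  have "nrm compl (limit (\<lambda>_. sm c x)) = 1" using x r by (simp add: nrm_compl_const seminorm_scale c)
  moreover have "limit (\<lambda>_. sm c x) \<in> carr compl" using x by (simp add: carr_compl)
  ultimately have "norm (\<phi> (limit (\<lambda>_. sm c x))) \<le> dual_norm compl \<phi>"
    unfolding dual_norm_def using dual_norm_bdd[OF \<phi>] by (intro cSup_upper) auto
  moreover have "\<phi> (limit (\<lambda>_. sm c x)) = c * \<phi> (limit (\<lambda>_. x))"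
  proof -
    have "\<phi> (scl compl c (limit (\<lambda>_. x))) = c * \<phi> (limit (\<lambda>_. x))"
      using \<phi> a by (simp add: bounded_functional_def)
    then show ?thesis by (simp only: scl_compl[OF cauchy_const[OF x]])
  qed
  ultimately show ?thesis using r by (simp add: norm_mult c field_simps)
qed

text \<open>A sparse subsequence of a Cauchy sequence has differences that decrease geometrically. Its telescoping
  series represents the same element of the completion, and its total weight exceeds the norm of that
  element by as little as desired.\<close>

lemma cauchy_as_series:
  assumes s: "cauchy s" and d: "0 < \<delta>"
  obtains z where "range z \<subseteq> E" "summable (\<lambda>k. p (z k))" "(\<Sum>k. p (z k)) \<le> nrm compl (limit s) + \<delta>"
    "\<And>e. 0 < e \<Longrightarrow> \<forall>\<^sub>F m in sequentially. \<forall>\<^sub>F n in sequentially. p (s n - (\<Sum>k<m. z k)) \<le> e"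
proof -
  define e where "e k = \<delta> / 2 * (1 / 2) ^ Suc k" for k :: nat
  have e_sums: "e sums (\<delta> / 2)"
    unfolding e_def using sums_mult[OF power_half_series, of "\<delta> / 2"] by (simp only: mult_1_right)
  have epos: "0 < e k" for k using d by (simp add: e_def)
  \<comment> \<open>The errors \<open>e k\<close> add up to \<open>\<delta> / 2\<close>; the other half is spent on the first term \<open>s N0\<close>.\<close>
  have "\<forall>k. \<exists>M. \<forall>m\<ge>M. \<forall>n\<ge>M. p (s m - s n) < e k" using cauchyD[OF s epos] by blast
  from choice[OF this] obtain N where N: "\<And>k m n. N k \<le> m \<Longrightarrow> N k \<le> n \<Longrightarrow> p (s m - s n) < e k"
    by blast
  have "\<forall>\<^sub>F n in sequentially. p (s n) < nrm compl (limit s) + \<delta> / 2"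
    using order_tendstoD(2)[OF nrm_compl_lim[OF s]] d by simp
  then obtain N0 where N0: "\<And>n. N0 \<le> n \<Longrightarrow> p (s n) < nrm compl (limit s) + \<delta> / 2"
    unfolding eventually_sequentially by blast
  \<comment> \<open>Adding up the \<open>N j\<close> gives an increasing choice of indices.\<close>
  define u where "u k = s (N0 + (\<Sum>j\<le>k. N j))" for k
  have uE: "u k \<in> E" for k by (simp add: u_def cauchy_in_E[OF s])
  define z where "z k = (case k of 0 \<Rightarrow> u 0 | Suc j \<Rightarrow> u (Suc j) - u j)" for k
  have zE: "range z \<subseteq> E" using uE by (auto simp: z_def split: nat.split)
  have sum_z: "(\<Sum>k<Suc m. z k) = u m" for m
    by (induction m) (simp_all add: z_def)
  have le: "N k \<le> N0 + (\<Sum>j\<le>k. N j)" "N k \<le> N0 + (\<Sum>j\<le>Suc k. N j)" for k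
    by (simp_all add: sum.atMost_Suc[of N k] member_le_sum trans_le_add1 trans_le_add2)
  have pz: "p (z (Suc k)) \<le> e k" for k
    using N[OF le(2) le(1), of k] by (simp add: z_def u_def)
  have p0: "p (z 0) \<le> nrm compl (limit s) + \<delta> / 2"
    using N0[of "N0 + (\<Sum>j\<le>0. N j)"] by (simp add: z_def u_def)
  have zE': "z k \<in> E" for k using zE by blast
  have sumz: "summable (\<lambda>k. p (z (Suc k)))"
    by (rule summable_comparison_test'[OF sums_summable[OF e_sums], of 0])
      (simp add: pz seminorm_nonneg[OF zE'])
  have "(\<Sum>k. p (z (Suc k))) \<le> \<delta> / 2"
    using suminf_le[OF pz sumz sums_summable[OF e_sums]] sums_unique[OF e_sums] by simp
  moreover have sumz': "summable (\<lambda>k. p (z k))" using sumz by (subst (asm) summable_Suc_iff)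
  ultimately have "(\<Sum>k. p (z k)) \<le> nrm compl (limit s) + \<delta>"
    using p0 suminf_split_head[OF sumz'] by simp
  moreover have "\<forall>\<^sub>F m in sequentially. \<forall>\<^sub>F n in sequentially. p (s n - (\<Sum>k<m. z k)) \<le> r" if "0 < r" for r
  proof -
    have "e \<longlonglongrightarrow> 0" using e_sums sums_summable summable_LIMSEQ_zero by blast
    then have "\<forall>\<^sub>F k in sequentially. e k < r" using order_tendstoD(2) that by blast
    moreover have "\<forall>\<^sub>F n in sequentially. p (s n - u k) \<le> r" if k: "e k < r" for k
    proof -
      have "p (s n - u k) \<le> r" if "N k \<le> n" for n
        using N[OF that le(1)] k by (simp add: u_def)
      then show ?thesis unfolding eventually_sequentially by blast
    qed
    ultimately have "\<forall>\<^sub>F m in sequentially. \<forall>\<^sub>F n in sequentially. p (s n - (\<Sum>k<Suc m. z k)) \<le> r"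
      unfolding sum_z by (rule eventually_mono)
    then show ?thesis by (subst (asm) eventually_sequentially_Suc)
  qed
  ultimately show thesis using that zE sumz' by blast
qed

end

locale seminormed_pair =
  dom: seminormed_space sm E q + cod: seminormed_space sm E p
  for sm :: "'k::real_or_complex \<Rightarrow> 'a::ab_group_add \<Rightarrow> 'a" and E q p +
  assumes le: "x \<in> E \<Longrightarrow> p x \<le> q x"
begin

lemma cauchy_mono: assumes s: "dom.cauchy s" shows "cod.cauchy s"
  unfolding cod.cauchy_def
proof (intro conjI allI impI)
  show "range s \<subseteq> E" using s by (simp add: dom.cauchy_def)
  fix e :: real assume "0 < e"
  then obtain M where M: "\<forall>m\<ge>M. \<forall>n\<ge>M. q (s m - s n) < e" using dom.cauchyD[OF s] by blast
  have "p (s m - s n) < e" if "m \<ge> M" "n \<ge> M" for m n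
  proof -
    have "p (s m - s n) \<le> q (s m - s n)" using dom.cauchy_in_E[OF s] by (intro le) simp
    also have "\<dots> < e" using M that by blast
    finally show ?thesis .
  qed
  then show "\<exists>M. \<forall>m\<ge>M. \<forall>n\<ge>M. p (s m - s n) < e" by blast
qed

lemma canonical_map_limit:
  assumes s: "dom.cauchy s"
  shows "canonical_map sm E q p (dom.limit s) = cod.limit s"
  unfolding canonical_map_def
proof (rule dom.limit_const_UN[OF s])
  fix t assume t: "dom.cauchy t" "(\<lambda>n. q (s n - t n)) \<longlonglongrightarrow> 0"
  note E = dom.cauchy_in_E[OF s] dom.cauchy_in_E[OF t(1)]
  have "(\<Union>x\<in>dom.coset (t n). ker_rel E p `` {x}) = cod.coset (t n)" for n
    unfolding cod.coset_def[symmetric]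
  proof (rule dom.coset_const_UN[OF E(2)])
    fix y assume y: "y \<in> E" "q (t n - y) = 0"
    have "p (t n - y) \<le> 0" using le[of "t n - y"] y E by simp
    moreover have "0 \<le> p (t n - y)" using y E by (intro cod.seminorm_nonneg) simp
    ultimately show "cod.coset y = cod.coset (t n)"
      using cod.coset_eq_iff[OF E(2) y(1), of n] by simp
  qed
  moreover have "cod.limit t = cod.limit s"
  proof -
    have "norm (p (s n - t n)) \<le> q (s n - t n)" for n
      using le[of "s n - t n"] cod.seminorm_nonneg[of "s n - t n"] E by simp
    then have "(\<lambda>n. p (s n - t n)) \<longlonglongrightarrow> 0"
      by (intro Lim_null_comparison[OF _ t(2)] always_eventually allI)
    then show ?thesis using cod.limit_eq_iff[OF cauchy_mono[OF s] cauchy_mono[OF t(1)]] by simp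
  qed
  ultimately show "cauchy_rel cod.quot `` {\<lambda>n. \<Union>x\<in>dom.coset (t n). ker_rel E p `` {x}} = cod.limit s"
    by (simp add: cod.limit_def)
qed

text \<open>Compare the partial sum over \<open>A\<close> with a much larger one that is close to \<open>x\<close>: the difference only
  involves indices outside \<open>A\<close>. The estimate is uniform in \<open>x\<close>, which is why it carries over to the
  completion.\<close>

lemma expansion_remainder:
  assumes exp: "nuclear_expansion sm E q p f y" and x: "x \<in> E" and A: "finite A"
  shows "p (x - (\<Sum>i\<in>A. sm (f i x) (y i))) \<le> q x * ((\<Sum>\<^sub>\<infinity>i. p (y i)) - (\<Sum>i\<in>A. p (y i)))"
proof (rule field_le_epsilon)
  have yE [simp]: "y i \<in> E" for i using exp by (auto simp: nuclear_expansion_def)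
  have sumy: "(\<lambda>i. p (y i)) summable_on UNIV" using exp by (simp add: nuclear_expansion_def)
  have fle: "norm (f i x) \<le> q x" for i using exp x by (simp add: nuclear_expansion_def dominated_form_def)
  fix e :: real assume "0 < e"
  then obtain B where B: "finite B" "A \<subseteq> B" "p (x - (\<Sum>i\<in>B. sm (f i x) (y i))) < e"
    using nuclear_expansion_approx[OF exp x A] by blast
  have eq: "x - (\<Sum>i\<in>A. sm (f i x) (y i)) =
      (x - (\<Sum>i\<in>B. sm (f i x) (y i))) + (\<Sum>i\<in>B - A. sm (f i x) (y i))"
    by (subst sum_diff[OF B(1,2)]) simp
  have "p (x - (\<Sum>i\<in>A. sm (f i x) (y i))) \<le>
      p (x - (\<Sum>i\<in>B. sm (f i x) (y i))) + p (\<Sum>i\<in>B - A. sm (f i x) (y i))"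
    unfolding eq using x by (intro cod.seminorm_add) simp_all
  also have "p (\<Sum>i\<in>B - A. sm (f i x) (y i)) \<le> (\<Sum>i\<in>B - A. p (sm (f i x) (y i)))"
    by (intro cod.seminorm_sum) simp
  also have "\<dots> \<le> (\<Sum>i\<in>B - A. q x * p (y i))"
    by (intro sum_mono) (simp add: cod.seminorm_scale mult_right_mono fle cod.seminorm_nonneg)
  also have "\<dots> = q x * ((\<Sum>i\<in>B. p (y i)) - (\<Sum>i\<in>A. p (y i)))"
    by (simp add: sum_distrib_left[symmetric] sum_diff[OF B(1,2)])
  also have "\<dots> \<le> q x * ((\<Sum>\<^sub>\<infinity>i. p (y i)) - (\<Sum>i\<in>A. p (y i)))"
    using x by (intro mult_left_mono diff_right_mono finite_sum_le_infsum sumy B)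
      (auto simp: cod.seminorm_nonneg dom.seminorm_nonneg)
  finally show "p (x - (\<Sum>i\<in>A. sm (f i x) (y i))) \<le> q x * ((\<Sum>\<^sub>\<infinity>i. p (y i)) - (\<Sum>i\<in>A. p (y i))) + e"
    using B(3) by simp
qed

text \<open>The forms are extended to the completion of \<open>E / ker q\<close>, and \<open>expansion_remainder\<close> is passed to the
  limit along a Cauchy sequence.\<close>

lemma nuclear_map_if_expansion:
  fixes f :: "nat \<Rightarrow> 'a \<Rightarrow> 'k"
  assumes exp: "nuclear_expansion sm E q p f y"
  shows "nuclear_map dom.compl cod.compl (canonical_map sm E q p)"
  unfolding nuclear_map_def
proof (intro exI conjI allI ballI)
  have f: "dominated_form sm E q (f i)" for i using exp by (simp add: nuclear_expansion_def)
  have yE [simp]: "y i \<in> E" for i using exp by (auto simp: nuclear_expansion_def)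
  have ynn: "0 \<le> p (y i)" for i by (simp add: cod.seminorm_nonneg)
  have sumy: "(\<lambda>i. p (y i)) summable_on UNIV" using exp by (simp add: nuclear_expansion_def)
  then have sumy': "summable (\<lambda>i. p (y i))" by (simp add: summable_on_UNIV_nonneg_real_iff ynn)
  let ?F = "\<lambda>i. dom.extension (f i)" and ?Y = "\<lambda>i. cod.limit (\<lambda>_. y i)"
  show "bounded_functional dom.compl (?F i)" for i by (rule dom.bounded_extension[OF f])
  show "?Y i \<in> carr cod.compl" for i by (simp add: cod.carr_compl)
  show "summable (\<lambda>i. dual_norm dom.compl (?F i) * nrm cod.compl (?Y i))"
  proof (rule summable_comparison_test'[OF sumy', of 0])
    fix i
    have "dual_norm dom.compl (?F i) * p (y i) \<le> 1 * p (y i)"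
      by (intro mult_right_mono dom.dual_norm_extension_le f ynn)
    then show "norm (dual_norm dom.compl (?F i) * nrm cod.compl (?Y i)) \<le> p (y i)"
      by (simp add: cod.nrm_compl_const abs_mult dom.dual_norm_nonneg[OF dom.bounded_extension[OF f]] ynn)
  qed
  fix a assume "a \<in> carr dom.compl"
  then obtain s where s: "dom.cauchy s" and a: "a = dom.limit s" by (auto simp: dom.carr_compl)
  note sE [simp] = dom.cauchy_in_E[OF s]
  let ?S = "\<lambda>n. \<Sum>i<n. sm (?F i a) (y i)"
  let ?tail = "\<lambda>n. (\<Sum>\<^sub>\<infinity>i. p (y i)) - (\<Sum>i<n. p (y i))"
  have ps: "partial_sum cod.compl (\<lambda>i. scl cod.compl (?F i a) (?Y i)) n = cod.limit (\<lambda>_. ?S n)" for n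
    using cod.partial_sum_compl[of "\<lambda>i _. y i" "\<lambda>i. ?F i a" n] by simp
  have "ndist cod.compl (canonical_map sm E q p a) (partial_sum cod.compl (\<lambda>i. scl cod.compl (?F i a) (?Y i)) n)
      \<le> nrm dom.compl a * ?tail n" for n
  proof -
    have "(\<lambda>k. p (s k - ?S n)) \<longlonglongrightarrow> nrm cod.compl (cod.limit (\<lambda>k. s k - ?S n))"
      by (intro cod.nrm_compl_lim cod.cauchy_diff cauchy_mono s cod.cauchy_const cod.E_sum cod.E_closed yE)
    moreover have "(\<lambda>k. q (s k) * ?tail n + (\<Sum>i<n. norm (f i (s k) - ?F i a) * p (y i))) \<longlonglongrightarrow>
        nrm dom.compl a * ?tail n + (\<Sum>i<n. norm (?F i a - ?F i a) * p (y i))"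
      unfolding a by (intro tendsto_intros dom.nrm_compl_lim dom.extension_limit f s)
    then have "(\<lambda>k. q (s k) * ?tail n + (\<Sum>i<n. norm (f i (s k) - ?F i a) * p (y i))) \<longlonglongrightarrow>
        nrm dom.compl a * ?tail n" by simp
    moreover have "p (s k - ?S n) \<le> q (s k) * ?tail n + (\<Sum>i<n. norm (f i (s k) - ?F i a) * p (y i))" for k
    proof -
      have eq: "s k - ?S n = (s k - (\<Sum>i<n. sm (f i (s k)) (y i))) + (\<Sum>i<n. sm (f i (s k) - ?F i a) (y i))"
        by (simp add: dom.scale_left_diff_distrib sum_subtractf)
      have "p (s k - ?S n) \<le> p (s k - (\<Sum>i<n. sm (f i (s k)) (y i))) + p (\<Sum>i<n. sm (f i (s k) - ?F i a) (y i))"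
        unfolding eq by (rule cod.seminorm_add) simp_all
      moreover have "p (\<Sum>i<n. sm (f i (s k) - ?F i a) (y i)) \<le> (\<Sum>i<n. norm (f i (s k) - ?F i a) * p (y i))"
        using cod.seminorm_sum[of "{..<n}" "\<lambda>i. sm (f i (s k) - ?F i a) (y i)"] by (simp add: cod.seminorm_scale)
      moreover have "p (s k - (\<Sum>i<n. sm (f i (s k)) (y i))) \<le> q (s k) * ?tail n"
        by (rule expansion_remainder[OF exp]) simp_all
      ultimately show ?thesis by linarith
    qed
    ultimately have "nrm cod.compl (cod.limit (\<lambda>k. s k - ?S n)) \<le> nrm dom.compl a * ?tail n"
      by (intro LIMSEQ_le[of "\<lambda>k. p (s k - ?S n)"]) blast+
    then show ?thesis
      unfolding ps by (simp add: a canonical_map_limit[OF s] cod.ndist_compl cauchy_mono[OF s])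
  qed
  note upper = this
  have lower: "0 \<le> ndist cod.compl (canonical_map sm E q p a) (partial_sum cod.compl (\<lambda>i. scl cod.compl (?F i a) (?Y i)) n)" for n
    unfolding ps by (simp add: a canonical_map_limit[OF s] cod.ndist_compl cod.nrm_compl_nonneg cod.cauchy_diff cauchy_mono[OF s])
  have "(\<lambda>n. nrm dom.compl a * ?tail n) \<longlonglongrightarrow> 0"
  proof -
    have "(\<lambda>n. \<Sum>i<n. p (y i)) \<longlonglongrightarrow> (\<Sum>\<^sub>\<infinity>i. p (y i))"
      using has_sum_imp_sums[OF has_sum_infsum[OF sumy]] by (simp add: sums_def)
    then have "(\<lambda>n. nrm dom.compl a * ?tail n) \<longlonglongrightarrow> nrm dom.compl a * ((\<Sum>\<^sub>\<infinity>i. p (y i)) - (\<Sum>\<^sub>\<infinity>i. p (y i)))"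
      by (intro tendsto_intros)
    then show ?thesis by simp
  qed
  then show "(\<lambda>n. ndist cod.compl (canonical_map sm E q p a)
        (partial_sum cod.compl (\<lambda>i. scl cod.compl (?F i a) (?Y i)) n)) \<longlonglongrightarrow> 0"
  proof (rule tendsto_sandwich[OF _ _ tendsto_const, rotated 2])
    show "\<forall>\<^sub>F n in sequentially. 0 \<le> ndist cod.compl (canonical_map sm E q p a)
        (partial_sum cod.compl (\<lambda>i. scl cod.compl (?F i a) (?Y i)) n)"
      using lower by (intro always_eventually allI)
    show "\<forall>\<^sub>F n in sequentially. ndist cod.compl (canonical_map sm E q p a)
        (partial_sum cod.compl (\<lambda>i. scl cod.compl (?F i a) (?Y i)) n) \<le> nrm dom.compl a * ?tail n"
      using upper by (intro always_eventually allI)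
  qed
qed

text \<open>Each vector \<open>y\<^sub>i\<close> of the completion is replaced by a series of vectors \<open>z\<^sub>i\<^sub>k\<close> of \<open>E\<close>, so the new expansion
  is indexed by pairs. The weight that is added in the \<open>i\<close>-th series is chosen so small that it remains
  summable after multiplication by the dual norm of \<open>f\<^sub>i\<close>.\<close>

lemma expansion_if_nuclear_map:
  assumes nuc: "nuclear_map dom.compl cod.compl (canonical_map sm E q p)"
  obtains f y where "nuclear_expansion sm E q p (f :: nat \<times> nat \<Rightarrow> 'a \<Rightarrow> 'k) y"
proof -
  from nuc[unfolded nuclear_map_def] obtain f y where
    fy: "(\<forall>i. bounded_functional dom.compl (f i)) \<and> (\<forall>i. y i \<in> carr cod.compl) \<and>
        summable (\<lambda>i. dual_norm dom.compl (f i) * nrm cod.compl (y i)) \<and>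
        (\<forall>a\<in>carr dom.compl.
           (\<lambda>n. ndist cod.compl (canonical_map sm E q p a)
              (partial_sum cod.compl (\<lambda>i. scl cod.compl (f i a) (y i)) n)) \<longlonglongrightarrow> 0)"
    by (elim exE)
  note f = fy[THEN conjunct1, rule_format] and y = fy[THEN conjunct2, THEN conjunct1, rule_format]
    and sums = fy[THEN conjunct2, THEN conjunct2, THEN conjunct1]
    and conv = fy[THEN conjunct2, THEN conjunct2, THEN conjunct2, rule_format]
  define d where "d i = dual_norm dom.compl (f i)" for i
  define g where "g i x = f i (dom.limit (\<lambda>_. x))" for i x
  have d0: "0 \<le> d i" for i using dom.dual_norm_nonneg[OF f] by (simp add: d_def)
  have gd: "norm (g i x) \<le> d i * q x" if "x \<in> E" for i x
    using dom.functional_le_dual_norm[OF f that] by (simp add: d_def g_def)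
  have "\<forall>i. \<exists>s. cod.cauchy s \<and> y i = cod.limit s" using y by (auto simp: cod.carr_compl)
  from choice[OF this] obtain s where s: "\<And>i. cod.cauchy (s i)" "\<And>i. y i = cod.limit (s i)" by blast
  have sE [simp]: "s i n \<in> E" for i n by (rule cod.cauchy_in_E[OF s(1)])
  define \<delta> where "\<delta> i = (1 / 2) ^ i / (1 + d i)" for i :: nat
  have \<delta>: "0 < \<delta> i" for i using d0[of i] by (simp add: \<delta>_def add_pos_nonneg)
  have "\<forall>i. \<exists>z. range z \<subseteq> E \<and> summable (\<lambda>k. p (z k)) \<and> (\<Sum>k. p (z k)) \<le> nrm cod.compl (y i) + \<delta> i \<and>
     (\<forall>e>0. \<forall>\<^sub>F m in sequentially. \<forall>\<^sub>F n in sequentially. p (s i n - (\<Sum>k<m. z k)) \<le> e)"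
  proof
    fix i
    obtain z where z: "range z \<subseteq> E" "summable (\<lambda>k. p (z k))"
      "(\<Sum>k. p (z k)) \<le> nrm cod.compl (cod.limit (s i)) + \<delta> i"
      "\<And>e. 0 < e \<Longrightarrow> \<forall>\<^sub>F m in sequentially. \<forall>\<^sub>F n in sequentially. p (s i n - (\<Sum>k<m. z k)) \<le> e"
      using cod.cauchy_as_series[OF s(1)[of i] \<delta>[of i]] by blast
    show "\<exists>z. range z \<subseteq> E \<and> summable (\<lambda>k. p (z k)) \<and> (\<Sum>k. p (z k)) \<le> nrm cod.compl (y i) + \<delta> i \<and>
     (\<forall>e>0. \<forall>\<^sub>F m in sequentially. \<forall>\<^sub>F n in sequentially. p (s i n - (\<Sum>k<m. z k)) \<le> e)"
      using z s(2)[of i] by (intro exI[of _ z] conjI allI impI) simp_all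
  qed
  from choice[OF this] obtain z where z: "\<forall>i. range (z i) \<subseteq> E \<and> summable (\<lambda>k. p (z i k)) \<and>
     (\<Sum>k. p (z i k)) \<le> nrm cod.compl (y i) + \<delta> i \<and>
     (\<forall>e>0. \<forall>\<^sub>F m in sequentially. \<forall>\<^sub>F n in sequentially. p (s i n - (\<Sum>k<m. z i k)) \<le> e)"
    by (elim exE)
  have zE: "range (z i) \<subseteq> E" and zs: "summable (\<lambda>k. p (z i k))"
    and zle: "(\<Sum>k. p (z i k)) \<le> nrm cod.compl (y i) + \<delta> i" for i
    using z[rule_format, of i] by simp_all
  have zlim: "\<forall>\<^sub>F m in sequentially. \<forall>\<^sub>F n in sequentially. p (s i n - (\<Sum>k<m. z i k)) \<le> e"
    if "0 < e" for i e using z[rule_format, of i] that by simp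
  have zE' [simp]: "z i k \<in> E" for i k using zE by blast
  have z0: "0 \<le> p (z i k)" for i k by (simp add: cod.seminorm_nonneg)
  \<comment> \<open>If \<open>d i = 0\<close> then \<open>g i\<close> vanishes on \<open>E\<close>, and both factors may be \<open>0\<close>.\<close>
  define F where "F = (\<lambda>(i, k::nat) x. g i x / of_real (d i))"
  define Y where "Y = (\<lambda>(i, k). sm (of_real (d i)) (z i k))"
  have dn: "\<bar>d i\<bar> = d i" for i using d0 by simp
  have dom_F: "dominated_form sm E q (F j)" for j
  proof -
    obtain i k where j: "j = (i, k)" by fastforce
    have add: "g i (x + x') = g i x + g i x'" if "x \<in> E" "x' \<in> E" for x x'
    proof -
      have "dom.limit (\<lambda>_. x) \<in> carr dom.compl" "dom.limit (\<lambda>_. x') \<in> carr dom.compl"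
        using that by (simp_all add: dom.carr_compl)
      then have "f i (pls dom.compl (dom.limit (\<lambda>_. x)) (dom.limit (\<lambda>_. x'))) = g i x + g i x'"
        using f[of i] by (simp add: bounded_functional_def g_def)
      then show ?thesis using that by (simp add: dom.pls_compl g_def)
    qed
    have scale: "g i (sm c x) = c * g i x" if "x \<in> E" for c x
    proof -
      have "dom.limit (\<lambda>_. x) \<in> carr dom.compl"
        using that by (simp add: dom.carr_compl)
      then have "f i (scl dom.compl c (dom.limit (\<lambda>_. x))) = c * g i x"
        using f[of i] by (simp add: bounded_functional_def g_def)
      then show ?thesis using that by (simp add: dom.scl_compl g_def)
    qed
    have bound: "norm (g i x / of_real (d i)) \<le> q x" if "x \<in> E" for x
    proof (cases "d i = 0")
      case False
      then show ?thesis using gd[OF that, of i] d0[of i] by (simp add: norm_divide field_simps)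
    qed (use that dom.seminorm_nonneg in simp)
    show ?thesis unfolding dominated_form_def j F_def
      using add scale bound by (simp add: add_divide_distrib)
  qed
  have pY: "p (Y (i, k)) = d i * p (z i k)" for i k
    by (simp add: Y_def cod.seminorm_scale dn)
  have sumY: "(\<lambda>j. p (Y j)) summable_on UNIV"
  proof (rule nonneg_bounded_partial_sums_imp_summable_on)
    show "0 \<le> p (Y j)" for j using pY[of "fst j" "snd j"] by (simp add: d0 z0)
    have t: "summable (\<lambda>i. d i * nrm cod.compl (y i) + (1 / 2) ^ i)"
      using sums by (intro summable_add) (simp_all add: d_def)
    let ?K = "\<Sum>i. d i * nrm cod.compl (y i) + (1 / 2) ^ i"
    have "sum (\<lambda>j. p (Y j)) A \<le> ?K" if A: "finite A" for A
    proof -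
      define N where "N = Suc (Max (insert 0 (fst ` A \<union> snd ` A)))"
      have "i < N \<and> k < N" if "(i, k) \<in> A" for i k
        using A that unfolding N_def by (force simp: less_Suc_eq_le intro!: Max_ge)
      then have "A \<subseteq> {..<N} \<times> {..<N}" by auto
      then have "sum (\<lambda>j. p (Y j)) A \<le> sum (\<lambda>j. p (Y j)) ({..<N} \<times> {..<N})"
        by (intro sum_mono2) (auto simp: pY d0 z0)
      also have "\<dots> = (\<Sum>i<N. d i * (\<Sum>k<N. p (z i k)))"
        by (simp add: sum.cartesian_product' pY sum_distrib_left)
      also have "\<dots> \<le> (\<Sum>i<N. d i * nrm cod.compl (y i) + (1 / 2) ^ i)"
      proof (rule sum_mono)
        fix i
        have "(\<Sum>k<N. p (z i k)) \<le> nrm cod.compl (y i) + \<delta> i"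
          using sum_le_suminf[OF zs[of i], of "{..<N}"] zle[of i] z0 by simp
        then have "d i * (\<Sum>k<N. p (z i k)) \<le> d i * nrm cod.compl (y i) + d i * \<delta> i"
          using d0[of i] by (metis mult_left_mono distrib_left)
        also have "d i * \<delta> i \<le> (1 / 2) ^ i"
        proof -
          have "d i / (1 + d i) \<le> 1" using d0[of i] by simp
          from mult_left_mono[OF this, of "(1 / 2) ^ i"] show ?thesis by (simp add: \<delta>_def mult.commute)
        qed
        finally show "d i * (\<Sum>k<N. p (z i k)) \<le> d i * nrm cod.compl (y i) + (1 / 2) ^ i" by simp
      qed
      also have "\<dots> \<le> ?K"
        using d0 s by (intro sum_le_suminf[OF t]) (auto intro!: add_nonneg_nonneg mult_nonneg_nonneg cod.nrm_compl_nonneg)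
      finally show ?thesis .
    qed
    then show "\<forall>\<^sub>F A in finite_subsets_at_top UNIV. sum (\<lambda>j. p (Y j)) A \<le> ?K"
      by (intro eventually_finite_subsets_at_top_weakI) auto
  qed
  have approx: "\<exists>B. finite B \<and> A \<subseteq> B \<and> p (x - (\<Sum>j\<in>B. sm (F j x) (Y j))) < e"
    if x: "x \<in> E" and A: "finite A" and e: "0 < e" for x A and e :: real
  proof -
    have xC: "dom.limit (\<lambda>_. x) \<in> carr dom.compl" using x by (simp add: dom.carr_compl)
    have "\<forall>\<^sub>F n in sequentially. ndist cod.compl (canonical_map sm E q p (dom.limit (\<lambda>_. x)))
        (partial_sum cod.compl (\<lambda>i. scl cod.compl (f i (dom.limit (\<lambda>_. x))) (y i)) n) < e / 2"
      using order_tendstoD(2)[OF conv[OF xC], of "e / 2"] e by simp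
    moreover have "\<forall>\<^sub>F n in sequentially. Max (insert 0 (fst ` A)) < n" by (rule eventually_gt_at_top)
    ultimately have "\<forall>\<^sub>F n in sequentially. ndist cod.compl (canonical_map sm E q p (dom.limit (\<lambda>_. x)))
        (partial_sum cod.compl (\<lambda>i. scl cod.compl (f i (dom.limit (\<lambda>_. x))) (y i)) n) < e / 2 \<and> Max (insert 0 (fst ` A)) < n"
      by (rule eventually_conj)
    then obtain N where "ndist cod.compl (canonical_map sm E q p (dom.limit (\<lambda>_. x)))
        (partial_sum cod.compl (\<lambda>i. scl cod.compl (f i (dom.limit (\<lambda>_. x))) (y i)) N) < e / 2"
      and NA: "Max (insert 0 (fst ` A)) < N"
      unfolding eventually_sequentially by blast
    moreover have psN: "partial_sum cod.compl (\<lambda>i. scl cod.compl (f i (dom.limit (\<lambda>_. x))) (y i)) N =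
        cod.limit (\<lambda>k. \<Sum>i<N. sm (g i x) (s i k))" and cN: "cod.cauchy (\<lambda>k. \<Sum>i<N. sm (g i x) (s i k))"
      using cod.partial_sum_compl[where s = s and c = "\<lambda>i. g i x" and n = N, OF s(1)] by (simp_all add: g_def s(2)[symmetric])
    ultimately have "nrm cod.compl (cod.limit (\<lambda>k. x - (\<Sum>i<N. sm (g i x) (s i k)))) < e / 2"
      by (simp add: canonical_map_limit x cod.ndist_compl)
    from order_tendstoD(2)[OF cod.nrm_compl_lim this]
    have ev1: "\<forall>\<^sub>F k in sequentially. p (x - (\<Sum>i<N. sm (g i x) (s i k))) < e / 2"
      using x cN by (simp add: cod.cauchy_diff)
    define G where "G = (\<Sum>i<N. norm (g i x))"
    have G0: "0 \<le> G" by (simp add: G_def sum_nonneg)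
    define r where "r = e / (2 * (1 + G))"
    have r: "0 < r" using e G0 by (simp add: r_def)
    \<comment> \<open>With \<open>N\<close> fixed, all the series with index below \<open>N\<close> are truncated at the same place.\<close>
    have "\<forall>\<^sub>F m in sequentially. \<forall>i\<in>{..<N}. \<forall>\<^sub>F n in sequentially. p (s i n - (\<Sum>k<m. z i k)) \<le> r"
      using zlim[OF r] by (intro eventually_ball_finite) simp_all
    moreover have "\<forall>\<^sub>F m in sequentially. Max (insert 0 (snd ` A)) < m" by (rule eventually_gt_at_top)
    ultimately have "\<forall>\<^sub>F m in sequentially. (\<forall>i\<in>{..<N}. \<forall>\<^sub>F n in sequentially. p (s i n - (\<Sum>k<m. z i k)) \<le> r)
        \<and> Max (insert 0 (snd ` A)) < m" by (rule eventually_conj)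
    then obtain M where M: "\<forall>i\<in>{..<N}. \<forall>\<^sub>F n in sequentially. p (s i n - (\<Sum>k<M. z i k)) \<le> r"
      and MA: "Max (insert 0 (snd ` A)) < M" unfolding eventually_sequentially by blast
    have "\<forall>\<^sub>F n in sequentially. \<forall>i\<in>{..<N}. p (s i n - (\<Sum>k<M. z i k)) \<le> r"
      using M by (intro eventually_ball_finite) simp_all
    from eventually_conj[OF this ev1]
    obtain n where n: "\<forall>i\<in>{..<N}. p (s i n - (\<Sum>k<M. z i k)) \<le> r" "p (x - (\<Sum>i<N. sm (g i x) (s i n))) < e / 2"
      unfolding eventually_sequentially by blast
    have g_d: "sm (g i x / of_real (d i)) (sm (of_real (d i)) v) = sm (g i x) v" for i v
      using gd[OF x, of i] by (cases "d i = 0") auto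
    have "(\<Sum>j\<in>{..<N} \<times> {..<M}. sm (F j x) (Y j)) = (\<Sum>i<N. sm (g i x) (\<Sum>k<M. z i k))"
      by (simp add: sum.cartesian_product' F_def Y_def g_d dom.scale_sum_right del: dom.scale_scale)
    then have eq: "x - (\<Sum>j\<in>{..<N} \<times> {..<M}. sm (F j x) (Y j)) =
        (x - (\<Sum>i<N. sm (g i x) (s i n))) + (\<Sum>i<N. sm (g i x) (s i n - (\<Sum>k<M. z i k)))"
      by (simp add: dom.scale_right_diff_distrib sum_subtractf)
    have "p (x - (\<Sum>j\<in>{..<N} \<times> {..<M}. sm (F j x) (Y j))) \<le>
        p (x - (\<Sum>i<N. sm (g i x) (s i n))) + p (\<Sum>i<N. sm (g i x) (s i n - (\<Sum>k<M. z i k)))"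
      unfolding eq using x by (intro cod.seminorm_add) simp_all
    also have "p (\<Sum>i<N. sm (g i x) (s i n - (\<Sum>k<M. z i k))) \<le> (\<Sum>i<N. norm (g i x) * p (s i n - (\<Sum>k<M. z i k)))"
      using cod.seminorm_sum[of "{..<N}" "\<lambda>i. sm (g i x) (s i n - (\<Sum>k<M. z i k))"]
      by (simp add: cod.seminorm_scale)
    also have "\<dots> \<le> (\<Sum>i<N. norm (g i x) * r)"
      using n(1) by (intro sum_mono mult_left_mono) auto
    also have "\<dots> = G * r" by (simp add: G_def sum_distrib_right)
    also have "\<dots> \<le> e / 2" using G0 e by (simp add: r_def field_simps)
    finally have "p (x - (\<Sum>j\<in>{..<N} \<times> {..<M}. sm (F j x) (Y j))) < e" using n(2) by simp
    moreover have "A \<subseteq> {..<N} \<times> {..<M}"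
    proof
      fix j assume "j \<in> A"
      then have "fst j \<le> Max (insert 0 (fst ` A))" "snd j \<le> Max (insert 0 (snd ` A))"
        using A by (auto intro!: Max_ge)
      then show "j \<in> {..<N} \<times> {..<M}" using NA MA by (cases j) auto
    qed
    ultimately show ?thesis by (intro exI[of _ "{..<N} \<times> {..<M}"]) simp
  qed
  have "range Y \<subseteq> E" by (auto simp: Y_def)
  then have "nuclear_expansion sm E q p F Y"
    unfolding nuclear_expansion_def using dom_F sumY approx by blast
  then show thesis using that by blast
qed

end

lemma nuclear_space_iff_expansion:
  fixes sm :: "'k::real_or_complex \<Rightarrow> 'a::ab_group_add \<Rightarrow> 'a"
  assumes "vector_space sm" "module.subspace sm (topspace X)"
  shows "nuclear_space sm X \<longleftrightarrow>
    (\<forall>p. continuous_seminorm sm X p \<longrightarrow>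
       (\<exists>q. continuous_seminorm sm X q \<and> (\<forall>x\<in>topspace X. p x \<le> q x) \<and>
          (\<exists>(f :: nat \<Rightarrow> 'a \<Rightarrow> 'k) y. nuclear_expansion sm (topspace X) q p f y)))"
proof -
  have "nuclear_map (seminorm_completion sm (topspace X) q) (seminorm_completion sm (topspace X) p)
      (canonical_map sm (topspace X) q p) \<longleftrightarrow>
    (\<exists>(f :: nat \<Rightarrow> 'a \<Rightarrow> 'k) y. nuclear_expansion sm (topspace X) q p f y)"
    if p: "continuous_seminorm sm X p" and q: "continuous_seminorm sm X q"
      and le: "\<forall>x\<in>topspace X. p x \<le> q x" for p q
  proof -
    interpret vector_space sm by fact
    interpret seminormed_pair sm "topspace X" q p
      using assms(2) p q le by unfold_locales (auto simp: continuous_seminorm_def)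
    show ?thesis
    proof
      assume "nuclear_map dom.compl cod.compl (canonical_map sm (topspace X) q p)"
      then obtain f y where "nuclear_expansion sm (topspace X) q p (f :: nat \<times> nat \<Rightarrow> 'a \<Rightarrow> 'k) y"
        by (rule expansion_if_nuclear_map)
      from nuclear_expansion_reindex[OF this bij_prod_decode]
      show "\<exists>(f :: nat \<Rightarrow> 'a \<Rightarrow> 'k) y. nuclear_expansion sm (topspace X) q p f y" by blast
    qed (use nuclear_map_if_expansion in blast)
  qed
  then show ?thesis unfolding nuclear_space_def by blast
qed

section \<open>Retracts of nuclear spaces\<close>

definition linear_between ::
  "('k::real_or_complex \<Rightarrow> 'a::ab_group_add \<Rightarrow> 'a) \<Rightarrow> 'a set \<Rightarrow>
   ('k \<Rightarrow> 'b::ab_group_add \<Rightarrow> 'b) \<Rightarrow> 'b set \<Rightarrow> ('a \<Rightarrow> 'b) \<Rightarrow> bool" where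
  "linear_between sm E sm' E' h \<longleftrightarrow>
     (\<forall>x\<in>E. h x \<in> E') \<and> (\<forall>x\<in>E. \<forall>y\<in>E. h (x + y) = h x + h y) \<and> (\<forall>c. \<forall>x\<in>E. h (sm c x) = sm' c (h x))"

lemma (in seminormed_space) linear_between_sum:
  assumes h: "linear_between sm E sm' E' h" and A: "finite A" and g: "\<And>i. g i \<in> E" and x: "x \<in> E"
  shows "h (x - (\<Sum>i\<in>A. sm (c i) (g i))) = h x - (\<Sum>i\<in>A. sm' (c i) (h (g i)))"
proof -
  have add: "h (a + b) = h a + h b" if "a \<in> E" "b \<in> E" for a b
    using h that by (simp add: linear_between_def)
  have zero: "h 0 = 0" using add[of 0 0] by simp
  have sum: "h (\<Sum>i\<in>A. sm (c i) (g i)) = (\<Sum>i\<in>A. sm' (c i) (h (g i)))"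
    using A
  proof (induction A rule: finite_induct)
    case (insert i A)
    have "h (sm (c i) (g i)) = sm' (c i) (h (g i))"
      using h g by (simp add: linear_between_def)
    then show ?case using insert g by (simp add: add)
  qed (simp add: zero)
  have "h (x - (\<Sum>i\<in>A. sm (c i) (g i))) + h (\<Sum>i\<in>A. sm (c i) (g i)) = h x"
    using add[of "x - (\<Sum>i\<in>A. sm (c i) (g i))" "\<Sum>i\<in>A. sm (c i) (g i)"] x g by simp
  then show ?thesis by (simp add: sum algebra_simps)
qed

text \<open>With \<open>\<iota> = \<pi> = id\<close> this is the monotonicity of expansions in the two seminorms; in general it is the
  reason why retracts of nuclear spaces are nuclear.\<close>

lemma nuclear_expansion_transfer:
  fixes f :: "'i \<Rightarrow> 'a::ab_group_add \<Rightarrow> 'k::real_or_complex"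
  assumes exp: "nuclear_expansion sm E q p f y"
    and p: "seminormed_space sm E p" and p': "seminormed_space sm' E' p'"
    and inc: "linear_between sm' E' sm E \<iota>" and pr: "linear_between sm E sm' E' \<pi>"
    and retr: "\<And>x. x \<in> E' \<Longrightarrow> \<pi> (\<iota> x) = x"
    and q: "\<And>x. x \<in> E' \<Longrightarrow> q (\<iota> x) \<le> q' x"
    and K: "0 < K" and pK: "\<And>z. z \<in> E \<Longrightarrow> p' (\<pi> z) \<le> K * p z"
  shows "nuclear_expansion sm' E' q' p' (\<lambda>i x. f i (\<iota> x)) (\<lambda>i. \<pi> (y i))"
  unfolding nuclear_expansion_def
proof (intro conjI allI ballI impI; (elim conjE)?)
  interpret P: seminormed_space sm E p by fact
  interpret P': seminormed_space sm' E' p' by fact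
  have yE [simp]: "y i \<in> E" for i using exp by (auto simp: nuclear_expansion_def)
  have f: "dominated_form sm E q (f i)" for i using exp by (simp add: nuclear_expansion_def)
  have inE: "\<iota> x \<in> E" if "x \<in> E'" for x using inc that by (simp add: linear_between_def)
  have prE: "\<pi> x \<in> E'" if "x \<in> E" for x using pr that by (simp add: linear_between_def)
  show "dominated_form sm' E' q' (\<lambda>x. f i (\<iota> x))" for i
    unfolding dominated_form_def
  proof (intro conjI ballI allI)
    show "f i (\<iota> (x + x')) = f i (\<iota> x) + f i (\<iota> x')" if "x \<in> E'" "x' \<in> E'" for x x'
      using f[of i] inc that inE by (simp add: dominated_form_def linear_between_def)
    show "f i (\<iota> (sm' c x)) = c * f i (\<iota> x)" if "x \<in> E'" for c x
      using f[of i] inc that inE by (simp add: dominated_form_def linear_between_def)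
    show "norm (f i (\<iota> x)) \<le> q' x" if "x \<in> E'" for x
    proof -
      have "norm (f i (\<iota> x)) \<le> q (\<iota> x)"
        using f[of i] inE[OF that] by (simp add: dominated_form_def)
      also have "\<dots> \<le> q' x" by (rule q[OF that])
      finally show ?thesis .
    qed
  qed
  show "range (\<lambda>i. \<pi> (y i)) \<subseteq> E'" using prE by auto
  have "(\<lambda>i. K * p (y i)) summable_on UNIV"
    using exp by (intro summable_on_cmult_right) (simp add: nuclear_expansion_def)
  then show "(\<lambda>i. p' (\<pi> (y i))) summable_on UNIV"
    by (rule summable_on_comparison_test) (simp_all add: pK prE P'.seminorm_nonneg)
  fix x e and A :: "'i set" assume x: "x \<in> E'" and A: "finite A" and e: "0 < (e::real)"
  have "0 < e / K" using e K by simp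
  obtain B where B: "finite B" "A \<subseteq> B" "p (\<iota> x - (\<Sum>i\<in>B. sm (f i (\<iota> x)) (y i))) < e / K"
    by (rule nuclear_expansion_approx[OF exp inE[OF x] A \<open>0 < e / K\<close>])
  have "x - (\<Sum>i\<in>B. sm' (f i (\<iota> x)) (\<pi> (y i))) = \<pi> (\<iota> x - (\<Sum>i\<in>B. sm (f i (\<iota> x)) (y i)))"
    using P.linear_between_sum[OF pr B(1), of y "\<iota> x"] inE[OF x] by (simp add: retr[OF x])
  moreover have "p' (\<pi> (\<iota> x - (\<Sum>i\<in>B. sm (f i (\<iota> x)) (y i)))) \<le>
      K * p (\<iota> x - (\<Sum>i\<in>B. sm (f i (\<iota> x)) (y i)))"
    using inE[OF x] by (intro pK) simp
  moreover have "K * p (\<iota> x - (\<Sum>i\<in>B. sm (f i (\<iota> x)) (y i))) < e"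
    using B(3) K by (simp add: field_simps)
  ultimately show "\<exists>B. finite B \<and> A \<subseteq> B \<and> p' (x - (\<Sum>i\<in>B. sm' (f i (\<iota> x)) (\<pi> (y i)))) < e"
    using B(1,2) by (intro exI[of _ B]) simp
qed

lemma seminormed_spaceI:
  assumes "vector_space sm" "module.subspace sm (topspace X)" "continuous_seminorm sm X p"
  shows "seminormed_space sm (topspace X) p"
  using assms by (simp add: seminormed_space_def seminormed_space_axioms_def continuous_seminorm_def)

text \<open>Continuity of \<open>\<iota>\<close> and \<open>\<pi>\<close> is expressed by domination of seminorms, the form in which it is known for
  the maps to which this is applied.\<close>

lemma nuclear_space_retract:
  fixes sm :: "'k::real_or_complex \<Rightarrow> 'a::ab_group_add \<Rightarrow> 'a"
    and sm' :: "'k \<Rightarrow> 'b::ab_group_add \<Rightarrow> 'b"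
  assumes nuc: "nuclear_space sm X"
    and vs: "vector_space sm" "module.subspace sm (topspace X)"
    and vs': "vector_space sm'" "module.subspace sm' (topspace X')"
    and inc: "linear_between sm' (topspace X') sm (topspace X) \<iota>"
    and pr: "linear_between sm (topspace X) sm' (topspace X') \<pi>"
    and retr: "\<And>x. x \<in> topspace X' \<Longrightarrow> \<pi> (\<iota> x) = x"
    and cont_inc: "\<And>q. continuous_seminorm sm X q \<Longrightarrow>
      \<exists>q'. continuous_seminorm sm' X' q' \<and> (\<forall>x\<in>topspace X'. q (\<iota> x) \<le> q' x)"
    and cont_pr: "\<And>p'. continuous_seminorm sm' X' p' \<Longrightarrow>
      \<exists>p. continuous_seminorm sm X p \<and> (\<forall>z\<in>topspace X. p' (\<pi> z) \<le> p z)"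
  shows "nuclear_space sm' X'"
  unfolding nuclear_space_iff_expansion[OF vs']
proof (intro allI impI)
  fix p' assume p': "continuous_seminorm sm' X' p'"
  obtain p where p: "continuous_seminorm sm X p" and pp: "\<forall>z\<in>topspace X. p' (\<pi> z) \<le> p z"
    using cont_pr[OF p'] by blast
  obtain q where q: "continuous_seminorm sm X q" and pq: "\<forall>x\<in>topspace X. p x \<le> q x"
    and "\<exists>(f :: nat \<Rightarrow> 'a \<Rightarrow> 'k) y. nuclear_expansion sm (topspace X) q p f y"
    using nuc p unfolding nuclear_space_iff_expansion[OF vs] by blast
  then obtain f :: "nat \<Rightarrow> 'a \<Rightarrow> 'k" and y where exp: "nuclear_expansion sm (topspace X) q p f y" by blast
  obtain q' where q': "continuous_seminorm sm' X' q'" and qq: "\<forall>x\<in>topspace X'. q (\<iota> x) \<le> q' x"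
    using cont_inc[OF q] by blast
  have in_inc: "\<iota> x \<in> topspace X" if "x \<in> topspace X'" for x
    using inc that by (simp add: linear_between_def)
  have "p' x \<le> q' x" if x: "x \<in> topspace X'" for x
  proof -
    have "p' x = p' (\<pi> (\<iota> x))" by (simp add: retr[OF x])
    also have "\<dots> \<le> p (\<iota> x)" using pp in_inc[OF x] by blast
    also have "\<dots> \<le> q (\<iota> x)" using pq in_inc[OF x] by blast
    also have "\<dots> \<le> q' x" using qq x by blast
    finally show ?thesis .
  qed
  moreover have "nuclear_expansion sm' (topspace X') q' p' (\<lambda>i x. f i (\<iota> x)) (\<lambda>i. \<pi> (y i))"
    using pp qq
    by (intro nuclear_expansion_transfer[OF exp seminormed_spaceI[OF vs p] seminormed_spaceI[OF vs' p']
          inc pr retr, of q' 1]) simp_all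
  ultimately show "\<exists>q'. continuous_seminorm sm' X' q' \<and> (\<forall>x\<in>topspace X'. p' x \<le> q' x) \<and>
      (\<exists>(f :: nat \<Rightarrow> 'b \<Rightarrow> 'k) y. nuclear_expansion sm' (topspace X') q' p' f y)"
    using q' by blast
qed

section \<open>Projective tensor seminorms\<close>

interpretation tens: vector_space "tscale :: 'k::real_or_complex \<Rightarrow> ('k, 'v) tensor \<Rightarrow> _"
  by (rule vector_space_tscale)

interpretation grad: vector_space "gscale :: 'k::real_or_complex \<Rightarrow> (nat \<Rightarrow> ('k, 'v) tensor) \<Rightarrow> _"
  by (rule vector_space_gscale)

lemma subspace_tensor_power: "tens.subspace (tensor_power sm n)"
  by (simp add: tensor_power_def)

lemma tensor_in_power: "length vs = n \<Longrightarrow> tensor sm vs \<in> tensor_power sm n"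
  unfolding tensor_power_def by (rule tens.span_base) blast

lemma sum_lessThan_add: "(\<Sum>i<m + k. f i) = (\<Sum>i<m. f i) + (\<Sum>i<(k::nat). f (m + i) :: 'b::comm_monoid_add)"
  by (induction k) (simp_all add: add.assoc)

text \<open>The set whose infimum is the projective seminorm: the costs of the representations of \<open>t\<close> as a
  combination of elementary tensors.\<close>

definition tensor_costs ::
  "('k::real_or_complex \<Rightarrow> 'v::ab_group_add \<Rightarrow> 'v) \<Rightarrow> ('v \<Rightarrow> real) \<Rightarrow> nat \<Rightarrow> ('k, 'v) tensor \<Rightarrow> real set" where
  "tensor_costs sm p n t =
     {\<Sum>i<m. norm (c i) * prod_list (map p (vs i)) | (m::nat) c vs.
        (\<forall>i<m. length (vs i) = n) \<and> t = (\<Sum>i<m. tscale (c i) (tensor sm (vs i)))}"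

lemma tensor_costsI:
  "\<forall>i<(m::nat). length (vs i) = n \<Longrightarrow> t = (\<Sum>i<m. tscale (c i) (tensor sm (vs i))) \<Longrightarrow>
   r = (\<Sum>i<m. norm (c i) * prod_list (map p (vs i))) \<Longrightarrow> r \<in> tensor_costs sm p n t"
  unfolding tensor_costs_def by blast

lemma tensor_costsE:
  assumes "r \<in> tensor_costs sm p n t"
  obtains m :: nat and c vs where "\<forall>i<m. length (vs i) = n" "t = (\<Sum>i<m. tscale (c i) (tensor sm (vs i)))"
    "r = (\<Sum>i<m. norm (c i) * prod_list (map p (vs i)))"
  using assms unfolding tensor_costs_def by blast

lemma tensor_costs_scaled_tensor:
  "length vs = n \<Longrightarrow> norm c * prod_list (map p vs) \<in> tensor_costs sm p n (tscale c (tensor sm vs))"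
  by (rule tensor_costsI[of 1 "\<lambda>_. vs" _ _ "\<lambda>_. c"]) simp_all

lemma tensor_costs_zero: "0 \<in> tensor_costs sm p n 0"
  by (rule tensor_costsI[of 0]) simp_all

lemma tensor_costs_add:
  assumes "a \<in> tensor_costs sm p n s" "b \<in> tensor_costs sm p n t"
  shows "a + b \<in> tensor_costs sm p n (s + t)"
proof -
  obtain m :: nat and c vs where a: "\<forall>i<m. length (vs i) = n" "s = (\<Sum>i<m. tscale (c i) (tensor sm (vs i)))"
    "a = (\<Sum>i<m. norm (c i) * prod_list (map p (vs i)))" using assms(1) by (rule tensor_costsE)
  obtain k :: nat and d ws where b: "\<forall>i<k. length (ws i) = n" "t = (\<Sum>i<k. tscale (d i) (tensor sm (ws i)))"
    "b = (\<Sum>i<k. norm (d i) * prod_list (map p (ws i)))" using assms(2) by (rule tensor_costsE)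
  show ?thesis
    by (rule tensor_costsI[of "m + k" "\<lambda>i. if i < m then vs i else ws (i - m)" _ _
          "\<lambda>i. if i < m then c i else d (i - m)"])
      (use a b in \<open>auto simp: sum_lessThan_add\<close>)
qed

lemma tensor_costs_scale:
  assumes "a \<in> tensor_costs sm p n t"
  shows "norm c * a \<in> tensor_costs sm p n (tscale c t)"
proof -
  obtain m :: nat and d vs where a: "\<forall>i<m. length (vs i) = n" "t = (\<Sum>i<m. tscale (d i) (tensor sm (vs i)))"
    "a = (\<Sum>i<m. norm (d i) * prod_list (map p (vs i)))" using assms by (rule tensor_costsE)
  show ?thesis
    by (rule tensor_costsI[of m vs _ _ "\<lambda>i. c * d i"])
      (use a in \<open>auto simp: tens.scale_sum_right sum_distrib_left norm_mult mult.assoc\<close>)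
qed

lemma tensor_costs_nonempty:
  assumes "t \<in> tensor_power sm n"
  shows "tensor_costs sm p n t \<noteq> {}"
  using assms unfolding tensor_power_def
proof (induction rule: tens.span_induct_alt)
  case base
  then show ?case using tensor_costs_zero by blast
next
  case (step c x y)
  then obtain vs b where vs: "x = tensor sm vs" "length vs = n" and b: "b \<in> tensor_costs sm p n y" by blast
  from tensor_costs_add[OF tensor_costs_scaled_tensor[OF vs(2)] b] show ?case
    unfolding vs(1) by blast
qed

locale seminorm_UNIV = seminormed_space sm UNIV p
  for sm :: "'k::real_or_complex \<Rightarrow> 'v::ab_group_add \<Rightarrow> 'v" and p :: "'v \<Rightarrow> real"
begin

abbreviation tsem :: "nat \<Rightarrow> ('k, 'v) tensor \<Rightarrow> real" where
  "tsem \<equiv> tensor_seminorm sm p"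

lemma prod_seminorm_nonneg: "0 \<le> prod_list (map p vs)"
  by (induction vs) (simp_all add: seminorm_nonneg)

lemma tensor_costs_nonneg: "a \<in> tensor_costs sm p n t \<Longrightarrow> 0 \<le> a"
  by (erule tensor_costsE) (simp add: sum_nonneg prod_seminorm_nonneg)

lemma tensor_seminorm_le_cost: "a \<in> tensor_costs sm p n t \<Longrightarrow> tsem n t \<le> a"
  unfolding tensor_seminorm_def tensor_costs_def[symmetric]
  by (intro cInf_lower bdd_belowI[of _ 0] tensor_costs_nonneg)

lemma le_tensor_seminorm:
  assumes "t \<in> tensor_power sm n" "\<And>a. a \<in> tensor_costs sm p n t \<Longrightarrow> r \<le> a"
  shows "r \<le> tsem n t"
  unfolding tensor_seminorm_def tensor_costs_def[symmetric]
  using assms tensor_costs_nonempty by (intro cInf_greatest) blast+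

lemma tensor_seminorm_tensor: "length vs = n \<Longrightarrow> tsem n (tensor sm vs) \<le> prod_list (map p vs)"
  using tensor_seminorm_le_cost[OF tensor_costs_scaled_tensor[of vs n 1]] by simp

lemma tensor_seminorm_add:
  assumes s: "s \<in> tensor_power sm n" and t: "t \<in> tensor_power sm n"
  shows "tsem n (s + t) \<le> tsem n s + tsem n t"
proof -
  have "tsem n (s + t) - b \<le> tsem n s" if b: "b \<in> tensor_costs sm p n t" for b
  proof (rule le_tensor_seminorm[OF s])
    fix a assume "a \<in> tensor_costs sm p n s"
    from tensor_seminorm_le_cost[OF tensor_costs_add[OF this b]] show "tsem n (s + t) - b \<le> a" by simp
  qed
  then have "tsem n (s + t) - tsem n s \<le> b" if "b \<in> tensor_costs sm p n t" for b
    using that by force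
  then have "tsem n (s + t) - tsem n s \<le> tsem n t" by (rule le_tensor_seminorm[OF t])
  then show ?thesis by simp
qed

lemma tensor_seminorm_scale_le:
  assumes t: "t \<in> tensor_power sm n"
  shows "tsem n (tscale c t) \<le> norm c * tsem n t"
proof (cases "c = 0")
  case True
  then show ?thesis using tensor_seminorm_le_cost[OF tensor_costs_zero, of n] by simp
next
  case False
  have "tsem n (tscale c t) / norm c \<le> tsem n t"
  proof (rule le_tensor_seminorm[OF t])
    fix a assume "a \<in> tensor_costs sm p n t"
    from tensor_seminorm_le_cost[OF tensor_costs_scale[OF this, of c]] False
    show "tsem n (tscale c t) / norm c \<le> a" by (simp add: field_simps)
  qed
  with False show ?thesis by (simp add: field_simps)
qed

lemma tensor_seminorm_nonneg: "t \<in> tensor_power sm n \<Longrightarrow> 0 \<le> tsem n t"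
  by (rule le_tensor_seminorm) (auto intro: tensor_costs_nonneg)

lemma tensor_seminorm_seminorm: "seminorm_on tscale (tensor_power sm n) (tsem n)"
  unfolding seminorm_on_def
proof (intro conjI ballI allI)
  show "tsem n (s + t) \<le> tsem n s + tsem n t"
    if "s \<in> tensor_power sm n" "t \<in> tensor_power sm n" for s t
    using that by (rule tensor_seminorm_add)
  fix c t assume t: "t \<in> tensor_power sm n"
  show "tsem n (tscale c t) = norm c * tsem n t"
  proof (rule antisym[OF tensor_seminorm_scale_le[OF t]])
    have ct: "tscale c t \<in> tensor_power sm n"
      using t subspace_tensor_power tens.subspace_scale by blast
    show "norm c * tsem n t \<le> tsem n (tscale c t)"
    proof (cases "c = 0")
      case True
      then show ?thesis using tensor_seminorm_nonneg[OF ct] by simp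
    next
      case False
      then have "tsem n t \<le> norm (1 / c) * tsem n (tscale c t)"
        using tensor_seminorm_scale_le[OF ct, of "1 / c"] by simp
      with False show ?thesis by (simp add: norm_divide field_simps)
    qed
  qed
qed

sublocale tens_pow: seminormed_space tscale "tensor_power sm n" "tsem n" for n
  by unfold_locales (rule subspace_tensor_power tensor_seminorm_seminorm)+

text \<open>The projective seminorm is the largest seminorm with \<open>p\<^sup>n(v\<^sub>1 \<otimes> \<dots> \<otimes> v\<^sub>n) \<le> p(v\<^sub>1) \<dots> p(v\<^sub>n)\<close>. Every upper
  bound by a projective seminorm below is obtained from this.\<close>

lemma tensor_seminorm_universal:
  assumes N: "seminorm_on tscale (tensor_power sm n) N"
    and bound: "\<And>vs. length vs = n \<Longrightarrow> N (tensor sm vs) \<le> prod_list (map p vs)"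
    and t: "t \<in> tensor_power sm n"
  shows "N t \<le> tsem n t"
proof (rule le_tensor_seminorm[OF t])
  interpret N: seminormed_space tscale "tensor_power sm n" N
    by unfold_locales (rule subspace_tensor_power N)+
  fix a assume "a \<in> tensor_costs sm p n t"
  then obtain m :: nat and c vs where a: "\<forall>i<m. length (vs i) = n" "t = (\<Sum>i<m. tscale (c i) (tensor sm (vs i)))"
    "a = (\<Sum>i<m. norm (c i) * prod_list (map p (vs i)))" by (rule tensor_costsE)
  have E: "tensor sm (vs i) \<in> tensor_power sm n" if "i < m" for i
    using a(1) that by (intro tensor_in_power) simp
  have "N t \<le> (\<Sum>i<m. N (tscale (c i) (tensor sm (vs i))))"
    unfolding a(2) using E by (intro N.seminorm_sum) simp
  also have "\<dots> = (\<Sum>i<m. norm (c i) * N (tensor sm (vs i)))"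
    using E by (intro sum.cong refl N.seminorm_scale) simp
  also have "\<dots> \<le> a"
    unfolding a(3) using a(1) by (intro sum_mono mult_left_mono bound) simp_all
  finally show "N t \<le> a" .
qed

lemma tensor_seminorm_mono:
  assumes "seminorm_UNIV sm q" "\<And>v. q v \<le> p v" and t: "t \<in> tensor_power sm n"
  shows "tensor_seminorm sm q n t \<le> tsem n t"
proof (rule tensor_seminorm_universal[OF _ _ t])
  interpret q: seminorm_UNIV sm q by fact
  show "seminorm_on tscale (tensor_power sm n) (q.tsem n)" by (rule q.tensor_seminorm_seminorm)
  have "prod_list (map q vs) \<le> prod_list (map p vs)" for vs
  proof (induction vs)
    case (Cons v vs)
    then show ?case by (simp add: mult_mono assms(2) q.prod_seminorm_nonneg seminorm_nonneg)
  qed simp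
  then show "q.tsem n (tensor sm vs) \<le> prod_list (map p vs)" if "length vs = n" for vs
    using q.tensor_seminorm_tensor[OF that] by (rule order_trans[rotated])
qed

end

section \<open>Seminorms on the tensor algebra\<close>

lemma subspace_tensor_algebra: "grad.subspace (tensor_algebra sm)"
proof (rule grad.subspaceI)
  show "0 \<in> tensor_algebra sm"
    using tens.subspace_0[OF subspace_tensor_power, of sm] by (simp add: tensor_algebra_def)
  fix s t assume s: "s \<in> tensor_algebra sm" and t: "t \<in> tensor_algebra sm"
  have "{n. (s + t) n \<noteq> 0} \<subseteq> {n. s n \<noteq> 0} \<union> {n. t n \<noteq> 0}" by auto
  then have "finite {n. (s + t) n \<noteq> 0}"
    using s t by (auto simp: tensor_algebra_def intro: finite_subset)
  then show "s + t \<in> tensor_algebra sm"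
    using s t subspace_tensor_power[of sm] by (simp add: tensor_algebra_def tens.subspace_add)
next
  fix t c assume t: "t \<in> tensor_algebra sm"
  have "{n. gscale c t n \<noteq> 0} \<subseteq> {n. t n \<noteq> 0}" by (auto simp: gscale_def)
  then have "finite {n. gscale c t n \<noteq> 0}"
    using t by (auto simp: tensor_algebra_def intro: finite_subset)
  then show "gscale c t \<in> tensor_algebra sm"
    using t subspace_tensor_power[of sm] by (simp add: tensor_algebra_def gscale_def tens.subspace_scale)
qed

context seminorm_UNIV
begin

text \<open>Sums over the supports of different tensors can be compared only after they have been extended to a
  common finite set of degrees.\<close>

lemma graded_seminorm_eq_sum:
  assumes "finite A" "\<And>n. n \<notin> A \<Longrightarrow> t n = 0"
  shows "graded_seminorm sm R p t = (\<Sum>n\<in>A. tsem n (t n) * fact n powr R)"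
  unfolding graded_seminorm_def
  by (rule sum.mono_neutral_left) (use assms in auto)

lemma graded_seminorm_le:
  assumes q: "seminorm_UNIV sm q" and s: "s \<in> tensor_algebra sm" and t: "t \<in> tensor_algebra sm"
    and le: "\<And>n. tensor_seminorm sm q n (s n) \<le> tsem n (t n)"
  shows "graded_seminorm sm R q s \<le> graded_seminorm sm R p t"
proof -
  interpret q: seminorm_UNIV sm q by fact
  let ?A = "{n. s n \<noteq> 0} \<union> {n. t n \<noteq> 0}"
  have fin: "finite ?A" using s t by (simp add: tensor_algebra_def)
  have "graded_seminorm sm R q s = (\<Sum>n\<in>?A. q.tsem n (s n) * fact n powr R)"
    by (rule q.graded_seminorm_eq_sum[OF fin]) simp
  also have "\<dots> \<le> (\<Sum>n\<in>?A. tsem n (t n) * fact n powr R)"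
    by (intro sum_mono mult_right_mono le) simp
  also have "\<dots> = graded_seminorm sm R p t"
    by (rule graded_seminorm_eq_sum[OF fin, symmetric]) simp
  finally show ?thesis .
qed

lemma graded_seminorm_mono:
  assumes "seminorm_UNIV sm q" "\<And>v. q v \<le> p v" "t \<in> tensor_algebra sm"
  shows "graded_seminorm sm R q t \<le> graded_seminorm sm R p t"
  using assms by (intro graded_seminorm_le tensor_seminorm_mono) (auto simp: tensor_algebra_def)

lemma component_le_graded_seminorm:
  assumes t: "t \<in> tensor_algebra sm"
  shows "tsem n (t n) * fact n powr R \<le> graded_seminorm sm R p t"
proof -
  have fin: "finite (insert n {n. t n \<noteq> 0})" using t by (simp add: tensor_algebra_def)
  have tn: "t k \<in> tensor_power sm k" for k using t by (simp add: tensor_algebra_def)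
  have "graded_seminorm sm R p t = (\<Sum>n\<in>insert n {n. t n \<noteq> 0}. tsem n (t n) * fact n powr R)"
    by (rule graded_seminorm_eq_sum[OF fin]) simp
  then show ?thesis
    using member_le_sum[OF _ _ fin, of n "\<lambda>n. tsem n (t n) * fact n powr R"]
    by (simp add: tensor_seminorm_nonneg[OF tn])
qed

lemma graded_seminorm_seminorm: "seminorm_on gscale (tensor_algebra sm) (graded_seminorm sm R p)"
  unfolding seminorm_on_def
proof (intro conjI ballI allI)
  fix s t assume s: "s \<in> tensor_algebra sm" and t: "t \<in> tensor_algebra sm"
  let ?A = "{n. s n \<noteq> 0} \<union> {n. t n \<noteq> 0}"
  have fin: "finite ?A" using s t by (simp add: tensor_algebra_def)
  have "graded_seminorm sm R p (s + t) = (\<Sum>n\<in>?A. tsem n ((s + t) n) * fact n powr R)"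
    by (rule graded_seminorm_eq_sum[OF fin]) simp
  also have "\<dots> \<le> (\<Sum>n\<in>?A. (tsem n (s n) + tsem n (t n)) * fact n powr R)"
    using s t by (intro sum_mono mult_right_mono) (simp_all add: tensor_algebra_def tensor_seminorm_add)
  also have "\<dots> = (\<Sum>n\<in>?A. tsem n (s n) * fact n powr R) + (\<Sum>n\<in>?A. tsem n (t n) * fact n powr R)"
    by (simp add: distrib_right sum.distrib)
  also have "(\<Sum>n\<in>?A. tsem n (s n) * fact n powr R) = graded_seminorm sm R p s"
    by (rule graded_seminorm_eq_sum[OF fin, symmetric]) simp
  also have "(\<Sum>n\<in>?A. tsem n (t n) * fact n powr R) = graded_seminorm sm R p t"
    by (rule graded_seminorm_eq_sum[OF fin, symmetric]) simp
  finally show "graded_seminorm sm R p (s + t) \<le> graded_seminorm sm R p s + graded_seminorm sm R p t" .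
next
  fix c t assume t: "t \<in> tensor_algebra sm"
  let ?A = "{n. t n \<noteq> 0}"
  have fin: "finite ?A" using t by (simp add: tensor_algebra_def)
  have tn: "t k \<in> tensor_power sm k" for k using t by (simp add: tensor_algebra_def)
  have "graded_seminorm sm R p (gscale c t) = (\<Sum>n\<in>?A. tsem n (gscale c t n) * fact n powr R)"
    by (rule graded_seminorm_eq_sum[OF fin]) (simp add: gscale_def)
  also have "\<dots> = (\<Sum>n\<in>?A. norm c * (tsem n (t n) * fact n powr R))"
    by (intro sum.cong refl) (simp add: gscale_def tens_pow.seminorm_scale tn)
  also have "\<dots> = norm c * graded_seminorm sm R p t"
    by (simp add: sum_distrib_left graded_seminorm_def)
  finally show "graded_seminorm sm R p (gscale c t) = norm c * graded_seminorm sm R p t" .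
qed

lemma graded_seminormed_space: "seminormed_space gscale (tensor_algebra sm) (graded_seminorm sm R p)"
  by unfold_locales (rule subspace_tensor_algebra graded_seminorm_seminorm)+

end

section \<open>The symmetrizer\<close>

definition pairs :: "nat \<Rightarrow> (nat \<times> nat) set" where
  "pairs n = {(i, j). i < j \<and> j < n}"

lemma finite_pairs: "finite (pairs n)"
  by (rule finite_subset[of _ "{..<n} \<times> {..<n}"]) (auto simp: pairs_def)

text \<open>As a product over all pairs of positions the sign can be reindexed by a permutation.\<close>

lemma koszul_sign_prod:
  "(koszul_sign V1 \<sigma> vs :: 'k::real_or_complex) =
     (\<Prod>(i, j)\<in>pairs (length vs). if \<sigma> i > \<sigma> j \<and> vs ! \<sigma> i \<in> V1 \<and> vs ! \<sigma> j \<in> V1 then - 1 else 1)"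
proof -
  let ?P = "\<lambda>(i, j). \<sigma> i > \<sigma> j \<and> vs ! \<sigma> i \<in> V1 \<and> vs ! \<sigma> j \<in> V1"
  have "(\<Prod>x\<in>pairs (length vs). if ?P x then - 1 else 1 :: 'k) = (- 1) ^ card (pairs (length vs) \<inter> {x. ?P x})"
    by (subst prod.If_cases[OF finite_pairs]) simp
  moreover have "pairs (length vs) \<inter> {x. ?P x} =
      {(i, j). i < j \<and> j < length vs \<and> \<sigma> i > \<sigma> j \<and> vs ! \<sigma> i \<in> V1 \<and> vs ! \<sigma> j \<in> V1}"
    by (auto simp: pairs_def)
  moreover have "(\<Prod>x\<in>pairs (length vs). if ?P x then - 1 else 1 :: 'k) =
      (\<Prod>(i, j)\<in>pairs (length vs). if \<sigma> i > \<sigma> j \<and> vs ! \<sigma> i \<in> V1 \<and> vs ! \<sigma> j \<in> V1 then - 1 else 1)"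
    by (intro prod.cong refl) (simp add: case_prod_unfold)
  ultimately show ?thesis unfolding koszul_sign_def by simp
qed

lemma bij_betw_sort_pairs:
  assumes \<tau>: "\<tau> permutes {..<n}"
  shows "bij_betw (\<lambda>(i, j). (min (\<tau> i) (\<tau> j), max (\<tau> i) (\<tau> j))) (pairs n) (pairs n)"
    (is "bij_betw ?h _ _")
proof -
  have inj: "\<tau> i = \<tau> j \<longleftrightarrow> i = j" for i j using permutes_inj[OF \<tau>] by (simp add: inj_eq)
  have lt: "\<tau> i < n" if "i < n" for i using \<tau> that by (metis lessThan_iff permutes_in_image)
  have "?h ` pairs n \<subseteq> pairs n"
  proof
    fix x assume "x \<in> ?h ` pairs n"
    then obtain i j where ij: "i < j" "j < n" "x = (min (\<tau> i) (\<tau> j), max (\<tau> i) (\<tau> j))"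
      by (auto simp: pairs_def)
    moreover have "\<tau> i \<noteq> \<tau> j" using ij inj by auto
    ultimately show "x \<in> pairs n" using lt[of i] lt[of j] by (auto simp: pairs_def min_def max_def)
  qed
  moreover have "inj_on ?h (pairs n)"
  proof (rule inj_onI)
    fix x y assume x: "x \<in> pairs n" and y: "y \<in> pairs n" and eq: "?h x = ?h y"
    obtain i j where ij: "x = (i, j)" "i < j" using x by (auto simp: pairs_def)
    obtain k l where kl: "y = (k, l)" "k < l" using y by (auto simp: pairs_def)
    have "\<tau> i = \<tau> k \<and> \<tau> j = \<tau> l \<or> \<tau> i = \<tau> l \<and> \<tau> j = \<tau> k"
      using eq unfolding ij kl by (auto simp: min_def max_def split: if_splits)
    then show "x = y" using ij kl inj by auto
  qed
  ultimately show ?thesis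
    using endo_inj_surj[OF finite_pairs] by (auto simp: bij_betw_def)
qed

text \<open>Reindex the sign of \<open>\<sigma>\<close> by the pairs \<open>{\<tau> i, \<tau> j}\<close>. For each pair of odd vectors, \<open>\<sigma> \<circ> \<tau>\<close> inverts \<open>(i, j)\<close>
  iff exactly one of the following holds: \<open>\<tau>\<close> inverts \<open>(i, j)\<close>, or \<open>\<sigma>\<close> inverts the sorted pair.\<close>

lemma koszul_sign_compose:
  assumes \<sigma>: "\<sigma> permutes {..<length vs}" and \<tau>: "\<tau> permutes {..<length vs}"
  shows "(koszul_sign V1 (\<sigma> \<circ> \<tau>) vs :: 'k::real_or_complex) = koszul_sign V1 \<sigma> vs * koszul_sign V1 \<tau> (permute_list \<sigma> vs)"
proof -
  let ?n = "length vs"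
  let ?e = "\<lambda>(i, j). if \<sigma> i > \<sigma> j \<and> vs ! \<sigma> i \<in> V1 \<and> vs ! \<sigma> j \<in> V1 then - 1 else 1 :: 'k"
  let ?h = "\<lambda>(i, j). (min (\<tau> i) (\<tau> j), max (\<tau> i) (\<tau> j))"
  have nth: "permute_list \<sigma> vs ! \<tau> i = vs ! \<sigma> (\<tau> i)" if "i < ?n" for i
    using \<sigma> \<tau> that by (intro permute_list_nth) (metis lessThan_iff permutes_in_image)+
  have "(koszul_sign V1 \<sigma> vs :: 'k) = (\<Prod>x\<in>pairs ?n. ?e x)" by (simp add: koszul_sign_prod)
  also have "\<dots> = (\<Prod>x\<in>pairs ?n. ?e (?h x))"
    by (rule prod.reindex_bij_betw[OF bij_betw_sort_pairs[OF \<tau>], symmetric])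
  finally have "(koszul_sign V1 \<sigma> vs :: 'k) * koszul_sign V1 \<tau> (permute_list \<sigma> vs) =
      (\<Prod>x\<in>pairs ?n. ?e (?h x) * (case x of (i, j) \<Rightarrow>
          if \<tau> i > \<tau> j \<and> permute_list \<sigma> vs ! \<tau> i \<in> V1 \<and> permute_list \<sigma> vs ! \<tau> j \<in> V1 then - 1 else 1))"
    by (simp add: koszul_sign_prod[of V1 \<tau>] prod.distrib)
  also have "\<dots> = (\<Prod>(i, j)\<in>pairs ?n. if (\<sigma> \<circ> \<tau>) i > (\<sigma> \<circ> \<tau>) j \<and> vs ! (\<sigma> \<circ> \<tau>) i \<in> V1 \<and> vs ! (\<sigma> \<circ> \<tau>) j \<in> V1
      then - 1 else 1)"
  proof (rule prod.cong[OF refl])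
    fix x assume x: "x \<in> pairs ?n"
    obtain i j where ij: "x = (i, j)" "i < j" "i < ?n" "j < ?n" using x by (auto simp: pairs_def)
    have "\<tau> i \<noteq> \<tau> j" using ij permutes_inj[OF \<tau>] by (auto simp: inj_eq)
    moreover have "\<sigma> (\<tau> i) \<noteq> \<sigma> (\<tau> j)" using calculation permutes_inj[OF \<sigma>] by (auto simp: inj_eq)
    ultimately show "?e (?h x) * (case x of (i, j) \<Rightarrow>
          if \<tau> i > \<tau> j \<and> permute_list \<sigma> vs ! \<tau> i \<in> V1 \<and> permute_list \<sigma> vs ! \<tau> j \<in> V1 then - 1 else 1) =
        (case x of (i, j) \<Rightarrow> if (\<sigma> \<circ> \<tau>) i > (\<sigma> \<circ> \<tau>) j \<and> vs ! (\<sigma> \<circ> \<tau>) i \<in> V1 \<and> vs ! (\<sigma> \<circ> \<tau>) j \<in> V1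
      then - 1 else 1)"
      using nth[OF ij(3)] nth[OF ij(4)] by (cases "\<tau> i < \<tau> j") (auto simp: ij(1) min_def max_def)
  qed
  also have "\<dots> = koszul_sign V1 (\<sigma> \<circ> \<tau>) vs" by (simp add: koszul_sign_prod[of V1 "\<sigma> \<circ> \<tau>"])
  finally show ?thesis ..
qed

context graded_locally_convex_space
begin

text \<open>Decompose the entries of an elementary tensor into even and odd parts, one position after the other:
  \<open>k\<close> counts the leading positions that may still be inhomogeneous.\<close>

lemma tensor_power_homogeneous:
  "tensor_power sm n = tens.span {tensor sm vs | vs. length vs = n \<and> set vs \<subseteq> V0 \<union> V1}"
    (is "_ = tens.span ?H")
proof
  show "tens.span ?H \<subseteq> tensor_power sm n"
    unfolding tensor_power_def by (intro tens.span_mono) auto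
  have "tensor sm vs \<in> tens.span ?H"
    if "length vs = n" "k \<le> n" "\<forall>i<n. k \<le> i \<longrightarrow> vs ! i \<in> V0 \<union> V1" for k vs
    using that
  proof (induction k arbitrary: vs)
    case 0
    then have "set vs \<subseteq> V0 \<union> V1" by (auto simp: in_set_conv_nth)
    then show ?case using 0 by (intro tens.span_base) blast
  next
    case (Suc k)
    obtain a b where ab: "a \<in> V0" "b \<in> V1" "vs ! k = a + b" using V0_plus_V1 by blast
    have k: "k < n" using Suc by simp
    have "tensor sm vs = tensor sm (vs[k := a]) + tensor sm (vs[k := b])"
      using multilinearD(1)[OF multilinear_tensor Suc.prems(1) k, of sm a b] ab
      by (metis list_update_id)
    moreover have "tensor sm (vs[k := c]) \<in> tens.span ?H" if "c \<in> V0 \<union> V1" for c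
      using that Suc.prems by (intro Suc.IH) (auto simp: nth_list_update)
    ultimately show ?case using ab by (metis (no_types, lifting) tens.span_add UnCI)
  qed
  from this[of _ n] show "tensor_power sm n \<subseteq> tens.span ?H"
    unfolding tensor_power_def by (intro tens.span_minimal) (auto simp: tens.subspace_span)
qed

abbreviation act :: "nat \<Rightarrow> (nat \<Rightarrow> nat) \<Rightarrow> ('k, 'v) tensor \<Rightarrow> ('k, 'v) tensor" where
  "act n \<sigma> \<equiv> koszul_action sm V0 V1 n \<sigma>"

lemma koszul_action_is_action: "\<sigma> permutes {..<n} \<Longrightarrow> is_koszul_action sm V0 V1 n \<sigma> (act n \<sigma>)"
  unfolding koszul_action_def by (rule someI_ex[OF koszul_action_exists])

lemma koszul_action_linear: "\<sigma> permutes {..<n} \<Longrightarrow> Vector_Spaces.linear tscale tscale (act n \<sigma>)"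
  using koszul_action_is_action by (simp add: is_koszul_action_def)

lemma koszul_action_tensor:
  "\<sigma> permutes {..<n} \<Longrightarrow> length vs = n \<Longrightarrow> set vs \<subseteq> V0 \<union> V1 \<Longrightarrow>
   act n \<sigma> (tensor sm vs) = tscale (koszul_sign V1 \<sigma> vs) (tensor sm (permute_list \<sigma> vs))"
  using koszul_action_is_action by (simp add: is_koszul_action_def)

lemma koszul_action_in_power:
  assumes \<sigma>: "\<sigma> permutes {..<n}" and t: "t \<in> tensor_power sm n"
  shows "act n \<sigma> t \<in> tensor_power sm n"
  using t unfolding tensor_power_homogeneous[of n]
proof (induction rule: tens.span_induct_alt)
  interpret L: Vector_Spaces.linear tscale tscale "act n \<sigma>" by (rule koszul_action_linear[OF \<sigma>])
  case base
  show ?case unfolding L.zero by (rule tens.span_zero)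
next
  interpret L: Vector_Spaces.linear tscale tscale "act n \<sigma>" by (rule koszul_action_linear[OF \<sigma>])
  case (step c x y)
  then obtain vs where vs: "x = tensor sm vs" "length vs = n" "set vs \<subseteq> V0 \<union> V1" by blast
  have "act n \<sigma> x \<in> tensor_power sm n"
    unfolding vs(1) koszul_action_tensor[OF \<sigma> vs(2,3)]
    by (intro tens.subspace_scale[OF subspace_tensor_power] tensor_in_power) (simp add: vs)
  then have x: "act n \<sigma> x \<in> tens.span {tensor sm vs |vs. length vs = n \<and> set vs \<subseteq> V0 \<union> V1}"
    by (simp only: tensor_power_homogeneous)
  show ?case unfolding L.add L.scale by (intro tens.span_add tens.span_scale x step(2))
qed

text \<open>A right action: the signs multiply by \<open>koszul_sign_compose\<close>, and both sides are determined by their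
  values on homogeneous tensors.\<close>

lemma koszul_action_compose:
  assumes \<sigma>: "\<sigma> permutes {..<n}" and \<tau>: "\<tau> permutes {..<n}" and t: "t \<in> tensor_power sm n"
  shows "act n \<tau> (act n \<sigma> t) = act n (\<sigma> \<circ> \<tau>) t"
proof -
  have \<sigma>\<tau>: "\<sigma> \<circ> \<tau> permutes {..<n}" by (rule permutes_compose[OF \<tau> \<sigma>])
  interpret L: Vector_Spaces.linear tscale tscale "act n \<sigma>" by (rule koszul_action_linear[OF \<sigma>])
  interpret M: Vector_Spaces.linear tscale tscale "act n \<tau>" by (rule koszul_action_linear[OF \<tau>])
  have "is_koszul_action sm V0 V1 n (\<sigma> \<circ> \<tau>) (\<lambda>t. act n \<tau> (act n \<sigma> t))"
    unfolding is_koszul_action_def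
  proof (intro conjI allI impI; (elim conjE)?)
    show "Vector_Spaces.linear tscale tscale (\<lambda>t. act n \<tau> (act n \<sigma> t))"
      by unfold_locales (simp_all add: L.add M.add L.scale M.scale)
    fix vs :: "'v list" assume vs: "length vs = n" "set vs \<subseteq> V0 \<union> V1"
    have "set (permute_list \<sigma> vs) \<subseteq> V0 \<union> V1"
      using vs \<sigma> by (simp add: set_permute_list)
    then show "act n \<tau> (act n \<sigma> (tensor sm vs)) =
        tscale (koszul_sign V1 (\<sigma> \<circ> \<tau>) vs) (tensor sm (permute_list (\<sigma> \<circ> \<tau>) vs))"
      using vs \<sigma> \<tau>
      by (simp add: koszul_action_tensor M.scale koszul_sign_compose permute_list_compose)
  qed
  from koszul_action_unique[OF this koszul_action_is_action[OF \<sigma>\<tau>] t] show ?thesis .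
qed

abbreviation symm :: "nat \<Rightarrow> ('k, 'v) tensor \<Rightarrow> ('k, 'v) tensor" where
  "symm n \<equiv> symmetrizer sm V0 V1 n"

lemma symmetrizer_linear: "Vector_Spaces.linear tscale tscale (symm n)"
proof unfold_locales
  fix s t c
  have add: "act n \<sigma> (s + t) = act n \<sigma> s + act n \<sigma> t"
    and scale: "act n \<sigma> (tscale c t) = tscale c (act n \<sigma> t)" if "\<sigma> \<in> {\<sigma>. \<sigma> permutes {..<n}}" for \<sigma>
  proof -
    interpret L: Vector_Spaces.linear tscale tscale "act n \<sigma>" using that by (simp add: koszul_action_linear)
    show "act n \<sigma> (s + t) = act n \<sigma> s + act n \<sigma> t" "act n \<sigma> (tscale c t) = tscale c (act n \<sigma> t)"
      by (rule L.add L.scale)+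
  qed
  show "symm n (s + t) = symm n s + symm n t"
    using add by (simp add: symmetrizer_def sum.distrib tens.scale_right_distrib)
  show "symm n (tscale c t) = tscale c (symm n t)"
    using scale by (simp add: symmetrizer_def tens.scale_sum_right mult.commute)
qed

lemma symmetrizer_in_power:
  assumes t: "t \<in> tensor_power sm n"
  shows "symm n t \<in> tensor_power sm n"
  unfolding symmetrizer_def
  using koszul_action_in_power[OF _ t]
  by (intro tens.subspace_scale tens.subspace_sum subspace_tensor_power) simp_all

lemma koszul_action_symmetrizer:
  assumes \<tau>: "\<tau> permutes {..<n}" and t: "t \<in> tensor_power sm n"
  shows "act n \<tau> (symm n t) = symm n t"
proof -
  interpret M: Vector_Spaces.linear tscale tscale "act n \<tau>" by (rule koszul_action_linear[OF \<tau>])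
  let ?S = "{\<sigma>. \<sigma> permutes {..<n}}"
  have "(\<Sum>\<sigma>\<in>?S. act n \<tau> (act n \<sigma> t)) = (\<Sum>\<sigma>\<in>?S. act n (\<sigma> \<circ> \<tau>) t)"
    using \<tau> t by (intro sum.cong refl koszul_action_compose) auto
  also have "\<dots> = (\<Sum>\<sigma>\<in>?S. act n \<sigma> t)"
    by (rule sum_permutations_compose_right[OF \<tau>, symmetric])
  finally show ?thesis by (simp add: symmetrizer_def M.scale M.sum)
qed

lemma symmetrizer_idem:
  assumes t: "t \<in> tensor_power sm n"
  shows "symm n (symm n t) = symm n t"
proof -
  have "(\<Sum>\<sigma> | \<sigma> permutes {..<n}. act n \<sigma> (symm n t)) = (\<Sum>\<sigma> | \<sigma> permutes {..<n}. symm n t)"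
    using t by (intro sum.cong refl koszul_action_symmetrizer) auto
  also have "\<dots> = tscale (fact n) (symm n t)"
    using tens.scale_sum_left[of "\<lambda>_. 1" "{\<sigma>. \<sigma> permutes {..<n}}" "symm n t"]
    by (simp add: card_permutations[OF refl])
  finally show ?thesis
    by (subst symmetrizer_def) simp
qed

lemma symmetrizer_symmetric_power: "t \<in> symmetric_power sm V0 V1 n \<Longrightarrow> symm n t = t"
  by (auto simp: symmetric_power_def symmetrizer_idem)

lemma symmetric_power_subset: "symmetric_power sm V0 V1 n \<subseteq> tensor_power sm n"
  by (auto simp: symmetric_power_def symmetrizer_in_power)

lemma symmetrizer_one:
  assumes t: "t \<in> tensor_power sm 1"
  shows "symm 1 t = t"
proof -
  have "is_koszul_action sm V0 V1 1 id id"
    unfolding is_koszul_action_def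
  proof (intro conjI allI impI)
    show "Vector_Spaces.linear tscale tscale (id :: ('k, 'v) tensor \<Rightarrow> _)" by unfold_locales simp_all
    have "pairs 1 = {}" by (auto simp: pairs_def)
    then show "id (tensor sm vs) = tscale (koszul_sign V1 id vs) (tensor sm (permute_list id vs))"
      if "length vs = 1 \<and> set vs \<subseteq> V0 \<union> V1" for vs
      using that by (simp add: koszul_sign_prod)
  qed
  then have "act 1 id t = id t"
    using koszul_action_unique[OF koszul_action_is_action[OF permutes_id]] t by blast
  moreover have "{\<sigma>. \<sigma> permutes {..<1::nat}} = {id}" by (auto simp: permutes_sing lessThan_Suc)
  ultimately show ?thesis by (simp add: symmetrizer_def)
qed

text \<open>On homogeneous tensors the action only permutes the entries and changes the sign. If \<open>p\<close> adds over
  the even and the odd part, both sides of the estimate add in the same way when an entry is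
  decomposed, so it holds for all elementary tensors.\<close>

lemma tensor_seminorm_koszul_action_le:
  assumes p: "seminorm_UNIV sm p" and gr: "\<And>a b. a \<in> V0 \<Longrightarrow> b \<in> V1 \<Longrightarrow> p (a + b) = p a + p b"
    and \<sigma>: "\<sigma> permutes {..<n}" and t: "t \<in> tensor_power sm n"
  shows "tensor_seminorm sm p n (act n \<sigma> t) \<le> tensor_seminorm sm p n t"
proof -
  interpret seminorm_UNIV sm p by fact
  interpret L: Vector_Spaces.linear tscale tscale "act n \<sigma>" by (rule koszul_action_linear[OF \<sigma>])
  note actT = koszul_action_in_power[OF \<sigma>]
  have prod_upd: "prod_list (map p (vs[k := c])) = prod_list (map p (take k vs)) * p c * prod_list (map p (drop (Suc k) vs))"
    if "k < length vs" for vs k c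
    using that by (simp add: upd_conv_take_nth_drop mult.assoc)
  have "tsem n (act n \<sigma> (tensor sm vs)) \<le> prod_list (map p vs)"
    if "length vs = n" "k \<le> n" "\<forall>i<n. k \<le> i \<longrightarrow> vs ! i \<in> V0 \<union> V1" for k vs
    using that
  proof (induction k arbitrary: vs)
    case 0
    then have vs: "set vs \<subseteq> V0 \<union> V1" by (auto simp: in_set_conv_nth)
    have "tsem n (act n \<sigma> (tensor sm vs)) = norm (koszul_sign V1 \<sigma> vs :: 'k) * tsem n (tensor sm (permute_list \<sigma> vs))"
      unfolding koszul_action_tensor[OF \<sigma> 0(1) vs]
      using 0 by (intro tens_pow.seminorm_scale tensor_in_power) simp
    also have "norm (koszul_sign V1 \<sigma> vs :: 'k) = 1" by (simp add: koszul_sign_def norm_power)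
    also have "1 * tsem n (tensor sm (permute_list \<sigma> vs)) \<le> prod_list (map p (permute_list \<sigma> vs))"
      using tensor_seminorm_tensor[of "permute_list \<sigma> vs" n] 0 by simp
    also have "\<dots> = prod_mset (image_mset p (mset (permute_list \<sigma> vs)))"
      by (simp add: prod_mset_prod_list[symmetric])
    also have "\<dots> = prod_list (map p vs)"
      using \<sigma> 0 by (simp add: mset_permute_list prod_mset_prod_list[symmetric])
    finally show ?case .
  next
    case (Suc k)
    obtain a b where ab: "a \<in> V0" "b \<in> V1" "vs ! k = a + b" using V0_plus_V1 by blast
    have k: "k < n" "k < length vs" using Suc by simp_all
    have vs_upd: "vs = vs[k := a + b]" using ab(3) by (metis list_update_id)
    have "tensor sm vs = tensor sm (vs[k := a]) + tensor sm (vs[k := b])"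
      using multilinearD(1)[OF multilinear_tensor Suc.prems(1) k(1), of sm a b] vs_upd by simp
    then have "act n \<sigma> (tensor sm vs) = act n \<sigma> (tensor sm (vs[k := a])) + act n \<sigma> (tensor sm (vs[k := b]))"
      by (simp add: L.add)
    then have "tsem n (act n \<sigma> (tensor sm vs)) \<le>
        tsem n (act n \<sigma> (tensor sm (vs[k := a]))) + tsem n (act n \<sigma> (tensor sm (vs[k := b])))"
      using Suc.prems by (simp add: tensor_seminorm_add actT tensor_in_power)
    also have "\<dots> \<le> prod_list (map p (vs[k := a])) + prod_list (map p (vs[k := b]))"
      using ab Suc.prems by (intro add_mono Suc.IH) (auto simp: nth_list_update)
    also have "\<dots> = prod_list (map p (vs[k := a + b]))"
      using gr[OF ab(1,2)] by (simp add: prod_upd[OF k(2)] algebra_simps)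
    finally show ?case using vs_upd by simp
  qed
  from this[of _ n] have bound: "tsem n (act n \<sigma> (tensor sm vs)) \<le> prod_list (map p vs)" if "length vs = n" for vs
    using that by simp
  have "seminorm_on tscale (tensor_power sm n) (\<lambda>t. tsem n (act n \<sigma> t))"
    unfolding seminorm_on_def by (simp add: L.add L.scale tensor_seminorm_add actT tens_pow.seminorm_scale)
  from tensor_seminorm_universal[OF this bound t] show ?thesis .
qed

lemma tensor_seminorm_symmetrizer_le:
  assumes p: "seminorm_UNIV sm p" and gr: "\<And>a b. a \<in> V0 \<Longrightarrow> b \<in> V1 \<Longrightarrow> p (a + b) = p a + p b"
    and t: "t \<in> tensor_power sm n"
  shows "tensor_seminorm sm p n (symm n t) \<le> tensor_seminorm sm p n t"
proof -
  interpret seminorm_UNIV sm p by fact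
  let ?S = "{\<sigma>. \<sigma> permutes {..<n}}"
  have actT: "act n \<sigma> t \<in> tensor_power sm n" if "\<sigma> \<in> ?S" for \<sigma>
    using that koszul_action_in_power[OF _ t] by simp
  have "tsem n (symm n t) = norm (1 / fact n :: 'k) * tsem n (\<Sum>\<sigma>\<in>?S. act n \<sigma> t)"
    unfolding symmetrizer_def
    by (intro tens_pow.seminorm_scale tens.subspace_sum[OF subspace_tensor_power] actT)
  also have "\<dots> \<le> norm (1 / fact n :: 'k) * (\<Sum>\<sigma>\<in>?S. tsem n (act n \<sigma> t))"
    by (intro mult_left_mono tens_pow.seminorm_sum actT) simp_all
  also have "\<dots> \<le> norm (1 / fact n :: 'k) * (\<Sum>\<sigma>\<in>?S. tsem n t)"
    using tensor_seminorm_koszul_action_le[OF p gr _ t] by (intro mult_left_mono sum_mono) simp_all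
  also have "\<dots> = tsem n t"
    by (simp add: card_permutations[OF refl] norm_divide)
  finally show ?thesis .
qed

end

section \<open>The topologies of the tensor algebra and of the Weyl algebra\<close>

context graded_locally_convex_space
begin

lemma continuous_seminorm_UNIV: "continuous_seminorm sm X p \<Longrightarrow> seminorm_UNIV sm p"
  unfolding seminorm_UNIV_def
  using seminormed_spaceI[OF vector_space_axioms, of X p] by (simp add: topspace_UNIV)

lemma continuous_seminorm_add:
  assumes p: "continuous_seminorm sm X p" and q: "continuous_seminorm sm X q"
  shows "continuous_seminorm sm X (\<lambda>v. p v + q v)"
proof -
  interpret p: seminorm_UNIV sm p by (rule continuous_seminorm_UNIV[OF p])
  interpret q: seminorm_UNIV sm q by (rule continuous_seminorm_UNIV[OF q])
  have "p (x + y) + q (x + y) \<le> p x + q x + (p y + q y)" for x y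
    using p.seminorm_add[of x y] q.seminorm_add[of x y] by simp
  then have "seminorm_on sm (topspace X) (\<lambda>v. p v + q v)"
    by (simp add: seminorm_on_def p.seminorm_scale q.seminorm_scale algebra_simps)
  moreover have "continuous_map X euclideanreal (\<lambda>v. p v + q v)"
    using p q by (intro continuous_map_add) (simp_all add: continuous_seminorm_def)
  ultimately show ?thesis by (simp add: continuous_seminorm_def)
qed

lemma continuous_seminorm_mult:
  assumes p: "continuous_seminorm sm X p" and K: "0 \<le> K"
  shows "continuous_seminorm sm X (\<lambda>v. K * p v)"
proof -
  interpret p: seminorm_UNIV sm p by (rule continuous_seminorm_UNIV[OF p])
  have "K * p (x + y) \<le> K * p x + K * p y" for x y
    using mult_left_mono[OF p.seminorm_add[of x y] K] by (simp add: distrib_left)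
  then have "seminorm_on sm (topspace X) (\<lambda>v. K * p v)"
    by (simp add: seminorm_on_def p.seminorm_scale)
  moreover have "continuous_map X euclideanreal (\<lambda>v. K * p v)"
    using p by (intro continuous_map_real_mult_left) (simp add: continuous_seminorm_def)
  ultimately show ?thesis by (simp add: continuous_seminorm_def)
qed

text \<open>This is where the continuity of the projections onto the even and the odd part is used.\<close>

lemma graded_continuous_seminorm:
  assumes p: "continuous_seminorm sm X p"
  shows "\<exists>p'. continuous_seminorm sm X p' \<and> (\<forall>v. p v \<le> p' v) \<and>
    (\<forall>a\<in>V0. \<forall>b\<in>V1. p' (a + b) = p' a + p' b)"
proof (intro exI conjI ballI allI)
  interpret p: seminorm_UNIV sm p by (rule continuous_seminorm_UNIV[OF p])
  let ?p = "\<lambda>v. p (proj_along V0 V1 v) + p (proj_along V1 V0 v)"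
  have comp: "continuous_seminorm sm X (\<lambda>v. p (h v))"
    if h: "continuous_map X X h" "\<And>x y. h (x + y) = h x + h y" "\<And>c x. h (sm c x) = sm c (h x)" for h
  proof -
    have "continuous_map X euclideanreal (p \<circ> h)"
      by (rule continuous_map_compose[OF h(1)]) (use p in \<open>simp add: continuous_seminorm_def\<close>)
    then show ?thesis
      by (simp add: continuous_seminorm_def seminorm_on_def h p.seminorm_add p.seminorm_scale o_def)
  qed
  show "continuous_seminorm sm X ?p"
    by (intro continuous_seminorm_add comp continuous_proj_V0 continuous_proj_V1 proj_along_linear)
  show "p v \<le> ?p v" for v
  proof -
    obtain a b where "a \<in> V0" "b \<in> V1" "v = a + b" using V0_plus_V1 by blast
    then show ?thesis using p.seminorm_add[of a b] by (simp add: proj_along_decomp)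
  qed
  show "?p (a + b) = ?p a + ?p b" if "a \<in> V0" "b \<in> V1" for a b
    using that proj_along_decomp[of a 0] proj_along_decomp[of 0 b] proj_along_decomp[of a b]
      subspace_0[OF subspace_V0] subspace_0[OF subspace_V1] by simp
qed

abbreviation TA :: "(nat \<Rightarrow> ('k, 'v) tensor) set" where "TA \<equiv> tensor_algebra sm"
abbreviation SA :: "(nat \<Rightarrow> ('k, 'v) tensor) set" where "SA \<equiv> symmetric_algebra sm V0 V1"
abbreviation TR :: "real \<Rightarrow> (nat \<Rightarrow> ('k, 'v) tensor) topology" where
  "TR R \<equiv> tensor_algebra_topology sm X R"

lemma openin_TR_ball:
  assumes "continuous_seminorm sm X p" "x \<in> TA" "0 < e"
  shows "openin (TR R) {y \<in> TA. graded_seminorm sm R p (y - x) < e}"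
  unfolding tensor_algebra_topology_def seminorm_topology_def
  by (rule topology_generated_by_Basis) (use assms in blast)

text \<open>The generating sets are balls for different seminorms around different points. A finite intersection
  contains a ball for the sum of the seminorms.\<close>

lemma openin_TR_contains_ball:
  assumes "openin (TR R) U" "x \<in> U"
  shows "\<exists>p e. continuous_seminorm sm X p \<and> 0 < e \<and> {y \<in> TA. graded_seminorm sm R p (y - x) < e} \<subseteq> U"
proof -
  have gen: "generate_topology_on {{y\<in>TA. p (y - x) < e} | p x e.
      p \<in> graded_seminorm sm R ` {p. continuous_seminorm sm X p} \<and> x \<in> TA \<and> 0 < e} U"
    using assms(1) by (simp add: tensor_algebra_topology_def seminorm_topology_def
        openin_topology_generated_by_iff)
  have "continuous_seminorm sm X (\<lambda>_. 0)" by (simp add: continuous_seminorm_def seminorm_on_def)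
  from gen assms(2) show ?thesis
  proof (induction arbitrary: x rule: generate_topology_on.induct)
    case Empty
    then show ?case by simp
  next
    case (Int a b)
    obtain p d where p: "continuous_seminorm sm X p" "0 < d"
      "{y \<in> TA. graded_seminorm sm R p (y - x) < d} \<subseteq> a" using Int.IH(1)[of x] Int.prems by blast
    obtain q e where q: "continuous_seminorm sm X q" "0 < e"
      "{y \<in> TA. graded_seminorm sm R q (y - x) < e} \<subseteq> b" using Int.IH(2)[of x] Int.prems by blast
    show ?case
    proof (cases "x \<in> TA")
      case xT: True
      interpret p: seminorm_UNIV sm p by (rule continuous_seminorm_UNIV[OF p(1)])
      interpret q: seminorm_UNIV sm q by (rule continuous_seminorm_UNIV[OF q(1)])
      interpret pq: seminorm_UNIV sm "\<lambda>v. p v + q v"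
        by (intro continuous_seminorm_UNIV continuous_seminorm_add p q)
      have le: "graded_seminorm sm R p (y - x) \<le> graded_seminorm sm R (\<lambda>v. p v + q v) (y - x)"
        "graded_seminorm sm R q (y - x) \<le> graded_seminorm sm R (\<lambda>v. p v + q v) (y - x)" if "y \<in> TA" for y
        using that xT grad.subspace_diff[OF subspace_tensor_algebra]
        by (auto intro!: pq.graded_seminorm_mono simp: p.seminorm_nonneg q.seminorm_nonneg
            p.seminorm_UNIV_axioms q.seminorm_UNIV_axioms)
      have "{y \<in> TA. graded_seminorm sm R (\<lambda>v. p v + q v) (y - x) < min d e} \<subseteq> a \<inter> b"
      proof
        fix y assume y: "y \<in> {y \<in> TA. graded_seminorm sm R (\<lambda>v. p v + q v) (y - x) < min d e}"
        then have "graded_seminorm sm R p (y - x) < d" "graded_seminorm sm R q (y - x) < e"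
          using le[of y] by auto
        then show "y \<in> a \<inter> b" using y p(3) q(3) by auto
      qed
      moreover have "0 < min d e" using p(2) q(2) by simp
      ultimately show ?thesis using continuous_seminorm_add[OF p(1) q(1)] by blast
    next
      case False
      have "openin (TR R) a"
        using Int.hyps(1) by (simp add: tensor_algebra_topology_def seminorm_topology_def
            openin_topology_generated_by_iff)
      then have "x \<in> topspace (TR R)" using openin_subset Int.prems by blast
      then show ?thesis using False by (simp add: topspace_tensor_algebra_topology)
    qed
  next
    case (UN K)
    then obtain k where k: "k \<in> K" "x \<in> k" by blast
    then obtain p e where "continuous_seminorm sm X p" "0 < e"
      "{y \<in> TA. graded_seminorm sm R p (y - x) < e} \<subseteq> k" using UN.IH[of k x] by blast
    then show ?case using k(1) by blast
  next
    case (Basis s)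
    then obtain p z e where s: "continuous_seminorm sm X p" "z \<in> TA" "0 < e"
      "s = {y\<in>TA. graded_seminorm sm R p (y - z) < e}" by blast
    interpret p: seminorm_UNIV sm p by (rule continuous_seminorm_UNIV[OF s(1)])
    interpret G: seminormed_space gscale TA "graded_seminorm sm R p" by (rule p.graded_seminormed_space)
    have x: "x \<in> TA" "graded_seminorm sm R p (x - z) < e" using Basis.prems s(4) by auto
    have "{y \<in> TA. graded_seminorm sm R p (y - x) < e - graded_seminorm sm R p (x - z)} \<subseteq> s"
    proof
      fix y assume y: "y \<in> {y \<in> TA. graded_seminorm sm R p (y - x) < e - graded_seminorm sm R p (x - z)}"
      then have "graded_seminorm sm R p (y - z) < e"
        using G.seminorm_triangle[of y x z] x(1) s(2) by auto
      then show "y \<in> s" using y s(4) by simp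
    qed
    moreover have "0 < e - graded_seminorm sm R p (x - z)" using x(2) by simp
    ultimately show ?case using s(1) by blast
  qed
qed

lemma continuous_graded_seminorm:
  assumes p: "continuous_seminorm sm X p" and K: "0 \<le> K" and S: "S \<subseteq> TA"
  shows "continuous_seminorm gscale (subtopology (TR R) S) (\<lambda>t. K * graded_seminorm sm R p t)"
proof -
  interpret p: seminorm_UNIV sm p by (rule continuous_seminorm_UNIV[OF p])
  interpret G: seminormed_space gscale TA "graded_seminorm sm R p" by (rule p.graded_seminormed_space)
  have "continuous_map (TR R) euclideanreal (graded_seminorm sm R p)"
    unfolding continuous_map_def
  proof (intro conjI allI impI)
    fix U :: "real set" assume U: "openin euclideanreal U"
    show "openin (TR R) {x \<in> topspace (TR R). graded_seminorm sm R p x \<in> U}"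
    proof (subst openin_subopen, intro ballI)
      fix x assume "x \<in> {x \<in> topspace (TR R). graded_seminorm sm R p x \<in> U}"
      then have x: "x \<in> TA" "graded_seminorm sm R p x \<in> U" by (simp_all add: topspace_tensor_algebra_topology)
      obtain e where e: "0 < e" "\<And>r. dist r (graded_seminorm sm R p x) < e \<Longrightarrow> r \<in> U"
        using U x(2) unfolding open_openin[symmetric] open_dist by blast
      have "{y \<in> TA. graded_seminorm sm R p (y - x) < e} \<subseteq> {x \<in> topspace (TR R). graded_seminorm sm R p x \<in> U}"
      proof
        fix y assume y: "y \<in> {y \<in> TA. graded_seminorm sm R p (y - x) < e}"
        then have "dist (graded_seminorm sm R p y) (graded_seminorm sm R p x) < e"
          using G.seminorm_diff[of y x] x(1) by (auto simp: dist_real_def)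
        then show "y \<in> {x \<in> topspace (TR R). graded_seminorm sm R p x \<in> U}"
          using y e(2) by (simp add: topspace_tensor_algebra_topology)
      qed
      moreover have "x \<in> {y \<in> TA. graded_seminorm sm R p (y - x) < e}" using x(1) e(1) by simp
      ultimately show "\<exists>T. openin (TR R) T \<and> x \<in> T \<and> T \<subseteq> {x \<in> topspace (TR R). graded_seminorm sm R p x \<in> U}"
        using openin_TR_ball[OF p x(1) e(1)] by blast
    qed
  qed simp
  then have "continuous_map (subtopology (TR R) S) euclideanreal (\<lambda>t. K * graded_seminorm sm R p t)"
    by (intro continuous_map_real_mult_left continuous_map_from_subtopology)
  moreover have "seminorm_on gscale S (\<lambda>t. K * graded_seminorm sm R p t)"
    unfolding seminorm_on_def
  proof (intro conjI ballI allI)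
    fix s t assume "s \<in> S" "t \<in> S"
    then have "graded_seminorm sm R p (s + t) \<le> graded_seminorm sm R p s + graded_seminorm sm R p t"
      using S by (intro G.seminorm_add) auto
    from mult_left_mono[OF this K]
    show "K * graded_seminorm sm R p (s + t) \<le> K * graded_seminorm sm R p s + K * graded_seminorm sm R p t"
      by (simp add: distrib_left)
  next
    fix c t assume "t \<in> S"
    then have "graded_seminorm sm R p (gscale c t) = norm c * graded_seminorm sm R p t"
      using S by (intro G.seminorm_scale) auto
    then show "K * graded_seminorm sm R p (gscale c t) = norm c * (K * graded_seminorm sm R p t)" by simp
  qed
  moreover have "topspace (subtopology (TR R) S) = S"
    using S by (auto simp: topspace_tensor_algebra_topology)
  ultimately show ?thesis by (simp add: continuous_seminorm_def)
qed

text \<open>The factor \<open>K\<close> cannot be absorbed into \<open>p\<close>, because in degree \<open>0\<close> the seminorm \<open>p\<^sub>R\<close> is the absolute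
  value for every \<open>p\<close>.\<close>

lemma continuous_seminorm_dominated:
  assumes P: "continuous_seminorm gscale (subtopology (TR R) S) P" and S: "grad.subspace S" "S \<subseteq> TA"
  shows "\<exists>p K. continuous_seminorm sm X p \<and> 1 \<le> K \<and> (\<forall>t\<in>S. P t \<le> K * graded_seminorm sm R p t)"
proof -
  have top: "topspace (subtopology (TR R) S) = S"
    using S by (auto simp: topspace_tensor_algebra_topology)
  interpret P: seminormed_space gscale S P
    by unfold_locales (use P S(1) in \<open>simp_all only: continuous_seminorm_def top\<close>)
  have "continuous_map (subtopology (TR R) S) euclideanreal P"
    using P by (simp add: continuous_seminorm_def)
  from openin_continuous_map_preimage[OF this, of "{..<1}"]
  have "openin (subtopology (TR R) S) {t \<in> S. P t < 1}"
    unfolding top by (simp add: open_openin[symmetric])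
  then obtain U where U: "openin (TR R) U" "{t \<in> S. P t < 1} = U \<inter> S"
    by (auto simp: openin_subtopology)
  have "0 \<in> {t \<in> S. P t < 1}" using P.E_closed(1) by simp
  then have "0 \<in> U" unfolding U(2) by blast
  from openin_TR_contains_ball[OF U(1) this] obtain p e where
    p: "continuous_seminorm sm X p" and e: "0 < e" and sub: "{y \<in> TA. graded_seminorm sm R p (y - 0) < e} \<subseteq> U"
    by blast
  interpret p: seminorm_UNIV sm p by (rule continuous_seminorm_UNIV[OF p])
  interpret G: seminormed_space gscale TA "graded_seminorm sm R p" by (rule p.graded_seminormed_space)
  have bound: "P t \<le> graded_seminorm sm R p t / e" if t: "t \<in> S" for t
  proof (rule dense_ge)
    fix r assume r: "graded_seminorm sm R p t / e < r"
    have tT: "t \<in> TA" using t S(2) by blast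
    have r0: "0 < r" using r e G.seminorm_nonneg[OF tT] by (meson divide_nonneg_pos le_less_trans)
    let ?s = "gscale (of_real (1 / r)) t"
    have nr: "norm (of_real (1 / r) :: 'k) = 1 / r" using r0 by (simp only: norm_of_real abs_of_pos zero_less_divide_1_iff)
    have "graded_seminorm sm R p ?s < e"
      using r r0 e by (simp add: G.seminorm_scale[OF tT] nr field_simps del: of_real_divide)
    moreover have "?s \<in> TA" using tT by blast
    ultimately have "?s \<in> U" using sub by auto
    moreover have "?s \<in> S" using t by (rule P.E_closed(4))
    ultimately have "P ?s < 1" using U(2) by blast
    then show "P t \<le> r"
      using r0 by (simp add: P.seminorm_scale[OF t] nr field_simps del: of_real_divide)
  qed
  have "P t \<le> max 1 (1 / e) * graded_seminorm sm R p t" if t: "t \<in> S" for t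
  proof -
    have "0 \<le> graded_seminorm sm R p t" using t S(2) by (intro G.seminorm_nonneg) blast
    from mult_right_mono[OF _ this, of "1 / e" "max 1 (1 / e)"] bound[OF t] show ?thesis by simp
  qed
  then show ?thesis using p by (intro exI[of _ p] exI[of _ "max 1 (1 / e)"]) simp
qed

lemma TR_eq_subtopology: "TR R = subtopology (TR R) TA"
  by (metis subtopology_topspace topspace_tensor_algebra_topology)

lemma subspace_symmetric_algebra: "grad.subspace SA" and symmetric_algebra_subset: "SA \<subseteq> TA"
proof -
  have sub: "tens.subspace (symmetric_power sm V0 V1 n)" for n
  proof -
    interpret L: Vector_Spaces.linear tscale tscale "symm n" by (rule symmetrizer_linear)
    show ?thesis unfolding symmetric_power_def by (intro L.subspace_image subspace_tensor_power)
  qed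
  show "SA \<subseteq> TA" using symmetric_power_subset by (auto simp: symmetric_algebra_def tensor_algebra_def)
  then have fin: "finite {n. t n \<noteq> 0}" if "t \<in> SA" for t using that by (auto simp: tensor_algebra_def)
  show "grad.subspace SA"
  proof (rule grad.subspaceI)
    show "0 \<in> SA" using tens.subspace_0[OF sub] by (simp add: symmetric_algebra_def)
    show "s + t \<in> SA" if "s \<in> SA" "t \<in> SA" for s t
    proof -
      have "s + t \<in> TA" using that \<open>SA \<subseteq> TA\<close> by (intro grad.subspace_add[OF subspace_tensor_algebra]) auto
      then show ?thesis
        using that tens.subspace_add[OF sub] by (simp add: symmetric_algebra_def tensor_algebra_def)
    qed
    show "gscale c t \<in> SA" if "t \<in> SA" for c t
    proof -
      have "gscale c t \<in> TA" using that \<open>SA \<subseteq> TA\<close> by (intro grad.subspace_scale[OF subspace_tensor_algebra]) auto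
      then show ?thesis
        using that tens.subspace_scale[OF sub] by (simp add: symmetric_algebra_def tensor_algebra_def gscale_def)
    qed
  qed
qed

lemma topspace_weyl: "topspace (weyl_algebra_topology sm X V0 V1 R) = SA"
  using symmetric_algebra_subset by (auto simp: weyl_algebra_topology_def topspace_tensor_algebra_topology)

section \<open>The Weyl algebra and the base space as retracts\<close>

lemma symmetrizer_zero: "symm n 0 = 0"
proof -
  interpret L: Vector_Spaces.linear tscale tscale "symm n" by (rule symmetrizer_linear)
  show ?thesis by (rule L.zero)
qed

lemma symmetrizer_in_symmetric_algebra:
  assumes t: "t \<in> TA"
  shows "(\<lambda>n. symm n (t n)) \<in> SA"
proof -
  have "{n. symm n (t n) \<noteq> 0} \<subseteq> {n. t n \<noteq> 0}" using symmetrizer_zero by auto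
  then have "finite {n. symm n (t n) \<noteq> 0}" using t by (auto simp: tensor_algebra_def intro: finite_subset)
  then show ?thesis using t by (simp add: symmetric_algebra_def symmetric_power_def tensor_algebra_def)
qed

lemma nuclear_weyl_if_nuclear_tensor_algebra:
  assumes nuc: "nuclear_space gscale (TR R)"
  shows "nuclear_space gscale (weyl_algebra_topology sm X V0 V1 R)" (is "nuclear_space gscale ?W")
proof (rule nuclear_space_retract[OF nuc])
  let ?pi = "\<lambda>t n. symm n (t n)"
  have top: "topspace (TR R) = TA" by (rule topspace_tensor_algebra_topology)
  show "vector_space (gscale :: 'k \<Rightarrow> (nat \<Rightarrow> ('k, 'v) tensor) \<Rightarrow> _)"
    "vector_space (gscale :: 'k \<Rightarrow> (nat \<Rightarrow> ('k, 'v) tensor) \<Rightarrow> _)" by (rule vector_space_gscale)+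
  show "grad.subspace (topspace (TR R))" by (simp add: top subspace_tensor_algebra)
  show "grad.subspace (topspace ?W)" by (simp add: topspace_weyl subspace_symmetric_algebra)
  show "linear_between gscale (topspace ?W) gscale (topspace (TR R)) (\<lambda>t. t)"
    using symmetric_algebra_subset by (auto simp: linear_between_def top topspace_weyl)
  have "?pi (s + t) = ?pi s + ?pi t" "?pi (gscale c t) = gscale c (?pi t)" for s t c
  proof -
    have "symm n ((s + t) n) = symm n (s n) + symm n (t n) \<and> symm n (gscale c t n) = tscale c (symm n (t n))" for n
    proof -
      interpret L: Vector_Spaces.linear tscale tscale "symm n" by (rule symmetrizer_linear)
      have "(s + t) n = s n + t n" by (rule plus_fun_apply)
      then show ?thesis by (simp only: gscale_def L.add L.scale)
    qed
    then show "?pi (s + t) = ?pi s + ?pi t" "?pi (gscale c t) = gscale c (?pi t)"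
      by (auto simp: gscale_def)
  qed
  then show "linear_between gscale (topspace (TR R)) gscale (topspace ?W) ?pi"
    using symmetrizer_in_symmetric_algebra by (simp add: linear_between_def top topspace_weyl)
  show "?pi t = t" if "t \<in> topspace ?W" for t
    using that symmetrizer_symmetric_power by (auto simp: topspace_weyl symmetric_algebra_def)
  fix Q assume Q: "continuous_seminorm gscale (TR R) Q"
  have "continuous_seminorm gscale ?W Q"
    using Q symmetric_algebra_subset unfolding continuous_seminorm_def weyl_algebra_topology_def
    by (auto simp: seminorm_on_def top intro: continuous_map_from_subtopology)
  then show "\<exists>q'. continuous_seminorm gscale ?W q' \<and> (\<forall>x\<in>topspace ?W. Q x \<le> q' x)" by blast
next
  let ?pi = "\<lambda>t n. symm n (t n)"
  fix P assume P: "continuous_seminorm gscale ?W P"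
  obtain p K where p: "continuous_seminorm sm X p" and K: "1 \<le> K"
    and PK: "\<And>t. t \<in> SA \<Longrightarrow> P t \<le> K * graded_seminorm sm R p t"
    using continuous_seminorm_dominated[OF P[unfolded weyl_algebra_topology_def]
        subspace_symmetric_algebra symmetric_algebra_subset] by blast
  obtain p' where p': "continuous_seminorm sm X p'" "\<And>v. p v \<le> p' v"
    "\<And>a b. a \<in> V0 \<Longrightarrow> b \<in> V1 \<Longrightarrow> p' (a + b) = p' a + p' b" using graded_continuous_seminorm[OF p] by blast
  interpret p': seminorm_UNIV sm p' by (rule continuous_seminorm_UNIV[OF p'(1)])
  have "P (?pi t) \<le> K * graded_seminorm sm R p' t" if t: "t \<in> TA" for t
  proof -
    have S: "?pi t \<in> SA" by (rule symmetrizer_in_symmetric_algebra[OF t])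
    then have T: "?pi t \<in> TA" using symmetric_algebra_subset by blast
    have "P (?pi t) \<le> K * graded_seminorm sm R p (?pi t)" by (rule PK[OF S])
    also have "\<dots> \<le> K * graded_seminorm sm R p' (?pi t)"
      using K p' T by (intro mult_left_mono p'.graded_seminorm_mono continuous_seminorm_UNIV[OF p]) simp_all
    also have "\<dots> \<le> K * graded_seminorm sm R p' t"
      using K t T
      by (intro mult_left_mono p'.graded_seminorm_le p'.seminorm_UNIV_axioms tensor_seminorm_symmetrizer_le p'(3))
        (simp_all add: tensor_algebra_def)
    finally show ?thesis .
  qed
  moreover have "continuous_seminorm gscale (TR R) (\<lambda>t. K * graded_seminorm sm R p' t)"
    using K by (subst TR_eq_subtopology) (intro continuous_graded_seminorm p'(1), simp_all)
  ultimately show "\<exists>q. continuous_seminorm gscale (TR R) q \<and> (\<forall>z\<in>topspace (TR R). P (?pi z) \<le> q z)"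
    by (auto simp: topspace_tensor_algebra_topology)
qed

text \<open>In degree one nothing is symmetrized and \<open>1!\<^sup>R = 1\<close>, so the inclusion as the part of degree one and the
  projection to that part exhibit \<open>V\<close> as a retract. The space of tensors of degree one is identified with \<open>V\<close> by the universal property.\<close>

lemma nuclear_if_nuclear_weyl:
  assumes nuc: "nuclear_space gscale (weyl_algebra_topology sm X V0 V1 R)" (is "nuclear_space gscale ?W")
  shows "nuclear_space sm X"
proof -
  have "multilinear sm sm 1 hd"
    unfolding multilinear_def by (auto simp: length_Suc_conv)
  from tensor_power_universal[OF vector_space_axioms this]
  obtain L where L: "Vector_Spaces.linear tscale sm L" and "\<forall>vs. length vs = 1 \<longrightarrow> L (tensor sm vs) = hd vs"
    by blast
  then have L1: "L (tensor sm [v]) = v" for v by simp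
  interpret L: Vector_Spaces.linear tscale sm L by fact
  define emb where "emb v = (\<lambda>n::nat. if n = 1 then tensor sm [v] else 0)" for v
  have in1: "tensor sm [v] \<in> tensor_power sm 1" for v by (simp add: tensor_in_power)
  have emb_SA: "emb v \<in> SA" for v
  proof -
    have "tensor sm [v] \<in> symmetric_power sm V0 V1 1"
      using symmetrizer_one[OF in1] in1 unfolding symmetric_power_def by (metis image_eqI)
    moreover have "0 \<in> symmetric_power sm V0 V1 n" for n
      using grad.subspace_0[OF subspace_symmetric_algebra] by (simp add: symmetric_algebra_def)
    moreover have "{n. emb v n \<noteq> 0} \<subseteq> {1}" by (auto simp: emb_def)
    then have "finite {n. emb v n \<noteq> 0}" by (rule finite_subset) simp
    ultimately show ?thesis by (simp add: symmetric_algebra_def emb_def)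
  qed
  then have emb_TA: "emb v \<in> TA" for v using symmetric_algebra_subset by blast
  have graded_emb: "graded_seminorm sm R p (emb v) \<le> p v" if "continuous_seminorm sm X p" for p v
  proof -
    interpret p: seminorm_UNIV sm p by (rule continuous_seminorm_UNIV[OF that])
    have "graded_seminorm sm R p (emb v) = (\<Sum>n\<in>{1}. p.tsem n (emb v n) * fact n powr R)"
      by (rule p.graded_seminorm_eq_sum) (simp_all add: emb_def)
    then show ?thesis using p.tensor_seminorm_tensor[of "[v]" 1] by (simp add: emb_def)
  qed
  show ?thesis
  proof (rule nuclear_space_retract[OF nuc])
    show "vector_space (gscale :: 'k \<Rightarrow> (nat \<Rightarrow> ('k, 'v) tensor) \<Rightarrow> _)" by (rule vector_space_gscale)
    show "vector_space sm" by (rule vector_space_axioms)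
    show "grad.subspace (topspace ?W)" by (simp add: topspace_weyl subspace_symmetric_algebra)
    show "subspace (topspace X)" by (rule subspace_topspace)
    have "tensor sm [x + y] = tensor sm [x] + tensor sm [y]" "tensor sm [sm c x] = tscale c (tensor sm [x])" for x y c
      using multilinearD[OF multilinear_tensor, of "[x]" 1 0 sm] by simp_all
    then have "emb (x + y) = emb x + emb y" "emb (sm c x) = gscale c (emb x)" for x y c
      by (auto simp: emb_def gscale_def)
    then show "linear_between sm (topspace X) gscale (topspace ?W) emb"
      using emb_SA by (simp add: linear_between_def topspace_weyl)
    show "linear_between gscale (topspace ?W) sm (topspace X) (\<lambda>w. L (w 1))"
      by (simp add: linear_between_def topspace_UNIV gscale_def L.add L.scale)
    show "L (emb x 1) = x" for x by (simp add: emb_def L1)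
    fix Q assume Q: "continuous_seminorm gscale ?W Q"
    obtain p K where p: "continuous_seminorm sm X p" and K: "1 \<le> K"
      and QK: "\<And>t. t \<in> SA \<Longrightarrow> Q t \<le> K * graded_seminorm sm R p t"
      using continuous_seminorm_dominated[OF Q[unfolded weyl_algebra_topology_def]
            subspace_symmetric_algebra symmetric_algebra_subset] by blast
    have "Q (emb v) \<le> K * p v" for v
    proof (rule order_trans[OF QK[OF emb_SA]])
      show "K * graded_seminorm sm R p (emb v) \<le> K * p v"
        using K by (intro mult_left_mono graded_emb p) simp
    qed
    moreover have "continuous_seminorm sm X (\<lambda>v. K * p v)"
      using K by (intro continuous_seminorm_mult p) simp
    ultimately show "\<exists>q'. continuous_seminorm sm X q' \<and> (\<forall>x\<in>topspace X. Q (emb x) \<le> q' x)" by blast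
  next
    fix p assume p: "continuous_seminorm sm X p"
    interpret p: seminorm_UNIV sm p by (rule continuous_seminorm_UNIV[OF p])
    have "p (L t) \<le> p.tsem 1 t" if t: "t \<in> tensor_power sm 1" for t
    proof (rule p.tensor_seminorm_universal[OF _ _ t])
      show "seminorm_on tscale (tensor_power sm 1) (\<lambda>t. p (L t))"
        by (simp add: seminorm_on_def L.add L.scale p.seminorm_add p.seminorm_scale)
      fix vs :: "'v list" assume "length vs = 1"
      then obtain v where "vs = [v]" by (auto simp: length_Suc_conv)
      then show "p (L (tensor sm vs)) \<le> prod_list (map p vs)" by (simp add: L1)
    qed
    then have "p (L (w 1)) \<le> 1 * graded_seminorm sm R p w" if "w \<in> SA" for w
      using that symmetric_algebra_subset p.component_le_graded_seminorm[of w 1 R]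
      by (force simp: tensor_algebra_def)
    then show "\<exists>q. continuous_seminorm gscale ?W q \<and> (\<forall>w\<in>topspace ?W. p (L (w 1)) \<le> q w)"
      using continuous_graded_seminorm[OF p _ symmetric_algebra_subset, of 1]
      unfolding weyl_algebra_topology_def[symmetric] topspace_weyl by force
  qed
qed

end

section \<open>Expansions of tensors along words\<close>

lemma sum_fun_apply: "(\<Sum>i\<in>A. g i) x = (\<Sum>i\<in>A. g i x)"
  by (induction A rule: infinite_finite_induct) simp_all

definition words :: "nat \<Rightarrow> nat \<Rightarrow> nat list set" where
  "words N n = {I. set I \<subseteq> {..<N} \<and> length I = n}"

lemma finite_words [simp]: "finite (words N n)"
  unfolding words_def by (rule finite_lists_length_eq) simp

lemma sum_words_0: "(\<Sum>I\<in>words N 0. g I) = g []"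
proof -
  have "words N 0 = {[]}" by (auto simp: words_def)
  then show ?thesis by simp
qed

lemma sum_words_Suc: "(\<Sum>I\<in>words N (Suc n). g I) = (\<Sum>i<N. \<Sum>I\<in>words N n. g (i # I))"
proof -
  have "bij_betw (\<lambda>(i, I). i # I) ({..<N} \<times> words N n) (words N (Suc n))"
    by (rule bij_betw_byWitness[where f' = "\<lambda>I. (hd I, tl I)"])
      (auto simp: words_def length_Suc_conv)
  from sum.reindex_bij_betw[OF this, of g, symmetric] show ?thesis
    by (simp add: sum.cartesian_product case_prod_unfold)
qed

lemma sum_words_prod_list:
  fixes b :: "nat \<Rightarrow> real"
  shows "(\<Sum>I\<in>words N n. prod_list (map b I)) = (\<Sum>i<N. b i) ^ n"
  by (induction n) (simp_all add: sum_words_0 sum_words_Suc sum_distrib_left[symmetric] sum_distrib_right[symmetric])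


lemma tensor_in_slot:
  fixes sm :: "'k::real_or_complex \<Rightarrow> 'v::ab_group_add \<Rightarrow> 'v"
  shows "tensor sm (us @ (x + y) # ws) = tensor sm (us @ x # ws) + tensor sm (us @ y # ws)"
    and "tensor sm (us @ sm c x # ws) = tscale c (tensor sm (us @ x # ws))"
  using multilinearD[OF multilinear_tensor refl, of "length us" "us @ x # ws" sm] by simp_all

lemma tensor_sum_in_slot:
  fixes sm :: "'k::real_or_complex \<Rightarrow> 'v::ab_group_add \<Rightarrow> 'v"
  assumes "finite A" "vector_space sm"
  shows "tensor sm (us @ (\<Sum>i\<in>A. sm (c i) (g i)) # ws) = (\<Sum>i\<in>A. tscale (c i) (tensor sm (us @ g i # ws)))"
  using assms(1)
proof (induction A rule: finite_induct)
  case empty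
  interpret vector_space sm by fact
  show ?case using tensor_in_slot(2)[of sm us 0 0 ws] by simp
qed (simp add: tensor_in_slot)

definition word_form :: "(nat \<Rightarrow> 'v \<Rightarrow> 'k) \<Rightarrow> nat list \<Rightarrow> 'v list \<Rightarrow> 'k::real_or_complex" where
  "word_form f I vs = (\<Prod>k<length I. f (I ! k) (vs ! k))"

lemma word_form_Nil [simp]: "word_form f [] vs = 1"
  by (simp add: word_form_def)

lemma word_form_Cons [simp]: "word_form f (i # I) (v # vs) = f i v * word_form f I vs"
  by (simp add: word_form_def prod.lessThan_Suc_shift del: prod.lessThan_Suc)

lemma multilinear_word_form:
  fixes sm :: "'k::real_or_complex \<Rightarrow> 'v::ab_group_add \<Rightarrow> 'v" and f :: "nat \<Rightarrow> 'v \<Rightarrow> 'k"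
  assumes f: "\<And>i x y. f i (x + y) = f i x + f i y" "\<And>i c x. f i (sm c x) = c * f i x"
  shows "multilinear sm (*) (length I) (word_form f I)"
  unfolding multilinear_def
proof (intro allI impI conjI; elim conjE)
  fix vs :: "'v list" and k x y c assume vs: "length vs = length I" "k < length I"
  have upd: "word_form f I (vs[k := z]) = f (I ! k) z * (\<Prod>j\<in>{..<length I} - {k}. f (I ! j) (vs ! j))" for z
  proof -
    have "word_form f I (vs[k := z]) = f (I ! k) (vs[k := z] ! k) *
        (\<Prod>j\<in>{..<length I} - {k}. f (I ! j) (vs[k := z] ! j))"
      unfolding word_form_def using vs by (intro prod.remove) auto
    also have "(\<Prod>j\<in>{..<length I} - {k}. f (I ! j) (vs[k := z] ! j)) =
        (\<Prod>j\<in>{..<length I} - {k}. f (I ! j) (vs ! j))"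
      using vs by (intro prod.cong refl) (auto simp: nth_list_update)
    finally show ?thesis using vs by simp
  qed
  show "word_form f I (vs[k := x + y]) = word_form f I (vs[k := x]) + word_form f I (vs[k := y])"
    by (simp add: upd f distrib_right)
  show "word_form f I (vs[k := sm c x]) = c * word_form f I (vs[k := x])"
    by (simp add: upd f mult.assoc)
qed

lemma (in seminormed_pair) expansion_tendsto:
  fixes f :: "nat \<Rightarrow> 'a \<Rightarrow> 'k"
  assumes exp: "nuclear_expansion sm E q p f y" and x: "x \<in> E"
  shows "(\<lambda>n. p (x - (\<Sum>i<n. sm (f i x) (y i)))) \<longlonglongrightarrow> 0"
proof -
  have yE: "y i \<in> E" for i using exp by (auto simp: nuclear_expansion_def)
  have sumy: "(\<lambda>i. p (y i)) summable_on UNIV" using exp by (simp add: nuclear_expansion_def)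
  have "(\<lambda>n. \<Sum>i<n. p (y i)) \<longlonglongrightarrow> (\<Sum>\<^sub>\<infinity>i. p (y i))"
    using has_sum_imp_sums[OF has_sum_infsum[OF sumy]] by (simp add: sums_def)
  then have "(\<lambda>n. q x * ((\<Sum>\<^sub>\<infinity>i. p (y i)) - (\<Sum>i<n. p (y i)))) \<longlonglongrightarrow>
      q x * ((\<Sum>\<^sub>\<infinity>i. p (y i)) - (\<Sum>\<^sub>\<infinity>i. p (y i)))" by (intro tendsto_intros)
  then have "(\<lambda>n. q x * ((\<Sum>\<^sub>\<infinity>i. p (y i)) - (\<Sum>i<n. p (y i)))) \<longlonglongrightarrow> 0" by simp
  then show ?thesis
  proof (rule tendsto_sandwich[OF _ _ tendsto_const, rotated 2])
    show "\<forall>\<^sub>F n in sequentially. 0 \<le> p (x - (\<Sum>i<n. sm (f i x) (y i)))"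
      using x yE by (intro always_eventually allI cod.seminorm_nonneg) simp
    show "\<forall>\<^sub>F n in sequentially. p (x - (\<Sum>i<n. sm (f i x) (y i))) \<le>
        q x * ((\<Sum>\<^sub>\<infinity>i. p (y i)) - (\<Sum>i<n. p (y i)))"
      using expansion_remainder[OF exp x] by (intro always_eventually allI) simp
  qed
qed

context seminorm_UNIV
begin

text \<open>Replace the entries \<open>v\<close> by \<open>w\<close> one after the other, using \<open>p w \<le> p v + p (v - w)\<close> for the entries that
  have already been replaced; the list \<open>us\<close> holds these entries. The right-hand side tends to \<open>0\<close> with
  the differences \<open>p (v - w)\<close>.\<close>

lemma tensor_difference_le:
  assumes "length vs = length ws"
  shows "tsem (length us + length vs) (tensor sm (us @ vs) - tensor sm (us @ ws)) \<le>
    prod_list (map p us) *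
      (prod_list (map2 (\<lambda>v w. p v + p (v - w)) vs ws) - prod_list (map p vs))"
  using assms
proof (induction vs ws arbitrary: us rule: list_induct2)
  case Nil
  show ?case unfolding diff_self tens_pow.seminorm_zero by simp
next
  case (Cons v vs w ws)
  let ?n = "length us + length (v # vs)"
  let ?D = "prod_list (map2 (\<lambda>v w. p v + p (v - w)) vs ws)"
  let ?P = "prod_list (map p vs)" and ?U = "prod_list (map p us)"
  have "tensor sm (us @ v # vs) = tensor sm (us @ (v - w) # vs) + tensor sm (us @ w # vs)"
    using tensor_in_slot(1)[of sm us "v - w" w vs] by simp
  then have eq: "tensor sm (us @ v # vs) - tensor sm (us @ w # ws) =
      tensor sm (us @ (v - w) # vs) + (tensor sm ((us @ [w]) @ vs) - tensor sm ((us @ [w]) @ ws))"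
    by simp
  have T: "tensor sm ((us @ [w]) @ vs) - tensor sm ((us @ [w]) @ ws) \<in> tensor_power sm ?n"
    using Cons.hyps by (intro tens.subspace_diff subspace_tensor_power tensor_in_power) simp_all
  have P0: "0 \<le> ?P" "0 \<le> ?U" by (rule prod_seminorm_nonneg)+
  have PD: "?P \<le> ?D"
    using Cons.hyps
  proof (induction vs ws rule: list_induct2)
    case (Cons a as b bs)
    then show ?case
      using seminorm_nonneg[of a] seminorm_nonneg[of "a - b"] prod_seminorm_nonneg[of as]
      by (simp add: mult_mono)
  qed simp
  have "p w \<le> p v + p (v - w)"
    using seminorm_add[of v "w - v"] seminorm_minus_commute[of w v] by simp
  then have pw: "?U * p w * (?D - ?P) \<le> ?U * (p v + p (v - w)) * (?D - ?P)"
    using PD P0 by (intro mult_right_mono mult_left_mono) simp_all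
  have "tsem ?n (tensor sm (us @ v # vs) - tensor sm (us @ w # ws)) \<le>
      tsem ?n (tensor sm (us @ (v - w) # vs)) +
      tsem ?n (tensor sm ((us @ [w]) @ vs) - tensor sm ((us @ [w]) @ ws))"
    unfolding eq by (intro tensor_seminorm_add T tensor_in_power) simp
  also have "tsem ?n (tensor sm (us @ (v - w) # vs)) \<le> prod_list (map p (us @ (v - w) # vs))"
    by (rule tensor_seminorm_tensor) simp
  also have "\<dots> = ?U * p (v - w) * ?P" by simp
  also have "tsem ?n (tensor sm ((us @ [w]) @ vs) - tensor sm ((us @ [w]) @ ws)) \<le> ?U * p w * (?D - ?P)"
  proof -
    have "length (us @ [w]) + length vs = ?n" "prod_list (map p (us @ [w])) = ?U * p w" by simp_all
    with Cons.IH[of "us @ [w]"] show ?thesis by (simp only:)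
  qed
  also have "?U * p w * (?D - ?P) \<le> ?U * (p v + p (v - w)) * (?D - ?P)" by (rule pw)
  finally show ?case by (simp add: algebra_simps)
qed

end

text \<open>The bound \<open>1 / 2\<close> is what makes the weights of the words of all lengths summable; it can always be
  achieved by scaling \<open>q\<close>, see \<open>nuclear_seminorm_pair_exists\<close>.\<close>

locale nuclear_seminorm_pair = seminormed_pair sm UNIV q p
  for sm :: "'k::real_or_complex \<Rightarrow> 'v::ab_group_add \<Rightarrow> 'v" and q p +
  fixes f :: "nat \<Rightarrow> 'v \<Rightarrow> 'k" and y :: "nat \<Rightarrow> 'v"
  assumes expansion: "nuclear_expansion sm UNIV q p f y"
    and half: "(\<Sum>\<^sub>\<infinity>i. p (y i)) \<le> 1 / 2"
begin

sublocale Q: seminorm_UNIV sm q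
  by (rule seminorm_UNIV.intro) (rule dom.seminormed_space_axioms)

sublocale P: seminorm_UNIV sm p
  by (rule seminorm_UNIV.intro) (rule cod.seminormed_space_axioms)

lemma form_linear: "f i (x + x') = f i x + f i x'" "f i (sm c x) = c * f i x"
  and form_bound: "norm (f i x) \<le> q x"
  using expansion by (simp_all add: nuclear_expansion_def dominated_form_def)

lemmas word_form_multilinear = multilinear_word_form[where f = f and sm = sm, OF form_linear]

text \<open>A tensor is a functional on multilinear forms, so the tensor product of the forms \<open>f\<^sub>i\<close> is evaluated
  on \<open>t\<close> by applying \<open>t\<close> to it.\<close>

lemma norm_eval_word_form_le:
  assumes t: "t \<in> tensor_power sm (length I)"
  shows "norm (t (word_form f I)) \<le> Q.tsem (length I) t"
proof (rule Q.tensor_seminorm_universal[OF _ _ t])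
  show "seminorm_on tscale (tensor_power sm (length I)) (\<lambda>t. norm (t (word_form f I)))"
    by (simp add: seminorm_on_def tscale_def norm_mult norm_triangle_ineq)
  fix vs :: "'v list" assume vs: "length vs = length I"
  then have "norm (tensor sm vs (word_form f I)) = (\<Prod>k<length vs. norm (f (I ! k) (vs ! k)))"
    using word_form_multilinear[of I] by (simp add: tensor_def word_form_def prod_norm)
  also have "\<dots> \<le> (\<Prod>k<length vs. q (vs ! k))"
    by (intro prod_mono) (simp add: form_bound)
  also have "\<dots> = prod_list (map q vs)"
    by (simp add: prod.list_conv_set_nth atLeast0LessThan)
  finally show "norm (tensor sm vs (word_form f I)) \<le> prod_list (map q vs)" .
qed

lemma tensor_map_partial_sums:
  "tensor sm (us @ map (\<lambda>v. \<Sum>i<N. sm (f i v) (y i)) vs) =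
     (\<Sum>I\<in>words N (length vs). tscale (word_form f I vs) (tensor sm (us @ map y I)))"
proof (induction vs arbitrary: us)
  case Nil
  then show ?case by (simp add: sum_words_0)
next
  case (Cons v vs)
  let ?S = "\<lambda>v. \<Sum>i<N. sm (f i v) (y i)"
  have "tensor sm (us @ map ?S (v # vs)) = (\<Sum>i<N. tscale (f i v) (tensor sm (us @ y i # map ?S vs)))"
    using tensor_sum_in_slot[OF finite_lessThan dom.vector_space_axioms] by simp
  also have "\<dots> = (\<Sum>i<N. tscale (f i v) (tensor sm ((us @ [y i]) @ map ?S vs)))" by simp
  also have "\<dots> = (\<Sum>i<N. \<Sum>I\<in>words N (length vs).
      tscale (word_form f (i # I) (v # vs)) (tensor sm (us @ map y (i # I))))"
    unfolding Cons.IH by (simp add: tens.scale_sum_right)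
  finally show ?case by (simp add: sum_words_Suc)
qed

text \<open>For an elementary tensor the sum over the words in the first \<open>N\<close> letters is the tensor product of the
  \<open>N\<close>-th partial sums, to which \<open>tensor_difference_le\<close> applies. Both sides are linear in \<open>t\<close>.\<close>

lemma tensor_expansion_tendsto:
  assumes t: "t \<in> tensor_power sm n"
  shows "(\<lambda>N. P.tsem n (t - (\<Sum>I\<in>words N n. tscale (t (word_form f I)) (tensor sm (map y I))))) \<longlonglongrightarrow> 0"
proof -
  let ?R = "\<lambda>N t. t - (\<Sum>I\<in>words N n. tscale (t (word_form f I)) (tensor sm (map y I)))"
  have sumT: "(\<Sum>I\<in>words N n. tscale (c I) (tensor sm (map y I))) \<in> tensor_power sm n" for N c
    by (intro tens.subspace_sum tens.subspace_scale subspace_tensor_power tensor_in_power)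
      (simp add: words_def)
  have RT: "?R N t \<in> tensor_power sm n" if "t \<in> tensor_power sm n" for N t
    using that by (intro tens.subspace_diff subspace_tensor_power sumT)
  have "t \<in> tensor_power sm n \<and> (\<lambda>N. P.tsem n (?R N t)) \<longlonglongrightarrow> 0"
    using t unfolding tensor_power_def[of sm n]
  proof (induction rule: tens.span_induct_alt)
    case base
    have R0: "?R N 0 = 0" for N by (simp add: fun_eq_iff tscale_def sum_fun_apply)
    show ?case unfolding R0 P.tens_pow.seminorm_zero by (intro conjI tens.span_zero tendsto_const)
  next
    case (step c x t)
    then obtain vs where x: "x = tensor sm vs" and vs: "length vs = n" by blast
    have tT: "t \<in> tensor_power sm n" using step(2) by (simp add: tensor_power_def)
    have xT: "x \<in> tensor_power sm n" unfolding x using vs by (rule tensor_in_power)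
    let ?S = "\<lambda>N v. \<Sum>i<N. sm (f i v) (y i)"
    have Rx: "?R N x = tensor sm vs - tensor sm (map (?S N) vs)" for N
    proof -
      have "x (word_form f I) = word_form f I vs" if "I \<in> words N n" for I
        using that vs word_form_multilinear[of I] by (simp add: x tensor_def words_def)
      then show ?thesis using tensor_map_partial_sums[of "[]" N vs] vs by (simp add: x)
    qed
    let ?B = "\<lambda>N. prod_list (map2 (\<lambda>v w. p v + p (v - w)) vs (map (?S N) vs)) - prod_list (map p vs)"
    have "(\<lambda>N. prod_list (map2 (\<lambda>v w. p v + p (v - w)) vs (map (?S N) vs))) \<longlonglongrightarrow> prod_list (map p vs)"
    proof (induction vs)
      case (Cons v vs)
      have "(\<lambda>N. p v + p (v - ?S N v)) \<longlonglongrightarrow> p v + 0"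
        by (intro tendsto_add tendsto_const expansion_tendsto[OF expansion]) simp
      from tendsto_mult[OF this Cons.IH] show ?case by simp
    qed simp
    from tendsto_diff[OF this tendsto_const[of "prod_list (map p vs)"]]
    have B0: "?B \<longlonglongrightarrow> 0" by simp
    have "(\<lambda>N. norm c * ?B N + P.tsem n (?R N t)) \<longlonglongrightarrow> norm c * 0 + 0"
      by (intro tendsto_add tendsto_mult tendsto_const B0 step(2)[THEN conjunct2])
    then have lim: "(\<lambda>N. norm c * ?B N + P.tsem n (?R N t)) \<longlonglongrightarrow> 0" by simp
    have split: "?R N (tscale c x + t) = tscale c (?R N x) + ?R N t" for N
      by (simp add: fun_eq_iff tscale_def sum_fun_apply algebra_simps sum.distrib sum_distrib_left)
    have bound: "P.tsem n (?R N (tscale c x + t)) \<le> norm c * ?B N + P.tsem n (?R N t)" for N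
    proof -
      have "P.tsem n (?R N x) \<le> ?B N"
        unfolding Rx using P.tensor_difference_le[of vs "map (?S N) vs" "[]"] vs by simp
      then have "norm c * P.tsem n (?R N x) \<le> norm c * ?B N" by (rule mult_left_mono) simp
      moreover have "P.tsem n (tscale c (?R N x)) = norm c * P.tsem n (?R N x)"
        by (intro P.tens_pow.seminorm_scale RT xT)
      ultimately have x_le: "P.tsem n (tscale c (?R N x)) \<le> norm c * ?B N" by (simp only:)
      have "P.tsem n (?R N (tscale c x + t)) \<le> P.tsem n (tscale c (?R N x)) + P.tsem n (?R N t)"
        unfolding split by (intro P.tensor_seminorm_add tens.subspace_scale[OF subspace_tensor_power] RT xT tT)
      then show ?thesis by (rule order_trans) (intro add_right_mono x_le)
    qed
    have in_T: "tscale c x + t \<in> tensor_power sm n"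
      by (intro tens.subspace_add tens.subspace_scale subspace_tensor_power xT tT)
    moreover have "(\<lambda>N. P.tsem n (?R N (tscale c x + t))) \<longlonglongrightarrow> 0"
      using lim
    proof (rule tendsto_sandwich[OF _ _ tendsto_const, rotated 2])
      show "\<forall>\<^sub>F N in sequentially. 0 \<le> P.tsem n (?R N (tscale c x + t))"
        by (intro always_eventually allI P.tensor_seminorm_nonneg RT in_T)
      show "\<forall>\<^sub>F N in sequentially. P.tsem n (?R N (tscale c x + t)) \<le> norm c * ?B N + P.tsem n (?R N t)"
        by (intro always_eventually allI bound)
    qed
    ultimately show ?case by (simp only: tensor_power_def)
  qed
  then show ?thesis by blast
qed

text \<open>The factor \<open>n!\<^sup>R\<close> is put into the forms, where it is absorbed by \<open>q\<^sub>R\<close>; it is removed again from the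
  vectors \<open>word_tensor\<close>, whose weight is then independent of \<open>R\<close>.\<close>

definition word_coeff :: "real \<Rightarrow> nat list \<Rightarrow> (nat \<Rightarrow> ('k, 'v) tensor) \<Rightarrow> 'k" where
  "word_coeff R I t = of_real (fact (length I) powr R) * t (length I) (word_form f I)"

definition word_tensor :: "real \<Rightarrow> nat list \<Rightarrow> nat \<Rightarrow> ('k, 'v) tensor" where
  "word_tensor R I n =
     (if n = length I then tscale (of_real (1 / fact n powr R)) (tensor sm (map y I)) else 0)"

lemma word_tensor_in_algebra: "word_tensor R I \<in> tensor_algebra sm"
proof -
  have "word_tensor R I n \<in> tensor_power sm n" for n
    using tens.subspace_0[OF subspace_tensor_power]
    by (auto simp: word_tensor_def intro!: tens.subspace_scale[OF subspace_tensor_power] tensor_in_power)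
  moreover have "{n. word_tensor R I n \<noteq> 0} \<subseteq> {length I}" by (auto simp: word_tensor_def)
  then have "finite {n. word_tensor R I n \<noteq> 0}" by (rule finite_subset) simp
  ultimately show ?thesis by (simp add: tensor_algebra_def)
qed

lemma graded_seminorm_word_tensor: "graded_seminorm sm R p (word_tensor R I) \<le> prod_list (map (\<lambda>i. p (y i)) I)"
proof -
  let ?n = "length I"
  have T: "tensor sm (map y I) \<in> tensor_power sm ?n" by (simp add: tensor_in_power)
  have "graded_seminorm sm R p (word_tensor R I) = (\<Sum>n\<in>{?n}. P.tsem n (word_tensor R I n) * fact n powr R)"
    by (rule P.graded_seminorm_eq_sum) (simp_all add: word_tensor_def)
  also have "\<dots> = norm (of_real (1 / fact ?n powr R) :: 'k) * P.tsem ?n (tensor sm (map y I)) * fact ?n powr R"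
    by (simp add: word_tensor_def P.tens_pow.seminorm_scale[OF T] del: of_real_divide)
  also have "norm (of_real (1 / fact ?n powr R) :: 'k) = 1 / fact ?n powr R"
    by (simp only: norm_of_real) simp
  also have "1 / fact ?n powr R * P.tsem ?n (tensor sm (map y I)) * fact ?n powr R = P.tsem ?n (tensor sm (map y I))"
    by simp
  also have "\<dots> \<le> prod_list (map p (map y I))" by (rule P.tensor_seminorm_tensor) simp
  finally show ?thesis by (simp add: o_def)
qed

text \<open>The words of length \<open>n\<close> have total weight \<open>(\<Sum>\<^sub>i p (y\<^sub>i))\<^sup>n \<le> (1/2)\<^sup>n\<close>.\<close>

lemma summable_words: "(\<lambda>I. prod_list (map (\<lambda>i. p (y i)) I)) summable_on UNIV"
proof (rule nonneg_bounded_partial_sums_imp_summable_on)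
  have b0: "0 \<le> p (y i)" for i by (simp add: cod.seminorm_nonneg)
  then show nn: "0 \<le> prod_list (map (\<lambda>i. p (y i)) I)" for I by (induction I) simp_all
  have sumy: "(\<lambda>i. p (y i)) summable_on UNIV" using expansion by (simp add: nuclear_expansion_def)
  have le: "(\<Sum>i<N. p (y i)) \<le> 1 / 2" for N
    using finite_sum_le_infsum[OF sumy, of "{..<N}"] half b0 by simp
  have "(\<Sum>I\<in>A. prod_list (map (\<lambda>i. p (y i)) I)) \<le> 2" if A: "finite A" for A
  proof -
    define N where "N = Suc (Max (insert 0 (\<Union>(set ` A))))"
    define M where "M = Suc (Max (insert 0 (length ` A)))"
    have "i < N" if "I \<in> A" "i \<in> set I" for i I
      using that A unfolding N_def less_Suc_eq_le by (intro Max_ge) auto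
    moreover have "length I < M" if "I \<in> A" for I
      using that A unfolding M_def less_Suc_eq_le by (intro Max_ge) auto
    ultimately have "A \<subseteq> (\<Union>n<M. words N n)" by (auto simp: words_def)
    then have "(\<Sum>I\<in>A. prod_list (map (\<lambda>i. p (y i)) I)) \<le> (\<Sum>I\<in>(\<Union>n<M. words N n). prod_list (map (\<lambda>i. p (y i)) I))"
      using nn by (intro sum_mono2) auto
    also have "\<dots> = (\<Sum>n<M. \<Sum>I\<in>words N n. prod_list (map (\<lambda>i. p (y i)) I))"
      by (rule sum.UNION_disjoint) (simp_all, auto simp: words_def)
    also have "\<dots> = (\<Sum>n<M. (\<Sum>i<N. p (y i)) ^ n)" by (simp add: sum_words_prod_list)
    also have "\<dots> \<le> (\<Sum>n<M. (1 / 2) ^ n)"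
      by (intro sum_mono power_mono le sum_nonneg b0)
    also have "\<dots> \<le> (\<Sum>n. (1 / 2) ^ n)" by (rule sum_le_suminf) simp_all
    also have "\<dots> = 2" by (simp add: suminf_geometric)
    finally show ?thesis .
  qed
  then show "\<forall>\<^sub>F A in finite_subsets_at_top UNIV. (\<Sum>I\<in>A. prod_list (map (\<lambda>i. p (y i)) I)) \<le> 2"
    by (intro eventually_finite_subsets_at_top_weakI) auto
qed

text \<open>Use all words in the first \<open>N\<close> letters of length less than \<open>M\<close>, where \<open>M\<close> exceeds the degree of \<open>t\<close> and
  \<open>N\<close> is large.\<close>

lemma tensor_algebra_expansion_approx:
  assumes t: "t \<in> tensor_algebra sm" and A: "finite A" and e: "0 < e"
  shows "\<exists>B. finite B \<and> A \<subseteq> B \<and>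
    graded_seminorm sm R p (t - (\<Sum>I\<in>B. gscale (word_coeff R I t) (word_tensor R I))) < e"
proof -
  have tn: "t n \<in> tensor_power sm n" for n using t by (simp add: tensor_algebra_def)
  define N0 where "N0 = Suc (Max (insert 0 (\<Union>(set ` A))))"
  define M where "M = Suc (Max (insert 0 (length ` A \<union> {n. t n \<noteq> 0})))"
  have fin: "finite {n. t n \<noteq> 0}" using t by (simp add: tensor_algebra_def)
  have N0: "i < N0" if "I \<in> A" "i \<in> set I" for i I
    using that A unfolding N0_def less_Suc_eq_le by (intro Max_ge) auto
  have MA: "length I < M" if "I \<in> A" for I
    using that A fin unfolding M_def less_Suc_eq_le by (intro Max_ge) auto
  have Mt: "t n = 0" if "n \<notin> {..<M}" for n
  proof (rule ccontr)
    assume "t n \<noteq> 0"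
    then have "n < M" using A fin unfolding M_def less_Suc_eq_le by (intro Max_ge) auto
    then show False using that by simp
  qed
  let ?r = "\<lambda>N n. t n - (\<Sum>I\<in>words N n. tscale (t n (word_form f I)) (tensor sm (map y I)))"
  have "(\<lambda>N. \<Sum>n<M. P.tsem n (?r N n) * fact n powr R) \<longlonglongrightarrow> (\<Sum>n<M. 0 * fact n powr R)"
    by (intro tendsto_intros tensor_expansion_tendsto tn)
  then have "\<forall>\<^sub>F N in sequentially. (\<Sum>n<M. P.tsem n (?r N n) * fact n powr R) < e"
    using order_tendstoD(2)[of _ 0 _ e] e by simp
  from eventually_conj[OF this eventually_ge_at_top[of N0]]
  obtain N where N: "(\<Sum>n<M. P.tsem n (?r N n) * fact n powr R) < e" "N0 \<le> N"
    unfolding eventually_sequentially by blast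
  define B where "B = (\<Union>n<M. words N n)"
  have B: "finite B" by (simp add: B_def)
  have AB: "A \<subseteq> B"
  proof
    fix I assume "I \<in> A"
    then have "I \<in> words N (length I)" using N0 N(2) by (force simp: words_def)
    then show "I \<in> B" using MA[OF \<open>I \<in> A\<close>] by (auto simp: B_def)
  qed
  let ?d = "t - (\<Sum>I\<in>B. gscale (word_coeff R I t) (word_tensor R I))"
  have comp: "(\<Sum>I\<in>B. gscale (word_coeff R I t) (word_tensor R I)) n =
      (if n < M then \<Sum>I\<in>words N n. tscale (t n (word_form f I)) (tensor sm (map y I)) else 0)" for n
  proof -
    have "(\<Sum>I\<in>B. gscale (word_coeff R I t) (word_tensor R I)) n =
        (\<Sum>I\<in>B. tscale (word_coeff R I t) (word_tensor R I n))"
      by (simp add: sum_fun_apply gscale_def)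
    also have "\<dots> = (\<Sum>I\<in>{I \<in> B. length I = n}. tscale (word_coeff R I t) (word_tensor R I n))"
      using B by (intro sum.mono_neutral_right) (auto simp: word_tensor_def)
    also have "\<dots> = (\<Sum>I\<in>{I \<in> B. length I = n}. tscale (t n (word_form f I)) (tensor sm (map y I)))"
    proof (rule sum.cong[OF refl])
      fix I assume "I \<in> {I \<in> B. length I = n}"
      then have n: "length I = n" by simp
      have "of_real (fact n powr R) * of_real (1 / fact n powr R) = (1 :: 'k)"
        by (simp only: of_real_mult[symmetric]) simp
      then have "word_coeff R I t * of_real (1 / fact n powr R) = t n (word_form f I)"
        by (simp add: word_coeff_def n mult.commute mult.left_commute del: of_real_divide)
      then show "tscale (word_coeff R I t) (word_tensor R I n) = tscale (t n (word_form f I)) (tensor sm (map y I))"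
        by (simp add: word_tensor_def n del: of_real_divide)
    qed
    also have "{I \<in> B. length I = n} = (if n < M then words N n else {})"
      by (auto simp: B_def words_def)
    finally show ?thesis by (cases "n < M") (simp_all only: if_True if_False sum.empty)
  qed
  have "graded_seminorm sm R p ?d = (\<Sum>n<M. P.tsem n (?d n) * fact n powr R)"
    by (rule P.graded_seminorm_eq_sum) (simp_all add: comp Mt)
  also have "\<dots> = (\<Sum>n<M. P.tsem n (?r N n) * fact n powr R)"
    by (intro sum.cong refl) (simp add: comp)
  finally have "graded_seminorm sm R p ?d < e" using N(1) by simp
  then show ?thesis using B AB by blast
qed

lemma tensor_algebra_expansion:
  "nuclear_expansion gscale (tensor_algebra sm) (graded_seminorm sm R q) (graded_seminorm sm R p)
     (word_coeff R) (word_tensor R)"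
proof -
  have "dominated_form gscale (tensor_algebra sm) (graded_seminorm sm R q) (word_coeff R I)" for I
    unfolding dominated_form_def
  proof (intro conjI ballI allI)
    fix t c assume t: "t \<in> tensor_algebra sm"
    then have tn: "t (length I) \<in> tensor_power sm (length I)" by (simp add: tensor_algebra_def)
    show "word_coeff R I (t + t') = word_coeff R I t + word_coeff R I t'" for t'
      by (simp add: word_coeff_def distrib_left)
    show "word_coeff R I (gscale c t) = c * word_coeff R I t"
      by (simp add: word_coeff_def gscale_def tscale_def)
    have "norm (word_coeff R I t) = norm (t (length I) (word_form f I)) * fact (length I) powr R"
      by (simp add: word_coeff_def norm_mult)
    also have "\<dots> \<le> Q.tsem (length I) (t (length I)) * fact (length I) powr R"
      by (intro mult_right_mono norm_eval_word_form_le tn) simp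
    also have "\<dots> \<le> graded_seminorm sm R q t" by (rule Q.component_le_graded_seminorm[OF t])
    finally show "norm (word_coeff R I t) \<le> graded_seminorm sm R q t" .
  qed
  moreover have "range (word_tensor R) \<subseteq> tensor_algebra sm" using word_tensor_in_algebra by blast
  moreover have "(\<lambda>I. graded_seminorm sm R p (word_tensor R I)) summable_on UNIV"
  proof (rule summable_on_comparison_test[OF summable_words])
    interpret G: seminormed_space gscale "tensor_algebra sm" "graded_seminorm sm R p"
      by (rule P.graded_seminormed_space)
    show "graded_seminorm sm R p (word_tensor R I) \<le> prod_list (map (\<lambda>i. p (y i)) I)" for I
      by (rule graded_seminorm_word_tensor)
    show "0 \<le> graded_seminorm sm R p (word_tensor R I)" for I
      by (rule G.seminorm_nonneg[OF word_tensor_in_algebra])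
  qed
  ultimately show ?thesis
    unfolding nuclear_expansion_def using tensor_algebra_expansion_approx by simp
qed

end

context graded_locally_convex_space
begin

text \<open>Multiplying \<open>q\<close> and the forms by \<open>c\<close> and dividing the vectors by \<open>c\<close> leaves the expansion unchanged and
  divides the total weight \<open>s\<close> by \<open>c\<close>. The choice \<open>c = 2 s + 1\<close> gives \<open>s / c \<le> 1 / 2\<close> and \<open>c \<ge> 1\<close>, so that
  \<open>p \<le> c q\<close> remains true.\<close>

lemma nuclear_seminorm_pair_exists:
  assumes nuc: "nuclear_space sm X" and p: "continuous_seminorm sm X p"
  shows "\<exists>q f y. continuous_seminorm sm X q \<and> nuclear_seminorm_pair sm q p f y"
proof -
  obtain q where q: "continuous_seminorm sm X q" and pq: "\<forall>v. p v \<le> q v"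
    and "\<exists>(f :: nat \<Rightarrow> 'v \<Rightarrow> 'k) y. nuclear_expansion sm UNIV q p f y"
    using nuc[unfolded nuclear_space_iff_expansion[OF vector_space_axioms subspace_topspace]
        topspace_UNIV, rule_format, OF p] by blast
  then obtain f :: "nat \<Rightarrow> 'v \<Rightarrow> 'k" and y where exp: "nuclear_expansion sm UNIV q p f y" by blast
  interpret q: seminorm_UNIV sm q by (rule continuous_seminorm_UNIV[OF q])
  interpret p: seminorm_UNIV sm p by (rule continuous_seminorm_UNIV[OF p])
  define s where "s = (\<Sum>\<^sub>\<infinity>i. p (y i))"
  have s0: "0 \<le> s" unfolding s_def by (rule infsum_nonneg) (simp add: p.seminorm_nonneg)
  define c where "c = 2 * s + 1"
  have c: "1 \<le> c" "0 < c" using s0 by (simp_all add: c_def)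
  define k :: 'k where "k = of_real c"
  have k: "k \<noteq> 0" "norm k = c" using c by (simp_all add: k_def)
  let ?q = "\<lambda>v. c * q v" and ?f = "\<lambda>i v. k * f i v" and ?y = "\<lambda>i. sm (1 / k) (y i)"
  have cq: "continuous_seminorm sm X ?q" using c by (intro continuous_seminorm_mult q) simp
  interpret cq: seminorm_UNIV sm ?q by (rule continuous_seminorm_UNIV[OF cq])
  have py: "p (?y i) = p (y i) / c" for i by (simp add: p.seminorm_scale norm_divide k)
  have sumy: "(\<lambda>i. p (y i)) summable_on UNIV" using exp by (simp add: nuclear_expansion_def)
  have "nuclear_expansion sm UNIV ?q p ?f ?y"
    unfolding nuclear_expansion_def
  proof (intro conjI allI ballI)
    show "dominated_form sm UNIV ?q (?f i)" for i
      using exp c by (auto simp: nuclear_expansion_def dominated_form_def distrib_left norm_mult k mult_left_mono)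
    show "range ?y \<subseteq> UNIV" by simp
    show "(\<lambda>i. p (?y i)) summable_on UNIV"
      unfolding py divide_real_def by (rule summable_on_cmult_left[OF sumy])
    show "finite A \<and> 0 < e \<longrightarrow> (\<exists>B. finite B \<and> A \<subseteq> B \<and> p (x - (\<Sum>i\<in>B. sm (?f i x) (?y i))) < e)" for x A e
      using exp k by (simp add: nuclear_expansion_def)
  qed
  moreover have "(\<Sum>\<^sub>\<infinity>i. p (?y i)) \<le> 1 / 2"
  proof -
    have "(\<Sum>\<^sub>\<infinity>i. p (?y i)) = s / c"
      unfolding py divide_real_def s_def by (rule infsum_cmult_left) (rule sumy)
    moreover have "s / c \<le> 1 / 2" using s0 by (simp add: c_def field_simps)
    ultimately show ?thesis by (simp only:)
  qed
  moreover have "p v \<le> ?q v" for v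
  proof -
    have "1 * q v \<le> c * q v" using c by (intro mult_right_mono q.seminorm_nonneg) simp_all
    then show ?thesis using pq by (metis mult_1 order_trans)
  qed
  then have "seminormed_pair sm UNIV ?q p"
    by unfold_locales simp
  ultimately have "nuclear_seminorm_pair sm ?q p ?f ?y"
    by (simp add: nuclear_seminorm_pair_def nuclear_seminorm_pair_axioms_def)
  then show ?thesis using cq by blast
qed

lemma nuclear_tensor_algebra_if_nuclear:
  assumes nuc: "nuclear_space sm X"
  shows "nuclear_space gscale (TR R)"
proof -
  have sub: "grad.subspace (topspace (TR R))"
    by (simp add: topspace_tensor_algebra_topology subspace_tensor_algebra)
  show ?thesis
    unfolding nuclear_space_iff_expansion[OF vector_space_gscale sub] topspace_tensor_algebra_topology
  proof (intro allI impI)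
    fix P assume P: "continuous_seminorm gscale (TR R) P"
    have P': "continuous_seminorm gscale (subtopology (TR R) TA) P" using P TR_eq_subtopology[of R] by simp
    obtain p K where p: "continuous_seminorm sm X p" and K: "1 \<le> K"
      and PK: "\<forall>t\<in>TA. P t \<le> K * graded_seminorm sm R p t"
      using continuous_seminorm_dominated[OF P' subspace_tensor_algebra subset_refl] by blast
    obtain q f y where q: "continuous_seminorm sm X q" and "nuclear_seminorm_pair sm q p f y"
      using nuclear_seminorm_pair_exists[OF nuc p] by blast
    interpret nuclear_seminorm_pair sm q p f y by fact
    interpret GP: seminormed_space gscale TA "graded_seminorm sm R p" by (rule P.graded_seminormed_space)
    interpret GQ: seminormed_space gscale TA "graded_seminorm sm R q" by (rule Q.graded_seminormed_space)
    interpret S: seminormed_space gscale TA P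
      using seminormed_spaceI[OF vector_space_gscale sub P] by (simp add: topspace_tensor_algebra_topology)
    let ?Q = "\<lambda>t. K * graded_seminorm sm R q t"
    have Q: "continuous_seminorm gscale (TR R) ?Q"
      using K by (subst TR_eq_subtopology) (intro continuous_graded_seminorm q, simp_all)
    have le: "P t \<le> ?Q t" if t: "t \<in> TA" for t
    proof -
      have "graded_seminorm sm R p t \<le> graded_seminorm sm R q t"
        using le t by (intro Q.graded_seminorm_mono P.seminorm_UNIV_axioms) simp_all
      then have "K * graded_seminorm sm R p t \<le> ?Q t" using K by simp
      then show ?thesis using PK t by (meson order_trans)
    qed
    have id: "linear_between gscale TA gscale TA (\<lambda>t. t)" by (simp add: linear_between_def)
    have "nuclear_expansion gscale TA ?Q P (\<lambda>I t. word_coeff R I t) (\<lambda>I. word_tensor R I)"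
    proof (rule nuclear_expansion_transfer[OF tensor_algebra_expansion GP.seminormed_space_axioms
          S.seminormed_space_axioms id id, of ?Q K])
      show "graded_seminorm sm R q t \<le> ?Q t" if "t \<in> TA" for t
        using mult_right_mono[OF K GQ.seminorm_nonneg[OF that]] by simp
    qed (use K PK in simp_all)
    moreover have "bij (from_nat_into (UNIV :: nat list set))"
      by (intro bij_betw_from_nat_into) (simp_all add: infinite_UNIV_listI)
    ultimately have "nuclear_expansion gscale TA ?Q P (word_coeff R \<circ> from_nat_into UNIV) (word_tensor R \<circ> from_nat_into UNIV)"
      by (intro nuclear_expansion_reindex) simp_all
    then show "\<exists>Q. continuous_seminorm gscale (TR R) Q \<and> (\<forall>t\<in>TA. P t \<le> Q t) \<and>
        (\<exists>(f :: nat \<Rightarrow> _ \<Rightarrow> 'k) y. nuclear_expansion gscale TA Q P f y)"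
      using Q le by blast
  qed
qed

end

section \<open>The equivalence\<close>

theorem theorem4p10:
  fixes sm :: "'k::real_or_complex \<Rightarrow> 'v::ab_group_add \<Rightarrow> 'v"
    and X :: "'v topology" and V0 V1 :: "'v set" and R :: real
  assumes "graded_locally_convex_space sm X V0 V1"
    and "R \<ge> 0"
  shows "(nuclear_space sm X \<longleftrightarrow> nuclear_space gscale (tensor_algebra_topology sm X R)) \<and>
    (nuclear_space gscale (tensor_algebra_topology sm X R) \<longleftrightarrow>
       nuclear_space gscale (weyl_algebra_topology sm X V0 V1 R))"
proof -
  interpret graded_locally_convex_space sm X V0 V1 by fact
  show ?thesis
    using nuclear_tensor_algebra_if_nuclear nuclear_weyl_if_nuclear_tensor_algebra
      nuclear_if_nuclear_weyl by blast
qed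

end
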